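(* Let $\rho(t,x)$ be such that $\rho^{\varepsilon_k}\to\rho$ strongly in $L^p(0,T;W^{-1,1}(\Omega))$ (for some $p\in[1,\infty)$ and every $T>0$) for some sequence $\varepsilon_k\to0$. For almost every $t>0$ (those for which $x\mapsto\rho(t,x)$ is well defined in $L^\infty(\Omega)$) let $$\Sigma(t)=\Big\{x\in\Omega\,:\,\exists r>0,\ \int_{B_r(x)\cap\Omega}[1-\rho(t,y)]\,dy=0\Big\}.$$ Then $\Sigma(t)$ is non-decreasing in $t$: $\Sigma(s)\subset\Sigma(t)$ whenever $0<s<t$ (for all such $s,t$ outside a set of measure zero).
   Context: $W^{-1,1}(\Omega)$ is the space of distributions $f_0+\partial_xf_1$ with $f_0,f_1\in L^1(\Omega)$, with the usual (infimum) norm. $B_r(x)=(x-r,x+r)$. Let $\Omega\subset\mathbb R$ be a bounded open interval, $n\in(0,3)$, and $u_{in}\in H^1(\Omega)$ with $u_{in}\ge 0$, $\int_\Omega u_{in}\,dx=1$. For $\varepsilon\in(0,1/2]$ the thin film problem is $|\ln\varepsilon|^{-1}\partial_t u+\partial_x\big((\varepsilon^{3-n}u^n+u^3)\partial_{xxx}u\big)=0$ in $(0,\infty)\times\Omega$, with $(\varepsilon^{3-n}u^n+u^3)u_{xxx}=0$ and $u_x=0$ on $(0,\infty)\times\partial\Omega$, and $u(0,\cdot)=u_{in}$. (Weak form: $|\ln\varepsilon|^{-1}\big(\int_0^\infty\!\int_\Omega u\psi_t+\int_\Omega u_{in}\psi(0,\cdot)\big)+\iint_{\{u>0\}}(\varepsilon^{3-n}u^n+u^3)u_{xxx}\psi_x=0$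 for all $\psi\in C_c^\infty([0,\infty)\times\overline\Omega)$.) Let $B(s)=\int_0^s\int_r^\infty\frac{1}{v^{n-1}+v^2}\,dv\,dr$ and $B^\varepsilon(s)=|\ln\varepsilon|^{-1}B(s/\varepsilon)$. For each $\varepsilon$, $u^\varepsilon$ denotes a fixed continuous non-negative weak solution such that, with $\rho^\varepsilon:=B^\varepsilon(u^\varepsilon)$, for every $T>0$: (i) $u^\varepsilon\in L^\infty((0,T);H^1(\Omega))$, $u^\varepsilon u^\varepsilon_{xxx}\in L^2((0,T)\times\Omega)$; (ii) $\int_\Omega u^\varepsilon(t)\,dx=\int_\Omega u_{in}\,dx$ for all $t>0$; (iii) $\frac12\int_\Omega|u^\varepsilon_x(t)|^2dx+\int_0^t\int_{\{u^\varepsilon>0\}}|\ln\varepsilon|(\varepsilon^{3-n}(u^\varepsilon)^n+(u^\varepsilon)^3)|u^\varepsilon_{xxx}|^2dx\,ds\le\frac12\int_\Omega|\partial_xu_{in}|^2dx$ for all $t>0$; (iv) $\int_\Omega\rho^\varepsilon(t)\,dx\ge\int_0^t\int_\Omega u^\varepsilon|u^\varepsilon_{xx}|^2dx\,ds+\int_\Omega\rho^\varepsilon(0)\,dx$ for all $t>0$ (with $u^\varepsilon|u^\varepsilon_{xx}|^2:=0$ on $\{u^\varepsilon=0\}$); (v) $u^\varepsilon\in L^2((0,T);H^2(\Omega))$ if $n<2$, and $(u^\varepsilon)^{3/2}\in L^2((0,T);H^2(\Omega))$, $((u^\varepsilon)^{3/4})_x\in L^4((0,T)\times\Omega)$ if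 $n\ge2$; for a.e. $t$, $u^\varepsilon(t,\cdot)\in C^1(\overline\Omega)$ with $u^\varepsilon_x=0$ on $\partial\Omega$; (vi) $\partial_t\rho^\varepsilon=T^\varepsilon+\partial_xR^\varepsilon$ in the sense of distributions, where $T^\varepsilon=-u^\varepsilon_x\,u^\varepsilon u^\varepsilon_{xxx}\in L^2((0,T);L^1(\Omega))$, $R^\varepsilon=-|\ln\varepsilon|(B^\varepsilon)'(u^\varepsilon)(\varepsilon^{3-n}(u^\varepsilon)^{n-1}+(u^\varepsilon)^2)u^\varepsilon u^\varepsilon_{xxx}$, and for a.e. $t$ and all $\varphi\in C^\infty(\overline\Omega)$, $\langle T^\varepsilon(t),\varphi\rangle=\int_\Omega u^\varepsilon(u^\varepsilon_{xx})^2\varphi\,dx-\frac56\int_\Omega(u^\varepsilon_x)^3\varphi'\,dx-\frac12\int_\Omega u^\varepsilon(u^\varepsilon_x)^2\varphi''\,dx$. *)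

theory Defs
  imports "HOL-Analysis.Analysis"
begin

section \<open>Smooth functions and test functions\<close>

text \<open>The greatest predicate such that a smooth function is differentiable everywhere and all its
  directional derivatives are smooth again, i.e. the class of C-infinity functions.\<close>

coinductive smooth :: "('a::euclidean_space \<Rightarrow> real) \<Rightarrow> bool" where
  "\<lbrakk>\<forall>x. f differentiable (at x); \<forall>v. smooth (\<lambda>x. frechet_derivative f (at x) v)\<rbrakk> \<Longrightarrow> smooth f"

definition supp :: "('a::euclidean_space \<Rightarrow> real) \<Rightarrow> 'a set" where
  "supp f = closure {x. f x \<noteq> 0}"

definition test_fun :: "'a::euclidean_space set \<Rightarrow> ('a \<Rightarrow> real) \<Rightarrow> bool" where
  "test_fun U \<phi> \<longleftrightarrow> smooth \<phi> \<and> compact (supp \<phi>) \<and> supp \<phi> \<subseteq> U"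

text \<open>Points of space-time are pairs \<open>(t, x)\<close>.\<close>

definition dt :: "(real \<times> real \<Rightarrow> real) \<Rightarrow> real \<times> real \<Rightarrow> real" where
  "dt \<psi> z = frechet_derivative \<psi> (at z) (1, 0)"

definition dx :: "(real \<times> real \<Rightarrow> real) \<Rightarrow> real \<times> real \<Rightarrow> real" where
  "dx \<psi> z = frechet_derivative \<psi> (at z) (0, 1)"

section \<open>Lebesgue and Sobolev spaces\<close>

definition Lp :: "real \<Rightarrow> 'a::euclidean_space set \<Rightarrow> ('a \<Rightarrow> real) \<Rightarrow> bool" where
  "Lp p A f \<longleftrightarrow> set_borel_measurable lborel A f \<and> set_integrable lborel A (\<lambda>x. \<bar>f x\<bar> powr p)"

definition Linf :: "'a::euclidean_space set \<Rightarrow> ('a \<Rightarrow> real) \<Rightarrow> bool" where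
  "Linf A f \<longleftrightarrow> set_borel_measurable lborel A f \<and> (\<exists>C. AE x\<in>A in lborel. \<bar>f x\<bar> \<le> C)"

definition loc_integrable :: "'a::euclidean_space set \<Rightarrow> ('a \<Rightarrow> real) \<Rightarrow> bool" where
  "loc_integrable U f \<longleftrightarrow> (\<forall>K. compact K \<and> K \<subseteq> U \<longrightarrow> set_integrable lborel K f)"

definition weak_deriv :: "real set \<Rightarrow> (real \<Rightarrow> real) \<Rightarrow> (real \<Rightarrow> real) \<Rightarrow> bool" where
  "weak_deriv U f g \<longleftrightarrow> loc_integrable U f \<and> loc_integrable U g \<and>
     (\<forall>\<phi>. test_fun U \<phi> \<longrightarrow> (LINT x:U|lborel. f x * deriv \<phi> x) = - (LINT x:U|lborel. g x * \<phi> x))"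

definition in_H1 :: "real set \<Rightarrow> (real \<Rightarrow> real) \<Rightarrow> bool" where
  "in_H1 U f \<longleftrightarrow> Lp 2 U f \<and> (\<exists>f1. weak_deriv U f f1 \<and> Lp 2 U f1)"

text \<open>For functions of \<open>(t, x)\<close>, the spaces \<open>L\<^sup>q((0,T); X)\<close> with a separable function space \<open>X\<close> are
  described by jointly measurable functions with jointly measurable weak \<open>x\<close>-derivatives.\<close>

definition Linf_H1 :: "real \<Rightarrow> real set \<Rightarrow> (real \<Rightarrow> real \<Rightarrow> real) \<Rightarrow> bool" where
  "Linf_H1 T U f \<longleftrightarrow> (\<exists>f1.
     set_borel_measurable lborel ({0<..<T} \<times> U) (\<lambda>(t, x). f t x) \<and>
     set_borel_measurable lborel ({0<..<T} \<times> U) (\<lambda>(t, x). f1 t x) \<and>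
     (\<exists>C. AE t\<in>{0<..<T} in lborel. weak_deriv U (f t) (f1 t) \<and> Lp 2 U (f t) \<and> Lp 2 U (f1 t) \<and>
        (LINT x:U|lborel. (f t x)\<^sup>2) + (LINT x:U|lborel. (f1 t x)\<^sup>2) \<le> C))"

definition L2_H2 :: "real \<Rightarrow> real set \<Rightarrow> (real \<Rightarrow> real \<Rightarrow> real) \<Rightarrow> bool" where
  "L2_H2 T U f \<longleftrightarrow> (\<exists>f1 f2.
     (AE t\<in>{0<..<T} in lborel. weak_deriv U (f t) (f1 t) \<and> weak_deriv U (f1 t) (f2 t)) \<and>
     Lp 2 ({0<..<T} \<times> U) (\<lambda>(t, x). f t x) \<and>
     Lp 2 ({0<..<T} \<times> U) (\<lambda>(t, x). f1 t x) \<and>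
     Lp 2 ({0<..<T} \<times> U) (\<lambda>(t, x). f2 t x))"

definition deriv_in_Lp :: "real \<Rightarrow> real \<Rightarrow> real set \<Rightarrow> (real \<Rightarrow> real \<Rightarrow> real) \<Rightarrow> bool" where
  "deriv_in_Lp p T U f \<longleftrightarrow> (\<exists>f1.
     (AE t\<in>{0<..<T} in lborel. weak_deriv U (f t) (f1 t)) \<and>
     Lp p ({0<..<T} \<times> U) (\<lambda>(t, x). f1 t x))"

definition L2_L1 :: "real \<Rightarrow> real set \<Rightarrow> (real \<Rightarrow> real \<Rightarrow> real) \<Rightarrow> bool" where
  "L2_L1 T U f \<longleftrightarrow>
     set_borel_measurable lborel ({0<..<T} \<times> U) (\<lambda>(t, x). f t x) \<and>
     (\<integral>\<^sup>+t\<in>{0<..<T}. (\<integral>\<^sup>+x\<in>U. ennreal \<bar>f t x\<bar> \<partial>lborel)\<^sup>2 \<partial>lborel) < \<infinity>"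

section \<open>Distributions and the space \<open>W\<^sup>-\<^sup>1\<^sup>,\<^sup>1\<close>\<close>

text \<open>Distributions are functionals of which only the values on test functions matter.\<close>

type_synonym distr = "(real \<Rightarrow> real) \<Rightarrow> real"

definition distr_of :: "real set \<Rightarrow> (real \<Rightarrow> real) \<Rightarrow> distr" where
  "distr_of U f = (\<lambda>\<phi>. LINT x:U|lborel. f x * \<phi> x)"

text \<open>\<open>F = f0 + \<partial>\<^sub>x f1\<close> in the sense of distributions.\<close>

definition W_rep :: "real set \<Rightarrow> distr \<Rightarrow> (real \<Rightarrow> real) \<Rightarrow> (real \<Rightarrow> real) \<Rightarrow> bool" where
  "W_rep U F f0 f1 \<longleftrightarrow> Lp 1 U f0 \<and> Lp 1 U f1 \<and>
     (\<forall>\<phi>. test_fun U \<phi> \<longrightarrow>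
        F \<phi> = (LINT x:U|lborel. f0 x * \<phi> x) - (LINT x:U|lborel. f1 x * deriv \<phi> x))"

definition in_W :: "real set \<Rightarrow> distr \<Rightarrow> bool" where
  "in_W U F \<longleftrightarrow> (\<exists>f0 f1. W_rep U F f0 f1)"

definition W_norm :: "real set \<Rightarrow> distr \<Rightarrow> real" where
  "W_norm U F = Inf {(LINT x:U|lborel. \<bar>f0 x\<bar>) + (LINT x:U|lborel. \<bar>f1 x\<bar>) | f0 f1. W_rep U F f0 f1}"

definition W_simple :: "real \<Rightarrow> real set \<Rightarrow> (real \<Rightarrow> distr) \<Rightarrow> bool" where
  "W_simple T U S \<longleftrightarrow> finite (S ` {0<..<T}) \<and> (\<forall>t\<in>{0<..<T}. in_W U (S t)) \<and>
     (\<forall>G. {t\<in>{0<..<T}. S t = G} \<in> sets lborel)"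

text \<open>The Bochner space \<open>L\<^sup>p((0,T); W\<^sup>-\<^sup>1\<^sup>,\<^sup>1)\<close>: strong measurability, that is almost everywhere
  approximation by simple functions, and integrability of the \<open>p\<close>-th power of the norm.\<close>

definition in_Lp_W :: "real \<Rightarrow> real \<Rightarrow> real set \<Rightarrow> (real \<Rightarrow> distr) \<Rightarrow> bool" where
  "in_Lp_W p T U F \<longleftrightarrow>
     (AE t\<in>{0<..<T} in lborel. in_W U (F t)) \<and>
     (\<exists>S :: nat \<Rightarrow> real \<Rightarrow> distr. (\<forall>j. W_simple T U (S j)) \<and>
        (AE t\<in>{0<..<T} in lborel. (\<lambda>j. W_norm U (\<lambda>\<phi>. S j t \<phi> - F t \<phi>)) \<longlonglongrightarrow> 0)) \<and>
     (\<integral>\<^sup>+t\<in>{0<..<T}. ennreal (W_norm U (F t) powr p) \<partial>lborel) < \<infinity>"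

definition converges_Lp_W ::
  "real \<Rightarrow> real \<Rightarrow> real set \<Rightarrow> (nat \<Rightarrow> real \<Rightarrow> distr) \<Rightarrow> (real \<Rightarrow> distr) \<Rightarrow> bool" where
  "converges_Lp_W p T U Fs F \<longleftrightarrow> (\<forall>k. in_Lp_W p T U (Fs k)) \<and> in_Lp_W p T U F \<and>
     (\<lambda>k. \<integral>\<^sup>+t\<in>{0<..<T}. ennreal (W_norm U (\<lambda>\<phi>. Fs k t \<phi> - F t \<phi>) powr p) \<partial>lborel) \<longlonglongrightarrow> 0"

definition Linf_rep :: "real set \<Rightarrow> distr \<Rightarrow> (real \<Rightarrow> real) \<Rightarrow> bool" where
  "Linf_rep U F g \<longleftrightarrow> Linf U g \<and> (\<forall>\<phi>. test_fun U \<phi> \<longrightarrow> F \<phi> = distr_of U g \<phi>)"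

section \<open>The thin film problem\<close>

definition mobility :: "real \<Rightarrow> real \<Rightarrow> real \<Rightarrow> real" where
  "mobility n \<epsilon> s = \<epsilon> powr (3 - n) * s powr n + s ^ 3"

definition B :: "real \<Rightarrow> real \<Rightarrow> real" where
  "B n s = (LINT r:{0..s}|lborel. (LINT v:{r<..}|lborel. 1 / (v powr (n - 1) + v\<^sup>2)))"

definition B_eps :: "real \<Rightarrow> real \<Rightarrow> real \<Rightarrow> real" where
  "B_eps n \<epsilon> s = B n (s / \<epsilon>) / \<bar>ln \<epsilon>\<bar>"

text \<open>Here \<open>ux\<close>, \<open>uxx\<close>, \<open>uxxx\<close> are the weak \<open>x\<close>-derivatives of \<open>u\<close>, the last two only on \<open>{u > 0}\<close>.
  Products with the factor \<open>u\<close> vanish on \<open>{u = 0}\<close>, whatever the values of \<open>uxx\<close> and \<open>uxxx\<close> there.\<close>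

definition derivatives ::
  "real set \<Rightarrow> (real \<Rightarrow> real \<Rightarrow> real) \<Rightarrow> (real \<Rightarrow> real \<Rightarrow> real) \<Rightarrow> (real \<Rightarrow> real \<Rightarrow> real)
     \<Rightarrow> (real \<Rightarrow> real \<Rightarrow> real) \<Rightarrow> bool" where
  "derivatives \<Omega> u ux uxx uxxx \<longleftrightarrow>
     set_borel_measurable lborel ({0<..} \<times> \<Omega>) (\<lambda>(t, x). ux t x) \<and>
     set_borel_measurable lborel {(t, x). 0 < t \<and> x \<in> \<Omega> \<and> u t x > 0} (\<lambda>(t, x). uxx t x) \<and>
     set_borel_measurable lborel {(t, x). 0 < t \<and> x \<in> \<Omega> \<and> u t x > 0} (\<lambda>(t, x). uxxx t x) \<and>
     (\<forall>t>0. weak_deriv \<Omega> (u t) (ux t)) \<and>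
     (AE t\<in>{0<..} in lborel. weak_deriv {x\<in>\<Omega>. u t x > 0} (ux t) (uxx t) \<and>
                              weak_deriv {x\<in>\<Omega>. u t x > 0} (uxx t) (uxxx t))"

text \<open>The test functions are the restrictions to \<open>[0,\<infinity>) \<times> closure \<Omega>\<close> of smooth compactly supported
  functions on the plane.\<close>

definition weak_form ::
  "real set \<Rightarrow> real \<Rightarrow> (real \<Rightarrow> real) \<Rightarrow> real \<Rightarrow> (real \<Rightarrow> real \<Rightarrow> real) \<Rightarrow> (real \<Rightarrow> real \<Rightarrow> real)
     \<Rightarrow> bool" where
  "weak_form \<Omega> n u_in \<epsilon> u uxxx \<longleftrightarrow> (\<forall>\<psi>. test_fun UNIV \<psi> \<longrightarrow>
     ((LINT (t, x):{0<..} \<times> \<Omega>|lborel. u t x * dt \<psi> (t, x)) + (LINT x:\<Omega>|lborel. u_in x * \<psi> (0, x)))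
        / \<bar>ln \<epsilon>\<bar>
     + (LINT (t, x):{(t, x). 0 < t \<and> x \<in> \<Omega> \<and> u t x > 0}|lborel.
          mobility n \<epsilon> (u t x) * uxxx t x * dx \<psi> (t, x)) = 0)"

text \<open>\<open>\<partial>\<^sub>t f = g + \<partial>\<^sub>x h\<close> in the sense of distributions on \<open>(0,\<infinity>) \<times> \<Omega>\<close>.\<close>

definition distr_eq ::
  "real set \<Rightarrow> (real \<Rightarrow> real \<Rightarrow> real) \<Rightarrow> (real \<Rightarrow> real \<Rightarrow> real) \<Rightarrow> (real \<Rightarrow> real \<Rightarrow> real) \<Rightarrow> bool" where
  "distr_eq \<Omega> f g h \<longleftrightarrow>
     loc_integrable ({0<..} \<times> \<Omega>) (\<lambda>(t, x). f t x) \<and>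
     loc_integrable ({0<..} \<times> \<Omega>) (\<lambda>(t, x). g t x) \<and>
     loc_integrable ({0<..} \<times> \<Omega>) (\<lambda>(t, x). h t x) \<and>
     (\<forall>\<psi>. test_fun ({0<..} \<times> \<Omega>) \<psi> \<longrightarrow>
        - (LINT (t, x):{0<..} \<times> \<Omega>|lborel. f t x * dt \<psi> (t, x))
        = (LINT (t, x):{0<..} \<times> \<Omega>|lborel. g t x * \<psi> (t, x))
          - (LINT (t, x):{0<..} \<times> \<Omega>|lborel. h t x * dx \<psi> (t, x)))"

definition T_eps ::
  "(real \<Rightarrow> real \<Rightarrow> real) \<Rightarrow> (real \<Rightarrow> real \<Rightarrow> real) \<Rightarrow> (real \<Rightarrow> real \<Rightarrow> real) \<Rightarrow> real \<Rightarrow> real \<Rightarrow> real" where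
  "T_eps u ux uxxx t x = - ux t x * (u t x * uxxx t x)"

definition R_eps ::
  "real \<Rightarrow> real \<Rightarrow> (real \<Rightarrow> real \<Rightarrow> real) \<Rightarrow> (real \<Rightarrow> real \<Rightarrow> real) \<Rightarrow> real \<Rightarrow> real \<Rightarrow> real" where
  "R_eps n \<epsilon> u uxxx t x =
     - \<bar>ln \<epsilon>\<bar> * deriv (B_eps n \<epsilon>) (u t x) *
       (\<epsilon> powr (3 - n) * u t x powr (n - 1) + (u t x)\<^sup>2) * (u t x * uxxx t x)"

text \<open>Continuous non-negative weak solutions, with the energy and entropy inequalities and the
  equation for \<open>\<rho>\<^sup>\<epsilon> = B\<^sup>\<epsilon>(u)\<close>. The boundary condition on the flux is part of the weak form. Inequalities
  between integrals of non-negative functions are stated for extended non-negative integrals, so that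
  they include the finiteness of the smaller side.\<close>

definition thin_film_solution ::
  "real set \<Rightarrow> real \<Rightarrow> (real \<Rightarrow> real) \<Rightarrow> real \<Rightarrow> (real \<Rightarrow> real \<Rightarrow> real) \<Rightarrow> bool" where
  "thin_film_solution \<Omega> n u_in \<epsilon> u \<longleftrightarrow>
     continuous_on ({0..} \<times> closure \<Omega>) (\<lambda>(t, x). u t x) \<and>
     (\<forall>t\<ge>0. \<forall>x\<in>closure \<Omega>. 0 \<le> u t x) \<and>
     (AE x\<in>\<Omega> in lborel. u 0 x = u_in x) \<and>
     (\<exists>u_in' ux uxx uxxx.
        weak_deriv \<Omega> u_in u_in' \<and>
        derivatives \<Omega> u ux uxx uxxx \<and>
        weak_form \<Omega> n u_in \<epsilon> u uxxx \<and>
        (\<forall>T>0. Linf_H1 T \<Omega> u \<and> Lp 2 ({0<..<T} \<times> \<Omega>) (\<lambda>(t, x). u t x * uxxx t x)) \<and>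
        (\<forall>t>0. (LINT x:\<Omega>|lborel. u t x) = (LINT x:\<Omega>|lborel. u_in x)) \<and>
        (\<forall>t>0.
           (\<integral>\<^sup>+x\<in>\<Omega>. ennreal ((ux t x)\<^sup>2 / 2) \<partial>lborel)
           + (\<integral>\<^sup>+z\<in>{(s, x). 0 < s \<and> s < t \<and> x \<in> \<Omega> \<and> u s x > 0}.
                (case z of (s, x) \<Rightarrow>
                   ennreal (\<bar>ln \<epsilon>\<bar> * mobility n \<epsilon> (u s x) * (uxxx s x)\<^sup>2)) \<partial>lborel)
           \<le> (\<integral>\<^sup>+x\<in>\<Omega>. ennreal ((u_in' x)\<^sup>2 / 2) \<partial>lborel)) \<and>
        (\<forall>t>0.
           (\<integral>\<^sup>+z\<in>{0<..<t} \<times> \<Omega>. (case z of (s, x) \<Rightarrow> ennreal (u s x * (uxx s x)\<^sup>2)) \<partial>lborel)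
           + (\<integral>\<^sup>+x\<in>\<Omega>. ennreal (B_eps n \<epsilon> (u 0 x)) \<partial>lborel)
           \<le> (\<integral>\<^sup>+x\<in>\<Omega>. ennreal (B_eps n \<epsilon> (u t x)) \<partial>lborel)) \<and>
        (n < 2 \<longrightarrow> (\<forall>T>0. L2_H2 T \<Omega> u)) \<and>
        (2 \<le> n \<longrightarrow> (\<forall>T>0. L2_H2 T \<Omega> (\<lambda>t x. u t x powr (3/2)) \<and>
                            deriv_in_Lp 4 T \<Omega> (\<lambda>t x. u t x powr (3/4)))) \<and>
        (AE t\<in>{0<..} in lborel. \<exists>v. continuous_on (closure \<Omega>) v \<and>
           (\<forall>x\<in>closure \<Omega>. (u t has_real_derivative v x) (at x within closure \<Omega>)) \<and>
           (\<forall>x\<in>frontier \<Omega>. v x = 0)) \<and>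
        distr_eq \<Omega> (\<lambda>t x. B_eps n \<epsilon> (u t x)) (T_eps u ux uxxx) (R_eps n \<epsilon> u uxxx) \<and>
        (\<forall>T>0. L2_L1 T \<Omega> (T_eps u ux uxxx)) \<and>
        (AE t\<in>{0<..} in lborel. \<forall>\<phi>. smooth \<phi> \<longrightarrow>
           (LINT x:\<Omega>|lborel. T_eps u ux uxxx t x * \<phi> x)
           = (LINT x:\<Omega>|lborel. u t x * (uxx t x)\<^sup>2 * \<phi> x)
             - 5 / 6 * (LINT x:\<Omega>|lborel. (ux t x) ^ 3 * deriv \<phi> x)
             - 1 / 2 * (LINT x:\<Omega>|lborel. u t x * (ux t x)\<^sup>2 * deriv (deriv \<phi>) x)))"

text \<open>The set \<open>\<Sigma>(t)\<close> for \<open>g = \<rho>(t, \<cdot>)\<close>; it depends only on the class of \<open>g\<close> in \<open>L\<^sup>\<infinity>(\<Omega>)\<close>.\<close>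

definition Sigma_set :: "real set \<Rightarrow> (real \<Rightarrow> real) \<Rightarrow> real set" where
  "Sigma_set \<Omega> g = {x\<in>\<Omega>. \<exists>r>0. (LINT y:ball x r \<inter> \<Omega>|lborel. 1 - g y) = 0}"

end

(*
  Write v = u_x, w = u_xx and let phi = h^4 >= 0 be a test function in x. For delta > 0 the function
  F(u) = delta u / (delta + u) is concave and bounded by delta. Splitting u = F(u) + u^2 / (delta + u) in
  T = - u u_x u_xxx and integrating only the part with F by parts gives
    <T, phi> = int F w^2 phi - 1/3 int F'' v^4 phi - 5/6 int F' v^3 phi' - 1/2 int F v^2 phi''
               - int u^2 / (delta + u) v u_xxx phi.
  The first two terms are non-negative, and the second one absorbs the third by Young's inequality up to
  O(delta^2). The fourth is O(delta), and the last one is bounded by delta int v^2 plus delta^(-2) times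
  the energy dissipation, whose time integral is O(1 / |ln epsilon|), as is the squared L^2 norm of R.
  Hence int rho(t) phi is non-decreasing in the limit epsilon -> 0, then delta -> 0. As the limit rho
  satisfies rho <= 1, it stays equal to 1 wherever it once is.
*)

theory Submission
  imports Defs
begin

text \<open>The obstacle is the zero set of u. The derivatives \<open>uxx\<close> and
  \<open>uxxx\<close> are known only on {u > 0}, an open set that may have infinitely many
  components, so the integration by parts cannot run across its boundary. The multiplier u^2 /
  (\<delta> + u) is therefore first replaced by one that vanishes where u is below a threshold; at
  fixed \<delta> the threshold is then sent to 0 by dominated convergence. The zero set contributes
  nothing because u_x vanishes there. The bound 1 for the limit comes from B'(r) \<le> 1 / r: B
  grows at most like the logarithm, so \<open>B_eps\<close> is at most 1 + O(1 / |ln \<epsilon>|) on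
  bounded values of u. The limit is given only as a distribution for almost every t. Its density is
  recovered from the primitives of the approximations, which converge pointwise to a non-decreasing
  function with Lipschitz constant 1. The comparison of two fixed times uses that the
  approximations, unlike the limit, are continuous in t.\<close>

section \<open>Calculus of smooth functions\<close>

lemma smooth_differentiable: "smooth f \<Longrightarrow> f differentiable (at x)"
  by (erule smooth.cases) auto

lemma smooth_frechet: "smooth f \<Longrightarrow> smooth (\<lambda>x. frechet_derivative f (at x) v)"
  by (erule smooth.cases) auto

lemma smooth_has_derivative:
  "smooth f \<Longrightarrow> (f has_derivative frechet_derivative f (at x)) (at x)"
  using frechet_derivative_works smooth_differentiable by blast

lemma smooth_continuous_on: "smooth f \<Longrightarrow> continuous_on S f"
  by (meson continuous_at_imp_continuous_on differentiable_imp_continuous_within smooth_differentiable)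

text \<open>Closure properties of a coinductive predicate need a coinduction up to those closure properties;
  this predicate generates them.\<close>

inductive smooth_upto :: "('a::euclidean_space \<Rightarrow> real) \<Rightarrow> bool" where
  base: "smooth f \<Longrightarrow> smooth_upto f"
| comp: "smooth g \<Longrightarrow> bounded_linear L \<Longrightarrow> smooth_upto (\<lambda>x. g (L x :: real))"
| const: "smooth_upto (\<lambda>x. c)"
| add: "smooth_upto f \<Longrightarrow> smooth_upto g \<Longrightarrow> smooth_upto (\<lambda>x. f x + g x)"
| mult: "smooth_upto f \<Longrightarrow> smooth_upto g \<Longrightarrow> smooth_upto (\<lambda>x. f x * g x)"
| inverse: "smooth_upto f \<Longrightarrow> (\<And>x. f x \<noteq> 0) \<Longrightarrow> smooth_upto (\<lambda>x. inverse (f x))"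

lemma frechet_derivative_eqI:
  "(f has_derivative f') (at x) \<Longrightarrow> frechet_derivative f (at x) = f'"
  using frechet_derivative_at by metis

text \<open>This is the invariant needed by the coinduction: the calculus rule for each constructor
  produces an expression that the constructors build again. For \<open>inverse\<close> the
  derivative is a product with two more inverses of f, which are admissible because f has no
  zero.\<close>

lemma smooth_upto_step:
  "smooth_upto f \<Longrightarrow>
    (\<forall>x. f differentiable (at x)) \<and> (\<forall>v. smooth_upto (\<lambda>x. frechet_derivative f (at x) v))"
proof (induction rule: smooth_upto.induct)
  case (base f)
  then show ?case
    by (auto intro: smooth_upto.base smooth_differentiable smooth_frechet)
next
  case (comp g L)
  have d: "((\<lambda>x. g (L x)) has_derivative (\<lambda>h. frechet_derivative g (at (L x)) (L h))) (at x)" for x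
    using has_derivative_compose[OF bounded_linear_imp_has_derivative[OF comp(2)]
        smooth_has_derivative[OF comp(1)], of x UNIV] by simp
  then have "(\<lambda>x. g (L x)) differentiable (at x)" for x
    unfolding differentiable_def by blast
  moreover have "smooth_upto (\<lambda>x. frechet_derivative g (at (L x)) (L v))" for v
    using smooth_upto.comp[OF smooth_frechet[OF comp(1)] comp(2)] .
  ultimately show ?case
    by (simp add: frechet_derivative_eqI[OF d])
next
  case (const c)
  then show ?case by (auto intro: smooth_upto.const)
next
  case (add f g)
  have d: "((\<lambda>x. f x + g x) has_derivative
      (\<lambda>h. frechet_derivative f (at x) h + frechet_derivative g (at x) h)) (at x)" for x
    using add.IH by (intro has_derivative_add) (auto simp: frechet_derivative_works)
  show ?case
    using add.IH by (auto simp: frechet_derivative_eqI[OF d] intro: smooth_upto.add)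
next
  case (mult f g)
  have d: "((\<lambda>x. f x * g x) has_derivative
      (\<lambda>h. f x * frechet_derivative g (at x) h + frechet_derivative f (at x) h * g x)) (at x)" for x
    using mult.IH by (intro has_derivative_mult) (auto simp: frechet_derivative_works)
  show ?case
    using mult by (auto simp: frechet_derivative_eqI[OF d] intro!: smooth_upto.add smooth_upto.mult)
next
  case (inverse f)
  have d: "((\<lambda>x. inverse (f x)) has_derivative
      (\<lambda>h. - (inverse (f x) * frechet_derivative f (at x) h * inverse (f x)))) (at x)" for x
    using inverse.IH inverse.hyps(2) by (intro Deriv.has_derivative_inverse) (auto simp: frechet_derivative_works)
  have s: "smooth_upto (\<lambda>x. (-1) * (inverse (f x) * frechet_derivative f (at x) h * inverse (f x)))" for h
    by (intro smooth_upto.mult smooth_upto.const smooth_upto.inverse inverse.hyps)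
      (use inverse.IH in auto)
  have "(\<lambda>x. inverse (f x)) differentiable (at x)" for x
    using d differentiable_def by blast
  moreover have "frechet_derivative (\<lambda>x. inverse (f x)) (at x) v
      = (-1) * (inverse (f x) * frechet_derivative f (at x) v * inverse (f x))" for x v
    unfolding frechet_derivative_eqI[OF d] by simp
  ultimately show ?case
    using s by presburger
qed

lemma smooth_uptoD: "smooth_upto f \<Longrightarrow> smooth f"
  by (coinduction arbitrary: f rule: smooth.coinduct) (use smooth_upto_step in blast)

lemma smooth_const: "smooth (\<lambda>x. c)"
  by (rule smooth_uptoD[OF smooth_upto.const])

lemma smooth_add: "smooth f \<Longrightarrow> smooth g \<Longrightarrow> smooth (\<lambda>x. f x + g x)"
  by (rule smooth_uptoD[OF smooth_upto.add]) (auto intro: smooth_upto.base)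

lemma smooth_mult: "smooth f \<Longrightarrow> smooth g \<Longrightarrow> smooth (\<lambda>x. f x * g x)"
  by (rule smooth_uptoD[OF smooth_upto.mult]) (auto intro: smooth_upto.base)

lemma smooth_cmult: "smooth f \<Longrightarrow> smooth (\<lambda>x. c * f x)"
  by (intro smooth_mult smooth_const)

lemma smooth_diff: "smooth f \<Longrightarrow> smooth g \<Longrightarrow> smooth (\<lambda>x. f x - g x)"
  using smooth_add[OF _ smooth_cmult[of g "-1"]] by simp

lemma smooth_divide: "smooth f \<Longrightarrow> smooth g \<Longrightarrow> (\<And>x. g x \<noteq> 0) \<Longrightarrow> smooth (\<lambda>x. f x / g x)"
  unfolding divide_inverse
  by (rule smooth_mult) (auto intro: smooth_uptoD[OF smooth_upto.inverse] smooth_upto.base)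

lemma smooth_power: "smooth f \<Longrightarrow> smooth (\<lambda>x. f x ^ k)"
  by (induction k) (auto intro: smooth_const smooth_mult)

lemma smooth_compose_linear:
  fixes g :: "real \<Rightarrow> real"
  shows "smooth g \<Longrightarrow> bounded_linear L \<Longrightarrow> smooth (\<lambda>x. g (L x))"
  by (rule smooth_uptoD[OF smooth_upto.comp])

text \<open>On the line every directional derivative is a multiple v of \<open>deriv\<close>, so a
  single function carries all of them.\<close>

lemma smooth_real_iff:
  fixes f :: "real \<Rightarrow> real"
  shows "smooth f \<longleftrightarrow> (\<forall>x. f differentiable (at x)) \<and> smooth (deriv f)"
proof -
  have *: "frechet_derivative f (at x) v = v * deriv f x" if "f differentiable (at x)" for x v
    using frechet_derivative_eqI[of f "(\<lambda>h. h * deriv f x)" x] that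
    by (metis DERIV_deriv_iff_real_differentiable has_field_derivative_def mult_commute_abs)
  show ?thesis
  proof
    assume f: "smooth f"
    show "(\<forall>x. f differentiable (at x)) \<and> smooth (deriv f)"
      using smooth_frechet[OF f, of 1] smooth_differentiable[OF f] by (simp add: *)
  next
    assume "(\<forall>x. f differentiable (at x)) \<and> smooth (deriv f)"
    then show "smooth f"
      by (intro smooth.intros) (auto simp: * intro!: smooth_cmult)
  qed
qed

lemma smooth_deriv: "smooth f \<Longrightarrow> smooth (deriv f)" for f :: "real \<Rightarrow> real"
  using smooth_real_iff by blast

lemma smooth_DERIV: "smooth f \<Longrightarrow> (f has_real_derivative deriv f x) (at x)" for f :: "real \<Rightarrow> real"
  using DERIV_deriv_iff_real_differentiable smooth_differentiable by blast

lemma smoothI_DERIV: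
  fixes f :: "real \<Rightarrow> real"
  assumes "\<And>x. (f has_real_derivative f' x) (at x)" "smooth f'"
  shows "smooth f"
proof -
  have "deriv f = f'" using assms(1) DERIV_imp_deriv by blast
  then show ?thesis
    using assms smooth_real_iff real_differentiable_def by metis
qed

text \<open>A shift is affine rather than linear, so the composition rule does not apply. But shifts
  commute with derivatives, and so the shifted smooth functions form an invariant of their
  own.\<close>

lemma smooth_translate: "smooth f \<Longrightarrow> smooth (\<lambda>x. f (x + c))" for f :: "real \<Rightarrow> real"
proof (coinduction arbitrary: f rule: smooth.coinduct)
  case (smooth f)
  have d: "((\<lambda>x. f (x + c)) has_derivative frechet_derivative f (at (x + c))) (at x)" for x
    by (rule has_derivative_compose[OF _ smooth_has_derivative[OF smooth]])
      (auto intro!: derivative_eq_intros)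
  then show ?case
    using smooth_frechet[OF smooth]
    by (auto simp: frechet_derivative_eqI[OF d] differentiable_def)
qed

text \<open>Products of this form serve as test functions in space-time: they reduce the evolution
  equation to an identity in t for integrals over x.\<close>

lemma smooth_tensor:
  fixes \<eta> \<phi> :: "real \<Rightarrow> real"
  assumes "smooth \<eta>" "smooth \<phi>"
  shows "smooth (\<lambda>(t, x). \<eta> t * \<phi> x)"
    and "dt (\<lambda>(t, x). \<eta> t * \<phi> x) (t, x) = deriv \<eta> t * \<phi> x"
    and "dx (\<lambda>(t, x). \<eta> t * \<phi> x) (t, x) = \<eta> t * deriv \<phi> x"
proof -
  show "smooth (\<lambda>(t, x). \<eta> t * \<phi> x)"
    unfolding case_prod_unfold
    by (intro smooth_mult smooth_compose_linear[OF _ bounded_linear_fst]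
        smooth_compose_linear[OF _ bounded_linear_snd] assms)
  have *: "((\<lambda>(t, x). \<eta> t * \<phi> x) has_derivative
      (\<lambda>h. \<eta> t * (deriv \<phi> x * snd h) + (deriv \<eta> t * fst h) * \<phi> x)) (at (t, x))"
  proof -
    have "((\<lambda>z. \<eta> (fst z)) has_derivative (\<lambda>h. deriv \<eta> t * fst h)) (at (t, x))"
      by (rule has_derivative_compose[OF bounded_linear_imp_has_derivative[OF bounded_linear_fst]])
        (use smooth_DERIV[OF assms(1), of t] in \<open>simp add: has_field_derivative_def\<close>)
    moreover have "((\<lambda>z. \<phi> (snd z)) has_derivative (\<lambda>h. deriv \<phi> x * snd h)) (at (t, x))"
      by (rule has_derivative_compose[OF bounded_linear_imp_has_derivative[OF bounded_linear_snd]])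
        (use smooth_DERIV[OF assms(2), of x] in \<open>simp add: has_field_derivative_def\<close>)
    ultimately show ?thesis
      using has_derivative_mult by (force simp: case_prod_unfold)
  qed
  show "dt (\<lambda>(t, x). \<eta> t * \<phi> x) (t, x) = deriv \<eta> t * \<phi> x"
    "dx (\<lambda>(t, x). \<eta> t * \<phi> x) (t, x) = \<eta> t * deriv \<phi> x"
    unfolding dt_def dx_def frechet_derivative_eqI[OF *] by auto
qed

section \<open>Bump functions\<close>

text \<open>The polynomial factor makes the family stable under differentiation: all derivatives of
  exp (- 1 / x), extended by 0 to x \<le> 0, have this form.\<close>

definition flat_exp :: "real poly \<Rightarrow> real \<Rightarrow> real" where
  "flat_exp p x = (if x > 0 then poly p (1/x) * exp (- (1/x)) else 0)"

lemma poly_exp_tendsto_0: "((\<lambda>y. poly p y * exp (- y)) \<longlongrightarrow> 0) at_top" for p :: "real poly"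
proof -
  have "((\<lambda>y. \<Sum>i\<le>degree p. coeff p i * (y ^ i / exp y)) \<longlongrightarrow> (\<Sum>i\<le>degree p. coeff p i * 0)) at_top"
    by (intro tendsto_intros tendsto_power_div_exp_0)
  then show ?thesis
    by (simp add: poly_altdef sum_distrib_right exp_minus divide_inverse mult.assoc)
qed

text \<open>With y = 1 / x one has dy/dx = - y^2, which accounts for the factor
  \<open>[:0, 0, 1:]\<close> and for p - p'. At 0 the right difference quotient is y p(y) exp (- y)
  with y tending to infinity, so the derivative there is 0.\<close>

lemma flat_exp_DERIV:
  "(flat_exp p has_real_derivative flat_exp ([:0, 0, 1:] * (p - pderiv p)) x) (at x)"
proof -
  consider "x > 0" | "x < 0" | "x = 0" by linarith
  then show ?thesis
  proof cases
    case 1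
    have "((\<lambda>x. poly p (1/x) * exp (- (1/x))) has_real_derivative
        flat_exp ([:0, 0, 1:] * (p - pderiv p)) x) (at x)"
      using 1 unfolding flat_exp_def
      by (auto intro!: derivative_eq_intros poly_DERIV[THEN DERIV_chain2] simp: field_simps power2_eq_square)
    then show ?thesis
      by (rule has_field_derivative_transform_within_open[of _ _ _ "{0<..}"])
        (use 1 in \<open>auto simp: flat_exp_def\<close>)
  next
    case 2
    have "((\<lambda>x. 0) has_real_derivative flat_exp ([:0, 0, 1:] * (p - pderiv p)) x) (at x)"
      using 2 by (auto simp: flat_exp_def)
    then show ?thesis
      by (rule has_field_derivative_transform_within_open[of _ _ _ "{..<0}"])
        (use 2 in \<open>auto simp: flat_exp_def\<close>)
  next
    case 3
    have r: "((\<lambda>h. poly ([:0, 1:] * p) (inverse h) * exp (- inverse h)) \<longlongrightarrow> 0) (at_right 0)"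
      using filterlim_compose[OF poly_exp_tendsto_0 filterlim_inverse_at_top_right] .
    have "((\<lambda>h. flat_exp p h / h) \<longlongrightarrow> 0) (at 0)"
    proof (rule filterlim_split_at)
      show "((\<lambda>h. flat_exp p h / h) \<longlongrightarrow> 0) (at_left 0)"
        by (rule tendsto_eventually) (auto simp: flat_exp_def eventually_at_left_field intro!: exI[of _ "-1"])
      show "((\<lambda>h. flat_exp p h / h) \<longlongrightarrow> 0) (at_right 0)"
        by (rule Lim_transform_eventually[OF r])
          (auto simp: flat_exp_def eventually_at_right_field divide_inverse intro!: exI[of _ "1"])
    qed
    then show ?thesis
      using 3 by (simp add: DERIV_def flat_exp_def)
  qed
qed

text \<open>The coinduction runs over all polynomials at once; the direction v is absorbed into the
  polynomial as a scalar factor.\<close>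

lemma smooth_flat_exp: "smooth (flat_exp p)"
proof (coinduction arbitrary: p rule: smooth.coinduct)
  case (smooth p)
  have "(flat_exp p has_derivative (*) (flat_exp ([:0, 0, 1:] * (p - pderiv p)) x)) (at x)" for x
    using flat_exp_DERIV has_field_derivative_def by blast
  then have d: "flat_exp p differentiable at x"
    and "frechet_derivative (flat_exp p) (at x) = (*) (flat_exp ([:0, 0, 1:] * (p - pderiv p)) x)" for x
    unfolding differentiable_def using frechet_derivative_eqI by blast+
  then have "(\<lambda>x. frechet_derivative (flat_exp p) (at x) v) = flat_exp (smult v ([:0, 0, 1:] * (p - pderiv p)))" for v
    by (auto simp: flat_exp_def fun_eq_iff)
  then show ?case using d by (intro exI[of _ "flat_exp p"]) blast
qed

definition bump :: "real \<Rightarrow> real \<Rightarrow> real \<Rightarrow> real" where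
  "bump c d x = flat_exp 1 (x - c) * flat_exp 1 (d - x)"

lemma smooth_bump: "smooth (bump c d)"
proof -
  have 1: "smooth (\<lambda>x. flat_exp 1 (x + (- c)))"
    by (rule smooth_translate[OF smooth_flat_exp])
  have "smooth (\<lambda>x. flat_exp 1 ((-1) * x))"
    by (rule smooth_compose_linear[OF smooth_flat_exp bounded_linear_mult_right])
  then have 2: "smooth (\<lambda>x. flat_exp 1 ((-1) * (x + (- d))))"
    by (rule smooth_translate)
  show ?thesis using smooth_mult[OF 1 2] by (simp add: bump_def[abs_def])
qed

lemma bump_nonneg: "0 \<le> bump c d x"
  by (auto simp: bump_def flat_exp_def)

lemma bump_eq_0_iff: "bump c d x = 0 \<longleftrightarrow> x \<le> c \<or> d \<le> x"
  by (auto simp: bump_def flat_exp_def)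

lemma supp_subset_closed: "closed S \<Longrightarrow> (\<And>x. x \<notin> S \<Longrightarrow> f x = 0) \<Longrightarrow> supp f \<subseteq> S"
  unfolding supp_def by (rule closure_minimal) auto

lemma not_in_supp: "x \<notin> supp f \<Longrightarrow> f x = 0"
  unfolding supp_def using closure_subset[of "{x. f x \<noteq> 0}"] by blast

lemma test_funI:
  assumes "smooth f" "compact S" "S \<subseteq> U" "\<And>x. x \<notin> S \<Longrightarrow> f x = 0"
  shows "test_fun U f"
proof -
  have "supp f \<subseteq> S" using assms by (intro supp_subset_closed compact_imp_closed)
  moreover have "closed (supp f)" by (simp add: supp_def)
  ultimately have "compact (supp f)"
    using assms(2) by (metis compact_Int_closed inf.absorb_iff2)
  then show ?thesis using assms \<open>supp f \<subseteq> S\<close> unfolding test_fun_def by blast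
qed

lemma test_fun_smooth: "test_fun U f \<Longrightarrow> smooth f"
  by (simp add: test_fun_def)

lemma test_fun_supp:
  assumes "test_fun U f"
  shows "compact (supp f)" "supp f \<subseteq> U" "\<And>x. x \<notin> U \<Longrightarrow> f x = 0"
  using assms not_in_supp by (auto simp: test_fun_def)

lemma test_fun_mono: "test_fun U f \<Longrightarrow> U \<subseteq> V \<Longrightarrow> test_fun V f"
  by (auto simp: test_fun_def)

lemma deriv_eq_0_outside_supp:
  fixes f :: "real \<Rightarrow> real"
  assumes "x \<notin> supp f" shows "deriv f x = 0"
proof -
  have o: "open (- supp f)" by (simp add: supp_def open_Compl)
  have "((\<lambda>x. 0) has_real_derivative 0) (at x)" by simp
  then have "(f has_real_derivative 0) (at x)"
    by (rule has_field_derivative_transform_within_open[OF _ o]) (use assms in \<open>auto simp: not_in_supp\<close>)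
  then show ?thesis by (rule DERIV_imp_deriv)
qed

lemma test_fun_deriv: "test_fun U f \<Longrightarrow> test_fun U (deriv f)" for f :: "real \<Rightarrow> real"
  by (rule test_funI[of _ "supp f"])
    (auto simp: test_fun_def smooth_deriv deriv_eq_0_outside_supp)

lemma test_fun_bounded:
  fixes f :: "'a::euclidean_space \<Rightarrow> real"
  assumes "test_fun U f" obtains C where "C > 0" "\<And>x. \<bar>f x\<bar> \<le> C"
proof -
  have "compact (f ` supp f)"
    using assms by (intro compact_continuous_image smooth_continuous_on) (auto simp: test_fun_def)
  then obtain C where C: "\<And>x. x \<in> supp f \<Longrightarrow> \<bar>f x\<bar> \<le> C"
    using compact_imp_bounded[of "f ` supp f"] unfolding bounded_iff by (metis imageI real_norm_def)
  have "\<bar>f x\<bar> \<le> max C 1" for x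
    using C[of x] not_in_supp[of x f] by (cases "x \<in> supp f") auto
  then show ?thesis using that[of "max C 1"] by auto
qed

lemma test_fun_borel: "test_fun U f \<Longrightarrow> f \<in> borel_measurable borel"
  by (intro borel_measurable_continuous_onI smooth_continuous_on test_fun_smooth)

lemma test_fun_mult_smooth: "test_fun U f \<Longrightarrow> smooth g \<Longrightarrow> test_fun U (\<lambda>x. f x * g x)"
  by (rule test_funI[of _ "supp f"]) (auto simp: test_fun_def smooth_mult not_in_supp)

lemma test_fun_power:
  assumes "test_fun U f" "k \<noteq> 0" shows "test_fun U (\<lambda>x. f x ^ k)"
proof -
  obtain m where "k = Suc m" using assms(2) by (cases k) auto
  then show ?thesis
    using test_fun_mult_smooth[OF assms(1) smooth_power[OF test_fun_smooth[OF assms(1)], of m]] by simp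
qed

lemma test_fun_cmult: "test_fun U f \<Longrightarrow> test_fun U (\<lambda>x. c * f x)"
  using test_fun_mult_smooth[OF _ smooth_const, of U f c] by (simp add: mult.commute)

lemma test_fun_diff: "test_fun U f \<Longrightarrow> test_fun U g \<Longrightarrow> test_fun U (\<lambda>x. f x - g x)"
  by (rule test_funI[of _ "supp f \<union> supp g"])
    (auto simp: test_fun_def smooth_diff not_in_supp compact_Un)

lemma test_fun_bump: "{c..d} \<subseteq> U \<Longrightarrow> test_fun U (bump c d)"
  by (rule test_funI[of _ "{c..d}"]) (auto simp: smooth_bump bump_eq_0_iff)

text \<open>A smooth substitute for the indicator of the open interval: since the bump is positive
  exactly there, the quotient tends to 1 inside as j grows, while the support stays the same for all
  j.\<close>

definition plateau :: "real \<Rightarrow> real \<Rightarrow> nat \<Rightarrow> real \<Rightarrow> real" where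
  "plateau c d j x = bump c d x / (bump c d x + 1 / real (Suc j))"

lemma plateau_denom_pos: "0 < bump c d x + 1 / real (Suc j)"
  using bump_nonneg[of c d x] by (intro add_nonneg_pos) auto

lemma plateau_bounds: "0 \<le> plateau c d j x" "plateau c d j x \<le> 1"
  using bump_nonneg[of c d x] plateau_denom_pos[of c d x j]
  by (auto simp: plateau_def field_simps)

lemma plateau_eq_0: "x \<notin> {c<..<d} \<Longrightarrow> plateau c d j x = 0"
  using bump_eq_0_iff[of c d x] by (auto simp: plateau_def)

lemma test_fun_plateau: "{c..d} \<subseteq> U \<Longrightarrow> test_fun U (plateau c d j)"
  by (rule test_funI[of _ "{c..d}"])
    (auto simp: plateau_def[abs_def] bump_eq_0_iff simp del: of_nat_Suc intro!:
      smooth_divide[OF smooth_bump smooth_add[OF smooth_bump smooth_const]]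
      less_imp_neq[OF plateau_denom_pos, symmetric])

lemma plateau_tendsto: "(\<lambda>j. plateau c d j x) \<longlonglongrightarrow> indicator {c<..<d} x"
proof (cases "x \<in> {c<..<d}")
  case True
  then have "bump c d x \<noteq> 0" by (auto simp: bump_eq_0_iff)
  moreover have "(\<lambda>j. bump c d x / (bump c d x + 1 / real (Suc j))) \<longlonglongrightarrow> bump c d x / (bump c d x + 0)"
    by (intro tendsto_intros LIMSEQ_Suc[OF lim_1_over_n]) (use calculation in auto)
  ultimately show ?thesis using True by (simp add: plateau_def)
qed (simp add: plateau_eq_0)

section \<open>Integrals against test functions\<close>

lemma integrable_mult_bounded:
  fixes f g :: "'a \<Rightarrow> real"
  assumes f: "integrable M f" and g: "g \<in> borel_measurable M" "\<And>x. \<bar>g x\<bar> \<le> C"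
  shows "integrable M (\<lambda>x. f x * g x)"
proof (rule Bochner_Integration.integrable_bound)
  show "integrable M (\<lambda>x. C * \<bar>f x\<bar>)" using f by auto
  show "AE x in M. norm (f x * g x) \<le> norm (C * \<bar>f x\<bar>)"
  proof (rule AE_I2)
    fix x
    have "\<bar>f x\<bar> * \<bar>g x\<bar> \<le> \<bar>f x\<bar> * \<bar>C\<bar>"
      using g(2)[of x] by (intro mult_left_mono) auto
    then show "norm (f x * g x) \<le> norm (C * \<bar>f x\<bar>)" by (simp add: abs_mult mult.commute)
  qed
qed (use f g in measurable)

text \<open>Nothing global on U is known about f, not even measurability. The product lives on the
  compact support of \<phi>, and there f is integrable and \<phi> bounded.\<close>

lemma loc_integrable_mult_test:
  assumes f: "loc_integrable U f" and \<phi>: "test_fun U \<phi>"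
  shows "set_integrable lborel U (\<lambda>x. f x * \<phi> x)"
proof -
  have "set_integrable lborel (supp \<phi>) f"
    using f test_fun_supp[OF \<phi>] by (auto simp: loc_integrable_def)
  moreover obtain C where C: "\<And>x. \<bar>\<phi> x\<bar> \<le> C"
    using test_fun_bounded[OF \<phi>] by blast
  ultimately have "integrable lborel (\<lambda>x. (indicator (supp \<phi>) x * f x) * \<phi> x)"
    using test_fun_borel[OF \<phi>]
    by (intro integrable_mult_bounded[of _ _ \<phi> C]) (auto simp: set_integrable_def)
  moreover have "(\<lambda>x. indicator U x * (f x * \<phi> x)) = (\<lambda>x. (indicator (supp \<phi>) x * f x) * \<phi> x)"
    using test_fun_supp[OF \<phi>] not_in_supp[of _ \<phi>] by (fastforce simp: indicator_def fun_eq_iff)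
  ultimately show ?thesis
    by (simp add: set_integrable_def)
qed

lemma loc_integrable_subset: "loc_integrable U f \<Longrightarrow> V \<subseteq> U \<Longrightarrow> loc_integrable V f"
  by (auto simp: loc_integrable_def)

lemma loc_integrable_continuous: "continuous_on U f \<Longrightarrow> loc_integrable U f"
  unfolding loc_integrable_def set_integrable_def
  using borel_integrable_compact continuous_on_subset by blast

lemma loc_integrable_diff:
  "loc_integrable U f \<Longrightarrow> loc_integrable U g \<Longrightarrow> loc_integrable U (\<lambda>x. f x - g x)"
  unfolding loc_integrable_def by (auto intro: set_integral_diff)

lemma LINT_test_subset:
  assumes "test_fun V \<phi>" "V \<subseteq> U"
  shows "(LINT x:U|lborel. f x * \<phi> x) = (LINT x:V|lborel. f x * \<phi> x)"
  unfolding set_lebesgue_integral_def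
  using test_fun_supp(3)[OF assms(1)] assms(2)
  by (intro Bochner_Integration.integral_cong) (auto simp: indicator_def)

section \<open>The fundamental lemma of the calculus of variations\<close>

lemma LINT_open_interval_tendsto:
  fixes f :: "real \<Rightarrow> real"
  assumes f: "loc_integrable U f" and cd: "{c..d} \<subseteq> U"
  shows "(\<lambda>j. LINT x:U|lborel. f x * plateau c d j x) \<longlonglongrightarrow> (LINT x:{c<..<d}|lborel. f x)"
proof -
  have i: "integrable lborel (\<lambda>x. indicator {c..d} x * f x)"
    using f cd by (simp add: loc_integrable_def set_integrable_def)
  have *: "indicator U x * (f x * plateau c d j x) = (indicator {c..d} x * f x) * plateau c d j x" for j x
    using plateau_eq_0[of x c d j] cd by (auto simp: indicator_def)
  have "(\<lambda>j. \<integral>x. (indicator {c..d} x * f x) * plateau c d j x \<partial>lborel)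
      \<longlonglongrightarrow> (\<integral>x. indicator {c<..<d} x * f x \<partial>lborel)"
  proof (rule integral_dominated_convergence)
    show "integrable lborel (\<lambda>x. \<bar>indicator {c..d} x * f x\<bar>)"
      using i by (rule integrable_abs)
    \<comment> \<open>Only the product of f with the indicator of a compact set is known to be
      measurable; multiplying that by a second indicator gives the claim.\<close>
    show "(\<lambda>x. indicator {c<..<d} x * f x) \<in> borel_measurable lborel"
    proof -
      have "(\<lambda>x. indicator {c<..<d} x * (indicator {c..d} x * f x)) \<in> borel_measurable lborel"
        using i by measurable
      moreover have "(\<lambda>x. indicator {c<..<d} x * (indicator {c..d} x * f x)) = (\<lambda>x. indicator {c<..<d} x * f x)"
        by (auto simp: indicator_def)
      ultimately show ?thesis by simp
    qed
    show "(\<lambda>x. indicator {c..d} x * f x * plateau c d j x) \<in> borel_measurable lborel" for j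
      using i test_fun_borel[OF test_fun_plateau[OF order_refl, of c d j]] by measurable
    show "AE x in lborel. (\<lambda>j. indicator {c..d} x * f x * plateau c d j x) \<longlonglongrightarrow> indicator {c<..<d} x * f x"
    proof (rule AE_I2)
      fix x
      have "(\<lambda>j. indicator {c..d} x * f x * plateau c d j x)
          \<longlonglongrightarrow> indicator {c..d} x * f x * indicator {c<..<d} x"
        by (intro tendsto_intros plateau_tendsto)
      moreover have "indicator {c..d} x * f x * indicator {c<..<d} x = indicator {c<..<d} x * f x"
        by (auto simp: indicator_def)
      ultimately show "(\<lambda>j. indicator {c..d} x * f x * plateau c d j x) \<longlonglongrightarrow> indicator {c<..<d} x * f x"
        by simp
    qed
    show "AE x in lborel. norm (indicator {c..d} x * f x * plateau c d j x) \<le> \<bar>indicator {c..d} x * f x\<bar>" for j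
      using plateau_bounds[of c d j] by (auto simp: abs_mult intro!: AE_I2 mult_left_le)
  qed
  then show ?thesis
    by (simp add: set_lebesgue_integral_def *)
qed

lemma sets_borel_open_intervals:
  "sets (borel :: real measure) = sigma_sets UNIV (range (\<lambda>(a, b). {a<..<b}))"
proof -
  have "(\<lambda>(a, b). box a b) = (\<lambda>(a, b). {a<..<b::real})" by (simp add: fun_eq_iff)
  then show ?thesis unfolding borel_eq_box by (simp only:) simp
qed

text \<open>The open intervals are stable under intersection and generate the Borel sets. The sets
  over which f has integral 0 are closed under disjoint countable unions and, because the total
  integral is 0, under complements. So f has integral 0 over every Borel set.\<close>

lemma AE_zero_if_integrals_zero:
  fixes f :: "real \<Rightarrow> real"
  assumes f: "integrable lborel f" and 0: "\<And>c d. (LINT x:{c<..<d}|lborel. f x) = 0"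
    and tot: "(\<integral>x. f x \<partial>lborel) = 0"
  shows "AE x in lborel. f x = 0"
proof (rule sigma_finite_measure.density_zero[OF sigma_finite_lborel f])
  fix A :: "real set" assume "A \<in> sets lborel"
  then have A: "A \<in> sigma_sets UNIV (range (\<lambda>(a, b). {a<..<b::real}))"
    by (simp add: sets_borel_open_intervals)
  have "Int_stable (range (\<lambda>(a, b). {a<..<b::real}))"
    by (auto simp: Int_stable_def)
  moreover have "range (\<lambda>(a, b). {a<..<b::real}) \<subseteq> Pow UNIV" by simp
  ultimately show "set_lebesgue_integral lborel A f = 0"
    using A
  proof (induction rule: sigma_sets_induct_disjoint)
    show "set_lebesgue_integral lborel {} f = 0"
      by (simp add: set_lebesgue_integral_def)
  next
    fix A assume A: "A \<in> sigma_sets UNIV (range (\<lambda>(a, b). {a<..<b::real}))"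
      and A0: "set_lebesgue_integral lborel A f = 0"
    then have A': "A \<in> sets borel" by (simp add: sets_borel_open_intervals)
    then have B': "UNIV - A \<in> sets borel" using sets.compl_sets[of A borel] by simp
    have "(\<integral>x. f x \<partial>lborel) = set_lebesgue_integral lborel (A \<union> (UNIV - A)) f"
      by (simp add: set_lebesgue_integral_def)
    also have "\<dots> = set_lebesgue_integral lborel A f + set_lebesgue_integral lborel (UNIV - A) f"
      by (rule set_integral_Un)
        (auto simp: set_integrable_def intro!: integrable_mult_indicator[where 'b = real, simplified] f A' B')
    finally show "set_lebesgue_integral lborel (UNIV - A) f = 0"
      using tot A0 by simp
  next
    fix A :: "nat \<Rightarrow> real set"
    assume disj: "disjoint_family A" and A: "range A \<subseteq> sigma_sets UNIV (range (\<lambda>(a, b). {a<..<b}))"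
      and A0: "\<And>i. set_lebesgue_integral lborel (A i) f = 0"
    have A': "A i \<in> sets borel" for i
      using A by (auto simp: sets_borel_open_intervals)
    then have B': "(\<Union>i. A i) \<in> sets borel" by auto
    have "set_lebesgue_integral lborel (\<Union>i. A i) f = (\<Sum>i. set_lebesgue_integral lborel (A i) f)"
      using disj by (intro lebesgue_integral_countable_add)
        (auto simp: set_integrable_def disjoint_family_on_def
          intro!: integrable_mult_indicator[where 'b = real, simplified] f A' B')
    then show "set_lebesgue_integral lborel (\<Union>i. A i) f = 0"
      by (simp add: A0)
  qed (use 0 in auto)
qed

text \<open>Intervals with rational end points suffice to cover U, so only countably many null sets
  are united.\<close>

lemma AE_on_open_realI:
  fixes U :: "real set"
  assumes "open U" and P: "\<And>c d. c < d \<Longrightarrow> {c..d} \<subseteq> U \<Longrightarrow> AE x in lborel. x \<in> {c<..<d} \<longrightarrow> P x"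
  shows "AE x in lborel. x \<in> U \<longrightarrow> P x"
proof -
  have "AE x in lborel. \<forall>q\<in>\<rat>. \<forall>r\<in>\<rat>. q < r \<and> {q..r} \<subseteq> U \<longrightarrow> x \<in> {q<..<r} \<longrightarrow> P x"
    using P by (intro AE_ball_countable[THEN iffD2] countable_rat ballI) auto
  then show ?thesis
  proof (rule AE_mp, intro AE_I2 impI)
    fix x assume H: "\<forall>q\<in>\<rat>. \<forall>r\<in>\<rat>. q < r \<and> {q..r} \<subseteq> U \<longrightarrow> x \<in> {q<..<r} \<longrightarrow> P x" and "x \<in> U"
    then obtain e where e: "e > 0" "cball x e \<subseteq> U"
      using \<open>open U\<close> open_contains_cball by blast
    obtain q r where "q \<in> \<rat>" "r \<in> \<rat>" "x - e < q" "q < x" "x < r" "r < x + e"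
      using Rats_dense_in_real[of "x - e" x] Rats_dense_in_real[of x "x + e"] e by auto
    moreover have "{q..r} \<subseteq> U"
      using e calculation by (auto simp: cball_def dist_real_def subset_eq abs_le_iff)
    ultimately show "P x" using H by force
  qed
qed

text \<open>Plateaus approximating an interval show that f has integral 0 over each open interval
  with closure in U. Restricted to one such interval, f is integrable and satisfies the hypotheses
  of \<open>AE_zero_if_integrals_zero\<close>.\<close>

lemma fundamental_lemma:
  fixes f :: "real \<Rightarrow> real"
  assumes U: "open U" and f: "loc_integrable U f"
    and 0: "\<And>\<phi>. test_fun U \<phi> \<Longrightarrow> (LINT x:U|lborel. f x * \<phi> x) = 0"
  shows "AE x in lborel. x \<in> U \<longrightarrow> f x = 0"
proof (rule AE_on_open_realI[OF U])
  fix c d :: real assume cd: "c < d" "{c..d} \<subseteq> U"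
  have z: "(LINT x:{a<..<b}|lborel. f x) = 0" if "{a..b} \<subseteq> U" for a b
    using LINT_open_interval_tendsto[OF f that] 0[OF test_fun_plateau[OF that]]
    by (simp add: LIMSEQ_const_iff)
  define g where "g x = indicator {c<..<d} x * f x" for x
  have "set_integrable lborel {c..d} f"
    using f cd by (simp add: loc_integrable_def)
  then have "set_integrable lborel {c<..<d} f"
    by (rule set_integrable_subset) auto
  then have g: "integrable lborel g"
    by (simp add: set_integrable_def g_def[abs_def])
  have "AE x in lborel. g x = 0"
  proof (rule AE_zero_if_integrals_zero[OF g])
    fix a b
    have "indicator {a<..<b} x * g x = indicator {max a c<..<min b d} x * f x" for x
      by (auto simp: g_def indicator_def)
    moreover have "{max a c..min b d} \<subseteq> U" using cd by auto
    ultimately show "(LINT x:{a<..<b}|lborel. g x) = 0"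
      using z by (simp add: set_lebesgue_integral_def)
    show "(\<integral>x. g x \<partial>lborel) = 0"
      using z[OF cd(2)] by (simp add: set_lebesgue_integral_def g_def)
  qed
  then show "AE x in lborel. x \<in> {c<..<d} \<longrightarrow> f x = 0"
    by (rule AE_mp) (auto simp: g_def)
qed

lemma weak_deriv_unique:
  assumes "open U" "weak_deriv U f g" "weak_deriv U f h"
  shows "AE x in lborel. x \<in> U \<longrightarrow> g x = h x"
proof -
  have "AE x in lborel. x \<in> U \<longrightarrow> g x - h x = 0"
  proof (rule fundamental_lemma[OF assms(1)])
    show "loc_integrable U (\<lambda>x. g x - h x)"
      using assms by (intro loc_integrable_diff) (auto simp: weak_deriv_def)
    fix \<phi> assume \<phi>: "test_fun U \<phi>"
    then have "(LINT x:U|lborel. g x * \<phi> x) = (LINT x:U|lborel. h x * \<phi> x)"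
      using assms unfolding weak_deriv_def by force
    moreover have "set_integrable lborel U (\<lambda>x. g x * \<phi> x)" "set_integrable lborel U (\<lambda>x. h x * \<phi> x)"
      using assms \<phi> by (auto simp: weak_deriv_def intro: loc_integrable_mult_test)
    ultimately show "(LINT x:U|lborel. (g x - h x) * \<phi> x) = 0"
      by (simp add: left_diff_distrib set_integral_diff)
  qed
  then show ?thesis by (rule AE_mp) auto
qed

lemma AE_eq_continuous_imp_eq:
  fixes f g :: "real \<Rightarrow> real"
  assumes U: "open U" and f: "continuous_on U f" and g: "continuous_on U g"
    and ae: "AE x in lborel. x \<in> U \<longrightarrow> f x = g x" and x: "x \<in> U"
  shows "f x = g x"
proof (rule ccontr)
  assume "f x \<noteq> g x"
  let ?V = "(\<lambda>x. f x - g x) -` (- {0}) \<inter> U"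
  have "open ?V"
    using continuous_on_open_vimage[OF U, of "\<lambda>x. f x - g x"] f g
    by (auto intro: continuous_on_diff)
  moreover have "x \<in> ?V" using x \<open>f x \<noteq> g x\<close> by auto
  ultimately have "\<not> negligible ?V"
    using open_not_negligible by blast
  moreover have "?V \<in> null_sets lborel"
    using ae \<open>open ?V\<close> by (intro AE_iff_null_sets[THEN iffD2]) (auto elim!: AE_mp)
  then have "negligible ?V"
    by (simp add: negligible_iff_null_sets null_sets_completionI)
  ultimately show False by blast
qed

section \<open>Locally absolutely continuous functions\<close>

text \<open>Local absolute continuity in integrated form: f is a primitive of f' on every compact
  interval in U. The function f' need not be a pointwise derivative, and U need not be
  connected.\<close>

definition ac_on :: "real set \<Rightarrow> (real \<Rightarrow> real) \<Rightarrow> (real \<Rightarrow> real) \<Rightarrow> bool" where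
  "ac_on U f f' \<longleftrightarrow> (\<forall>c d. c \<le> d \<and> {c..d} \<subseteq> U \<longrightarrow>
     set_integrable lborel {c..d} f' \<and> (LINT x:{c..d}|lborel. f' x) = f d - f c)"

lemma ac_on_subset: "ac_on U f f' \<Longrightarrow> V \<subseteq> U \<Longrightarrow> ac_on V f f'"
  by (force simp: ac_on_def)

lemma ac_on_C1:
  assumes "open U" "\<And>x. x \<in> U \<Longrightarrow> (f has_real_derivative f' x) (at x)" "continuous_on U f'"
  shows "ac_on U f f'"
  unfolding ac_on_def
proof (intro allI impI)
  fix c d assume cd: "c \<le> d \<and> {c..d} \<subseteq> U"
  have "has_bochner_integral lborel (\<lambda>x. f' x * indicator {c..d} x) (f d - f c)"
    using cd assms continuous_on_eq_continuous_at[OF assms(1), of f']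
    by (intro has_bochner_integral_FTC_Icc_real) auto
  then show "set_integrable lborel {c..d} f' \<and> (LINT x:{c..d}|lborel. f' x) = f d - f c"
    by (auto simp: has_bochner_integral_iff set_integrable_def set_lebesgue_integral_def mult.commute)
qed

text \<open>Local integrability of g' is asked for because a change on a null set may destroy Borel
  measurability.\<close>

lemma ac_on_cong:
  assumes "ac_on U f f'" "\<And>x. x \<in> U \<Longrightarrow> f x = g x" "AE x in lborel. x \<in> U \<longrightarrow> f' x = g' x"
    and g': "loc_integrable U g'"
  shows "ac_on U g g'"
  unfolding ac_on_def
proof (intro allI impI)
  fix c d assume cd: "c \<le> d \<and> {c..d} \<subseteq> U"
  then have i: "set_integrable lborel {c..d} f'" and e: "(LINT x:{c..d}|lborel. f' x) = f d - f c"
    using assms(1) by (auto simp: ac_on_def)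
  have i': "set_integrable lborel {c..d} g'"
    using cd g' by (auto simp: loc_integrable_def)
  have "(LINT x:{c..d}|lborel. g' x) = (LINT x:{c..d}|lborel. f' x)"
    unfolding set_lebesgue_integral_def
  proof (rule integral_cong_AE)
    show "AE x in lborel. indicator {c..d} x *\<^sub>R g' x = indicator {c..d} x *\<^sub>R f' x"
      using assms(3) by eventually_elim (use cd in \<open>auto simp: indicator_def\<close>)
  qed (use i i' in \<open>auto simp: set_integrable_def\<close>)
  moreover have "c \<in> U" "d \<in> U" using cd by auto
  ultimately show "set_integrable lborel {c..d} g' \<and> (LINT x:{c..d}|lborel. g' x) = g d - g c"
    using i' e assms(2) by auto
qed

lemma ac_on_add: "ac_on U f f' \<Longrightarrow> ac_on U g g' \<Longrightarrow> ac_on U (\<lambda>x. f x + g x) (\<lambda>x. f' x + g' x)"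
  by (auto simp: ac_on_def set_integral_add)

lemma ac_on_cmult: "ac_on U f f' \<Longrightarrow> ac_on U (\<lambda>x. k * f x) (\<lambda>x. k * f' x)"
  by (auto simp: ac_on_def right_diff_distrib)

lemma ac_on_continuous_on_Icc:
  assumes ac: "ac_on U f f'" and cd: "{c..d} \<subseteq> U"
  shows "continuous_on {c..d} f"
proof (cases "c \<le> d")
  case True
  then have "set_integrable lborel {c..d} f'"
    using ac cd by (auto simp: ac_on_def)
  then have "f' integrable_on {c..d}"
    using set_borel_integral_eq_integral(1) by blast
  then have "continuous_on {c..d} (\<lambda>x. f c + integral {c..x} f')"
    by (intro continuous_intros indefinite_integral_continuous_1)
  moreover have "f x = f c + integral {c..x} f'" if "x \<in> {c..d}" for x
  proof -
    have "{c..x} \<subseteq> U" using that cd by auto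
    then have "set_integrable lborel {c..x} f'" "(LINT x:{c..x}|lborel. f' x) = f x - f c"
      using ac that by (auto simp: ac_on_def)
    then show ?thesis
      using set_borel_integral_eq_integral(2) by fastforce
  qed
  ultimately show ?thesis
    using continuous_on_cong by (metis (no_types, lifting))
qed auto

lemma ac_on_continuous_on:
  assumes "open U" "ac_on U f f'"
  shows "continuous_on U f"
proof (rule continuous_at_imp_continuous_on, rule ballI)
  fix x assume "x \<in> U"
  then obtain e where e: "e > 0" "cball x e \<subseteq> U"
    using assms(1) open_contains_cball by blast
  then have "continuous_on {x - e..x + e} f"
    using ac_on_continuous_on_Icc[OF assms(2)] by (simp add: cball_eq_atLeastAtMost)
  then have "continuous_on {x - e<..<x + e} f"
    by (rule continuous_on_subset) auto
  then show "isCont f x"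
    using e continuous_on_eq_continuous_at[of "{x - e<..<x + e}" f] by simp
qed

text \<open>Fubini's theorem on the triangle \<open>y \<le> x\<close> gives
  \<open>\<integral> (f - f c) g' = \<integral> f' (g d - g)\<close>.\<close>

lemma ac_on_mult:
  assumes f: "ac_on U f f'" and g: "ac_on U g g'"
  shows "ac_on U (\<lambda>x. f x * g x) (\<lambda>x. f' x * g x + f x * g' x)"
  unfolding ac_on_def
proof (intro allI impI)
  fix c d assume cd: "c \<le> d \<and> {c..d} \<subseteq> U"
  define F where "F y = indicator {c..d} y * f' y" for y
  define G where "G y = indicator {c..d} y * g' y" for y
  have F[measurable]: "integrable lborel F" and F': "(\<integral>y. F y \<partial>lborel) = f d - f c"
    and G[measurable]: "integrable lborel G" and G': "(\<integral>y. G y \<partial>lborel) = g d - g c"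
    using f g cd by (auto simp: ac_on_def set_integrable_def set_lebesgue_integral_def F_def[abs_def] G_def[abs_def])
  have FM[measurable]: "F \<in> borel_measurable borel" and GM[measurable]: "G \<in> borel_measurable borel"
    using F G by auto
  have cont: "continuous_on {c..d} f" "continuous_on {c..d} g"
    using f g cd by (auto intro: ac_on_continuous_on_Icc)
  have If: "integrable lborel (\<lambda>x. indicator {c..d} x * f x)" "integrable lborel (\<lambda>x. indicator {c..d} x * g x)"
    using borel_integrable_compact[OF compact_Icc cont(1)] borel_integrable_compact[OF compact_Icc cont(2)] by auto
  have Fx: "(\<integral>y. F y * indicator {y. y \<le> x} y \<partial>lborel) = f x - f c" if "x \<in> {c..d}" for x
  proof -
    have "(\<lambda>y. F y * indicator {y. y \<le> x} y) = (\<lambda>y. indicator {c..x} y * f' y)"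
      using that by (auto simp: F_def indicator_def)
    moreover have "{c..x} \<subseteq> U" using that cd by auto
    ultimately show ?thesis
      using f that by (auto simp: ac_on_def set_lebesgue_integral_def)
  qed
  have Gy: "(\<integral>x. G x * indicator {x. y \<le> x} x \<partial>lborel) = g d - g y" if "y \<in> {c..d}" for y
  proof -
    have "(\<lambda>x. G x * indicator {x. y \<le> x} x) = (\<lambda>x. indicator {y..d} x * g' x)"
      using that by (auto simp: G_def indicator_def)
    moreover have "{y..d} \<subseteq> U" using that cd by auto
    ultimately show ?thesis
      using g that by (auto simp: ac_on_def set_lebesgue_integral_def)
  qed
  define H where "H = (\<lambda>x y. G x * (F y * indicator {y. y \<le> x} y))"
  have [measurable]: "case_prod H \<in> borel_measurable (lborel \<Otimes>\<^sub>M lborel)"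
    unfolding H_def by measurable
  have Fint: "integrable lborel (\<lambda>y. F y * indicator {y. y \<le> x} y)" for x
    using F by (intro integrable_real_mult_indicator) auto
  have "integrable (lborel \<Otimes>\<^sub>M lborel) (case_prod H)"
  proof (rule lborel_pair.Fubini_integrable)
    show "AE x in lborel. integrable lborel (\<lambda>y. case_prod H (x, y))"
      unfolding H_def by (simp add: Fint)
    show "integrable lborel (\<lambda>x. \<integral>y. norm (case_prod H (x, y)) \<partial>lborel)"
    proof (rule Bochner_Integration.integrable_bound)
      show "integrable lborel (\<lambda>x. \<bar>G x\<bar> * (\<integral>y. \<bar>F y\<bar> \<partial>lborel))"
        using G by (intro integrable_mult_left) auto
      have "(\<integral>y. norm (H x y) \<partial>lborel) \<le> (\<integral>y. \<bar>G x\<bar> * \<bar>F y\<bar> \<partial>lborel)" for x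
        unfolding H_def using F Fint[of x]
        by (intro integral_mono integrable_norm integrable_mult_right integrable_abs)
          (auto simp: abs_mult indicator_def mult_left_mono)
      then show "AE x in lborel. norm (\<integral>y. norm (case_prod H (x, y)) \<partial>lborel)
          \<le> norm (\<bar>G x\<bar> * (\<integral>y. \<bar>F y\<bar> \<partial>lborel))"
        by (auto simp: abs_mult abs_of_nonneg[OF Bochner_Integration.integral_nonneg])
    qed measurable
  qed measurable
  then have "(\<integral>y. (\<integral>x. H x y \<partial>lborel) \<partial>lborel) = (\<integral>x. (\<integral>y. H x y \<partial>lborel) \<partial>lborel)"
    by (rule lborel_pair.Fubini_integral)
  moreover have "(\<integral>y. H x y \<partial>lborel) = G x * f x - f c * G x" for x
  proof (cases "x \<in> {c..d}")
    case True
    then show ?thesis unfolding H_def using Fx[OF True] by (simp add: right_diff_distrib mult.commute)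
  qed (simp add: H_def G_def)
  moreover have "(\<integral>x. H x y \<partial>lborel) = g d * F y - F y * g y" for y
  proof -
    have "(\<integral>x. H x y \<partial>lborel) = (\<integral>x. F y * (G x * indicator {x. y \<le> x} x) \<partial>lborel)"
      unfolding H_def by (intro Bochner_Integration.integral_cong) (auto simp: indicator_def)
    then show ?thesis
      using Gy[of y] by (cases "y \<in> {c..d}") (auto simp: F_def right_diff_distrib mult.commute)
  qed
  ultimately have "(\<integral>y. g d * F y - F y * g y \<partial>lborel) = (\<integral>x. G x * f x - f c * G x \<partial>lborel)"
    by simp
  have bdd: "\<exists>C. \<forall>x. \<bar>indicator {c..d} x * h x\<bar> \<le> C" if "continuous_on {c..d} h" for h :: "real \<Rightarrow> real"
  proof -
    have "bounded (h ` {c..d})" using that compact_continuous_image compact_imp_bounded by blast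
    then obtain C where "\<And>x. x \<in> {c..d} \<Longrightarrow> \<bar>h x\<bar> \<le> C" unfolding bounded_iff by (metis imageI real_norm_def)
    then show ?thesis by (intro exI[of _ "max C 0"]) (auto simp: indicator_def abs_mult le_max_iff_disj)
  qed
  have Fg: "integrable lborel (\<lambda>y. F y * g y)"
  proof -
    obtain C where "\<And>x. \<bar>indicator {c..d} x * g x\<bar> \<le> C" using bdd[OF cont(2)] by blast
    then have "integrable lborel (\<lambda>y. F y * (indicator {c..d} y * g y))"
      using F If by (intro integrable_mult_bounded[where C = C]) auto
    moreover have "F y * (indicator {c..d} y * g y) = F y * g y" for y
      by (auto simp: F_def indicator_def)
    ultimately show ?thesis by simp
  qed
  have Gf: "integrable lborel (\<lambda>y. G y * f y)"
  proof -
    obtain C where "\<And>x. \<bar>indicator {c..d} x * f x\<bar> \<le> C" using bdd[OF cont(1)] by blast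
    then have "integrable lborel (\<lambda>y. G y * (indicator {c..d} y * f y))"
      using G If by (intro integrable_mult_bounded[where C = C]) auto
    moreover have "G y * (indicator {c..d} y * f y) = G y * f y" for y
      by (auto simp: G_def indicator_def)
    ultimately show ?thesis by simp
  qed
  \<comment> \<open>Solving this for the sum of the integrals of f' g and f g' gives f d g d - f c g
    c, the product rule in integrated form.\<close>
  have "g d * (f d - f c) - (\<integral>y. F y * g y \<partial>lborel) = (\<integral>x. G x * f x \<partial>lborel) - f c * (g d - g c)"
    using \<open>(\<integral>y. g d * F y - F y * g y \<partial>lborel) = _\<close> F G Fg Gf by (simp add: F' G')
  moreover have *: "(\<lambda>x. indicator {c..d} x * (f' x * g x + f x * g' x)) = (\<lambda>y. F y * g y + G y * f y)"
    by (auto simp: F_def G_def indicator_def)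
  ultimately show "set_integrable lborel {c..d} (\<lambda>x. f' x * g x + f x * g' x) \<and>
      (LINT x:{c..d}|lborel. f' x * g x + f x * g' x) = f d * g d - f c * g c"
    using Fg Gf by (auto simp: set_integrable_def set_lebesgue_integral_def algebra_simps)
qed

text \<open>U may have infinitely many components, so no single interval inside U contains S. Both
  functions are extended by 0 outside U. The fundamental theorem then holds on every short interval
  around a given point: around a point of U by \<open>ac_on\<close>, around any other point because
  S is at a positive distance. Bolzano's subdivision argument glues these intervals to one that
  contains S.\<close>

lemma ac_on_compact_support:
  assumes U: "open U" and ac: "ac_on U f f'" and S: "compact S" "S \<subseteq> U"
    and f0: "\<And>x. x \<in> U \<Longrightarrow> x \<notin> S \<Longrightarrow> f x = 0 \<and> f' x = 0"
  shows "set_integrable lborel U f'" "(LINT x:U|lborel. f' x) = 0"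
proof -
  define h where "h x = (if x \<in> U then f' x else 0)" for x
  define g where "g x = (if x \<in> U then f x else 0)" for x
  define P where "P c d \<longleftrightarrow> set_integrable lborel {c..d} h \<and> (LINT x:{c..d}|lborel. h x) = g d - g c" for c d
  obtain A where A: "\<And>x. x \<in> S \<Longrightarrow> \<bar>x\<bar> \<le> A"
    using compact_imp_bounded[OF S(1)] unfolding bounded_iff by (metis real_norm_def)
  define L where "L = \<bar>A\<bar> + 1"
  have L: "x \<in> S \<Longrightarrow> -L < x \<and> x < L" for x using A[of x] by (auto simp: L_def)
  have "P (- L) L"
  proof (rule Bolzano)
    show "- L \<le> L" by (auto simp: L_def)
    fix a b c assume p: "P a b" "P b c" "a \<le> b" "b \<le> c"
    then have ab: "{a..c} = {a..b} \<union> {b..c}" by auto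
    have "AE x in lborel. \<not> (x \<in> {a..b} \<and> x \<in> {b..c})"
      using AE_lborel_singleton[of b] by (rule AE_mp) auto
    then have "(LINT x:{a..c}|lborel. h x) = (LINT x:{a..b}|lborel. h x) + (LINT x:{b..c}|lborel. h x)"
      unfolding ab by (intro set_integral_Un_AE) (use p in \<open>auto simp: P_def\<close>)
    moreover have "set_integrable lborel {a..c} h"
      unfolding ab by (intro set_integrable_Un) (use p in \<open>auto simp: P_def\<close>)
    ultimately show "P a c" using p by (auto simp: P_def)
  next
    fix x :: real
    show "\<exists>d>0. \<forall>a b. a \<le> x \<and> x \<le> b \<and> b - a < d \<longrightarrow> P a b"
    proof (cases "x \<in> U")
      case True
      then obtain e where e: "e > 0" "ball x e \<subseteq> U" using U open_contains_ball by blast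
      have "P a b" if "a \<le> x" "x \<le> b" "b - a < e" for a b
      proof -
        have ab: "{a..b} \<subseteq> U" using e that by (auto simp: ball_def dist_real_def subset_eq)
        then have "set_integrable lborel {a..b} f'" "(LINT x:{a..b}|lborel. f' x) = f b - f a"
          using ac that by (auto simp: ac_on_def)
        moreover have "indicator {a..b} y * h y = indicator {a..b} y * f' y" for y
          using ab by (auto simp: h_def indicator_def)
        then have "set_integrable lborel {a..b} h = set_integrable lborel {a..b} f'"
          "(LINT x:{a..b}|lborel. f' x) = (LINT x:{a..b}|lborel. h x)"
          by (simp_all only: set_integrable_def set_lebesgue_integral_def real_scaleR_def)
        moreover have "a \<in> U" "b \<in> U" using ab that by auto
        ultimately show ?thesis by (simp add: P_def g_def)
      qed
      then show ?thesis using e by blast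
    next
      case False
      then have "x \<in> - S" "open (- S)" using S compact_imp_closed by auto
      then obtain e where e: "e > 0" "ball x e \<subseteq> - S" using open_contains_ball by blast
      have "P a b" if "a \<le> x" "x \<le> b" "b - a < e" for a b
      proof -
        have ab: "{a..b} \<subseteq> - S" using e that by (auto simp: ball_def dist_real_def subset_eq)
        then have h: "h y = 0" "g y = 0" if "y \<in> {a..b}" for y using that f0[of y] by (auto simp: h_def g_def)
        have "indicator {a..b} y * h y = 0" for y
          using h(1)[of y] by (auto simp: indicator_def)
        then have "(\<lambda>y. indicator {a..b} y * h y) = (\<lambda>y. 0)" by blast
        moreover have "a \<in> {a..b}" "b \<in> {a..b}" using that by auto
        ultimately show ?thesis
          using h(2) by (simp only: P_def set_integrable_def set_lebesgue_integral_def real_scaleR_def) simp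
      qed
      then show ?thesis using e by blast
    qed
  qed
  moreover have "g L = 0" "g (- L) = 0" using L[of L] L[of "-L"] f0 by (auto simp: g_def)
  moreover have "(\<lambda>x. indicator {- L..L} x * h x) = (\<lambda>x. indicator U x * f' x)"
  proof
    fix x show "indicator {- L..L} x * h x = indicator U x * f' x"
      using L[of x] f0[of x] by (cases "x \<in> S") (auto simp: h_def indicator_def)
  qed
  ultimately show "set_integrable lborel U f'" "(LINT x:U|lborel. f' x) = 0"
    by (auto simp: P_def set_integrable_def set_lebesgue_integral_def)
qed

lemma ac_on_test: "open U \<Longrightarrow> smooth \<phi> \<Longrightarrow> ac_on U \<phi> (deriv \<phi>)"
  by (intro ac_on_C1 smooth_DERIV smooth_continuous_on smooth_deriv)

lemma ac_on_imp_weak: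
  assumes U: "open U" and ac: "ac_on U f f'" and f': "loc_integrable U f'" and \<phi>: "test_fun U \<phi>"
  shows "(LINT x:U|lborel. f x * deriv \<phi> x) = - (LINT x:U|lborel. f' x * \<phi> x)"
proof -
  have "(LINT x:U|lborel. f' x * \<phi> x + f x * deriv \<phi> x) = 0"
    by (rule ac_on_compact_support(2)[OF U ac_on_mult[OF ac ac_on_test[OF U test_fun_smooth[OF \<phi>]]]
          test_fun_supp(1,2)[OF \<phi>]])
      (auto simp: not_in_supp deriv_eq_0_outside_supp)
  moreover have "set_integrable lborel U (\<lambda>x. f' x * \<phi> x)" "set_integrable lborel U (\<lambda>x. f x * deriv \<phi> x)"
    using f' \<phi> ac_on_continuous_on[OF U ac]
    by (auto intro!: loc_integrable_mult_test test_fun_deriv loc_integrable_continuous)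
  ultimately show ?thesis
    by (simp add: set_integral_add)
qed

section \<open>Weak derivatives and absolute continuity\<close>

lemma weak_deriv_subset:
  assumes "weak_deriv U f g" "V \<subseteq> U" shows "weak_deriv V f g"
  using assms LINT_test_subset[OF _ assms(2)] test_fun_mono[OF _ assms(2)]
  unfolding weak_deriv_def by (metis loc_integrable_subset test_fun_deriv)

text \<open>The primitive that starts at 0 at the left end of the support of g returns to 0 at the
  right end because g has mean 0. So it is again supported between these two points.\<close>

lemma test_fun_antiderivative:
  fixes g :: "real \<Rightarrow> real"
  assumes g: "test_fun {c<..<d} g" and 0: "(LINT x:{c<..<d}|lborel. g x) = 0"
  obtains \<psi> where "test_fun {c<..<d} \<psi>" "deriv \<psi> = g"
proof -
  have cont: "isCont g x" for x
    using smooth_continuous_on[OF test_fun_smooth[OF g], of UNIV] continuous_on_eq_continuous_at[of UNIV] by auto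
  obtain F where F: "\<And>x. (F has_real_derivative g x) (at x)"
    using einterval_antiderivative[of "-\<infinity>" "\<infinity>" g] cont
    by (auto simp: has_real_derivative_iff_has_vector_derivative)
  define K where "K = supp g"
  have K: "compact K" "K \<subseteq> {c<..<d}" using g by (auto simp: K_def test_fun_def)
  show thesis
  proof (cases "K = {}")
    case True
    then have "g = (\<lambda>x. 0)" using not_in_supp by (auto simp: K_def)
    moreover have "deriv (\<lambda>x::real. 0::real) = (\<lambda>x. 0)" by auto
    ultimately show thesis using that[of "\<lambda>x. 0"] g by simp
  next
    case False
    obtain m where m: "m \<in> K" "\<And>x. x \<in> K \<Longrightarrow> m \<le> x" using compact_attains_inf[OF K(1) False] by blast
    obtain M where M: "M \<in> K" "\<And>x. x \<in> K \<Longrightarrow> x \<le> M" using compact_attains_sup[OF K(1) False] by blast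
    have cd: "c < m" "m \<le> M" "M < d" using m M K by auto
    have FTC: "(LINT x:{x..y}|lborel. g x) = F y - F x" if "x \<le> y" for x y
      using integral_FTC_Icc_real[OF that F cont] by (simp add: set_lebesgue_integral_def mult.commute)
    have z: "g x = 0" if "x < m \<or> M < x" for x
      using that m(2)[of x] M(2)[of x] not_in_supp[of x g] by (force simp: K_def)
    have z0: "(LINT x:{x..y}|lborel. g x) = 0" if "y \<le> m \<or> M \<le> x" for x y
    proof -
      have "AE z in lborel. indicator {x..y} z * g z = 0"
        using AE_lborel_singleton[of m] AE_lborel_singleton[of M]
        by eventually_elim (use that z in \<open>auto simp: indicator_def\<close>)
      then have "(\<integral>z. indicator {x..y} z * g z \<partial>lborel) = 0"
        by (rule integral_eq_zero_AE)
      then show ?thesis by (simp add: set_lebesgue_integral_def)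
    qed
    have "(LINT x:{m..M}|lborel. g x) = (LINT x:{c<..<d}|lborel. g x)"
      unfolding set_lebesgue_integral_def
    proof (intro Bochner_Integration.integral_cong refl)
      fix x show "indicator {m..M} x *\<^sub>R g x = indicator {c<..<d} x *\<^sub>R g x"
        using z[of x] cd by (cases "x < m \<or> M < x") (auto simp: indicator_def)
    qed
    then have FM: "F M = F m" using FTC[OF cd(2)] 0 by simp
    define \<psi> where "\<psi> x = F x - F m" for x
    have d: "(\<psi> has_real_derivative g x) (at x)" for x
      unfolding \<psi>_def[abs_def] using F[of x] by (auto intro!: derivative_eq_intros)
    have "\<psi> x = 0" if "x \<notin> {m..M}" for x
    proof (cases "x < m")
      case True
      then show ?thesis using FTC[of x m] z0[of m x] by (simp add: \<psi>_def)
    next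
      case False
      then show ?thesis using FTC[of M x] z0[of x M] that FM by (simp add: \<psi>_def)
    qed
    moreover have "smooth \<psi>" using smoothI_DERIV[OF d] g test_fun_smooth by blast
    ultimately have "test_fun {c<..<d} \<psi>"
      using cd by (intro test_funI[of _ "{m..M}"]) auto
    moreover have "deriv \<psi> = g" using d DERIV_imp_deriv by blast
    ultimately show thesis by (rule that)
  qed
qed

text \<open>The lemma of du Bois-Reymond. The difference h of f and the primitive of g pairs to 0
  with all derivatives of test functions, and these are exactly the test functions of mean 0. Every
  test function has mean 0 up to a multiple of one fixed bump, so h acts as a constant.\<close>

lemma weak_deriv_primitive:
  assumes w: "weak_deriv U f g" and cd: "c < d" "{c..d} \<subseteq> U"
  obtains k where "AE x in lborel. x \<in> {c<..<d} \<longrightarrow> f x = k + (LINT y:{c..x}|lborel. g y)"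
    "ac_on {c..d} (\<lambda>x. LINT y:{c..x}|lborel. g y) g"
proof -
  define G where "G x = (LINT y:{c..x}|lborel. g y)" for x
  let ?V = "{c<..<d}"
  have g: "set_integrable lborel {x..y} g" if "{x..y} \<subseteq> {c..d}" for x y
    using w subset_trans[OF that cd(2)] by (auto simp: weak_deriv_def loc_integrable_def)
  have ac: "ac_on {c..d} G g"
    unfolding ac_on_def
  proof (intro allI impI)
    fix x y assume xy: "x \<le> y \<and> {x..y} \<subseteq> {c..d}"
    then have e: "{c..y} = {c..x} \<union> {x..y}" by auto
    have "AE z in lborel. \<not> (z \<in> {c..x} \<and> z \<in> {x..y})"
      using AE_lborel_singleton[of x] by (rule AE_mp) auto
    then have "G y = G x + (LINT x:{x..y}|lborel. g x)"
      unfolding G_def e using xy by (intro set_integral_Un_AE g) auto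
    then show "set_integrable lborel {x..y} g \<and> (LINT x:{x..y}|lborel. g x) = G y - G x"
      using g xy by auto
  qed
  then have acV: "ac_on ?V G g" by (rule ac_on_subset) auto
  have wV: "weak_deriv ?V f g" using w by (rule weak_deriv_subset) (use cd in auto)
  define h where "h x = f x - G x" for x
  have locG: "loc_integrable ?V G"
    by (intro loc_integrable_continuous ac_on_continuous_on[OF _ acV]) auto
  have loch: "loc_integrable ?V h"
    unfolding h_def using locG wV by (intro loc_integrable_diff) (auto simp: weak_deriv_def)
  have h0: "(LINT x:?V|lborel. h x * deriv \<psi> x) = 0" if "test_fun ?V \<psi>" for \<psi>
  proof -
    have "(LINT x:?V|lborel. f x * deriv \<psi> x) = (LINT x:?V|lborel. G x * deriv \<psi> x)"
      using ac_on_imp_weak[OF _ acV _ that] wV that by (auto simp: weak_deriv_def)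
    moreover have "set_integrable lborel ?V (\<lambda>x. f x * deriv \<psi> x)" "set_integrable lborel ?V (\<lambda>x. G x * deriv \<psi> x)"
      using that wV locG by (auto intro!: loc_integrable_mult_test test_fun_deriv simp: weak_deriv_def)
    ultimately show ?thesis by (simp add: h_def left_diff_distrib set_integral_diff)
  qed
  obtain c1 d1 where c1: "c < c1" "c1 < d1" "d1 < d"
    using cd(1) dense by meson
  \<comment> \<open>The reference bump with non-zero integral: subtracting a suitable multiple of it
    turns any test function into one of mean 0.\<close>
  define \<theta> where "\<theta> = bump c1 d1"
  have \<theta>: "test_fun ?V \<theta>" unfolding \<theta>_def using c1 by (intro test_fun_bump) auto
  define I where "I = (LINT x:?V|lborel. \<theta> x)"
  have int1: "set_integrable lborel ?V \<phi>" if "test_fun ?V \<phi>" for \<phi>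
    using loc_integrable_mult_test[OF loc_integrable_continuous[OF continuous_on_const[of _ 1]] that] by simp
  have I: "I \<noteq> 0"
  proof
    assume "I = 0"
    then have "AE x in lborel. indicator ?V x * \<theta> x = 0"
      using int1[OF \<theta>] bump_nonneg
      by (subst integral_nonneg_eq_0_iff_AE[symmetric]) (auto simp: I_def set_integrable_def set_lebesgue_integral_def \<theta>_def)
    then have "AE x in lborel. x \<in> {c1<..<d1} \<longrightarrow> (1::real) = 0"
      by (rule AE_mp) (use c1 in \<open>auto simp: \<theta>_def bump_eq_0_iff indicator_def\<close>)
    from AE_eq_continuous_imp_eq[OF _ _ _ this, of "(c1 + d1)/2"] c1 show False by auto
  qed
  define k where "k = (LINT x:?V|lborel. h x * \<theta> x) / I"
  have "AE x in lborel. x \<in> ?V \<longrightarrow> h x - k = 0"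
  proof (rule fundamental_lemma)
    show "loc_integrable ?V (\<lambda>x. h x - k)"
      by (intro loc_integrable_diff loch loc_integrable_continuous continuous_intros)
    fix \<phi> assume \<phi>: "test_fun ?V \<phi>"
    define s where "s = (LINT x:?V|lborel. \<phi> x) / I"
    have t: "test_fun ?V (\<lambda>x. \<phi> x - s * \<theta> x)"
      by (intro test_fun_diff \<phi> test_fun_cmult \<theta>)
    have "(LINT x:?V|lborel. \<phi> x - s * \<theta> x) = 0"
      using int1[OF \<phi>] int1[OF \<theta>] I by (subst set_integral_diff) (auto simp: s_def I_def)
    then obtain \<psi> where \<psi>: "test_fun ?V \<psi>" "deriv \<psi> = (\<lambda>x. \<phi> x - s * \<theta> x)"
      using test_fun_antiderivative[OF t] by blast
    have i: "set_integrable lborel ?V (\<lambda>x. h x * \<phi> x)" "set_integrable lborel ?V (\<lambda>x. h x * \<theta> x)"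
      using loch \<phi> \<theta> by (auto intro: loc_integrable_mult_test)
    have "0 = (LINT x:?V|lborel. h x * \<phi> x - s * (h x * \<theta> x))"
      using h0[OF \<psi>(1)] by (simp add: \<psi>(2) algebra_simps)
    also have "\<dots> = (LINT x:?V|lborel. h x * \<phi> x) - s * (LINT x:?V|lborel. h x * \<theta> x)"
      using i by (subst set_integral_diff) auto
    also have "s * (LINT x:?V|lborel. h x * \<theta> x) = k * (LINT x:?V|lborel. \<phi> x)"
      by (simp add: s_def k_def)
    also have "(LINT x:?V|lborel. h x * \<phi> x) - k * (LINT x:?V|lborel. \<phi> x) = (LINT x:?V|lborel. (h x - k) * \<phi> x)"
      using i int1[OF \<phi>] by (simp add: left_diff_distrib set_integral_diff)
    finally show "(LINT x:?V|lborel. (h x - k) * \<phi> x) = 0" by simp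
  qed auto
  then have "AE x in lborel. x \<in> ?V \<longrightarrow> f x = k + G x"
    by (rule AE_mp) (auto simp: h_def)
  then show thesis using that ac by (simp add: G_def[abs_def])
qed

lemma Icc_enlarge:
  fixes c d :: real
  assumes "open U" "{c..d} \<subseteq> U" "c \<le> d"
  obtains e where "e > 0" "{c - e..d + e} \<subseteq> U"
proof -
  obtain e1 e2 where e: "e1 > 0" "cball c e1 \<subseteq> U" "e2 > 0" "cball d e2 \<subseteq> U"
    using assms open_contains_cball by (metis atLeastAtMost_iff order_refl subsetD)
  have "{c - min e1 e2..d + min e1 e2} \<subseteq> {c..d} \<union> cball c e1 \<union> cball d e2"
    by (auto simp: dist_real_def)
  then have "{c - min e1 e2..d + min e1 e2} \<subseteq> U"
    using e assms by blast
  then show thesis using that[of "min e1 e2"] e by simp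
qed

text \<open>On a slightly larger open interval v and a constant plus the primitive of g are both
  continuous and agree almost everywhere, hence everywhere. The enlargement makes this valid at the
  end points c and d as well.\<close>

lemma weak_deriv_ac_on:
  assumes U: "open U" and w: "weak_deriv U f g"
    and v: "continuous_on U v" and ae: "AE x in lborel. x \<in> U \<longrightarrow> v x = f x"
  shows "ac_on U v g"
  unfolding ac_on_def
proof (intro allI impI)
  fix c d :: real assume cd: "c \<le> d \<and> {c..d} \<subseteq> U"
  then obtain e where e: "e > 0" "{c - e..d + e} \<subseteq> U"
    using Icc_enlarge[OF U] by metis
  let ?V = "{c - e<..<d + e}"
  have "c - e < d + e" using e cd by auto
  from weak_deriv_primitive[OF w this e(2)]
  obtain k where k: "AE x in lborel. x \<in> ?V \<longrightarrow> f x = k + (LINT y:{c - e..x}|lborel. g y)"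
    and ac: "ac_on {c - e..d + e} (\<lambda>x. LINT y:{c - e..x}|lborel. g y) g" by blast
  have acV: "ac_on ?V (\<lambda>x. LINT y:{c - e..x}|lborel. g y) g" using ac by (rule ac_on_subset) auto
  have ve: "v x = k + (LINT y:{c - e..x}|lborel. g y)" if "x \<in> ?V" for x
  proof (rule AE_eq_continuous_imp_eq[OF _ _ _ _ that])
    show "continuous_on ?V v" by (rule continuous_on_subset[OF v]) (use e in auto)
    show "continuous_on ?V (\<lambda>x. k + (LINT y:{c - e..x}|lborel. g y))"
      by (intro continuous_on_add continuous_on_const ac_on_continuous_on[OF _ acV] open_greaterThanLessThan)
    show "AE x in lborel. x \<in> ?V \<longrightarrow> v x = k + (LINT y:{c - e..x}|lborel. g y)"
      using ae k
    proof eventually_elim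
      case (elim x)
      then show ?case using e(2) by (metis atLeastAtMost_iff greaterThanLessThan_iff less_imp_le subsetD)
    qed
  qed auto
  have "{c..d} \<subseteq> ?V" using e by auto
  then have "set_integrable lborel {c..d} g \<and>
      (LINT x:{c..d}|lborel. g x) = (LINT y:{c - e..d}|lborel. g y) - (LINT y:{c - e..c}|lborel. g y)"
    using acV cd unfolding ac_on_def by blast
  then show "set_integrable lborel {c..d} g \<and> (LINT x:{c..d}|lborel. g x) = v d - v c"
    using ve[of c] ve[of d] cd e by auto
qed

text \<open>The continuous representative is the limit of averages over shrinking intervals.\<close>

lemma weak_deriv_representative:
  assumes U: "open U" and w: "weak_deriv U f g"
  obtains v where "AE x in lborel. x \<in> U \<longrightarrow> v x = f x" "ac_on U v g" "continuous_on U v"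
proof -
  \<comment> \<open>One formula for all of U: the local representatives h are identified with v
    separately on each interval, which makes them consistent on overlaps.\<close>
  define v where "v x = lim (\<lambda>j. real (Suc j) * (LINT y:{x..x + 1 / real (Suc j)}|lborel. f y))" for x
  have loc: "\<exists>h. continuous_on {c..d} h \<and> (\<forall>x\<in>{c<..<d}. v x = h x) \<and>
      (AE x in lborel. x \<in> {c<..<d} \<longrightarrow> f x = h x)" if cd: "c < d" "{c..d} \<subseteq> U" for c d
  proof -
    from weak_deriv_primitive[OF w cd] obtain k
      where k: "AE x in lborel. x \<in> {c<..<d} \<longrightarrow> f x = k + (LINT y:{c..x}|lborel. g y)"
      and ac: "ac_on {c..d} (\<lambda>x. LINT y:{c..x}|lborel. g y) g" by blast
    define h where "h x = k + (LINT y:{c..x}|lborel. g y)" for x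
    have ch: "continuous_on {c..d} h"
      unfolding h_def using ac_on_continuous_on_Icc[OF ac] by (auto intro!: continuous_intros)
    have "v x = h x" if x: "x \<in> {c<..<d}" for x
    proof -
      have "(\<lambda>j. real (Suc j) * (LINT y:{x..x + 1 / real (Suc j)}|lborel. f y)) \<longlonglongrightarrow> h x"
      proof (rule LIMSEQ_I)
        fix r :: real assume "r > 0"
        have "isCont h x"
          using x continuous_on_interior[OF ch] by (simp add: interior_atLeastAtMost_real)
        then obtain \<delta> where \<delta>: "\<delta> > 0" "\<And>y. \<bar>y - x\<bar> < \<delta> \<Longrightarrow> \<bar>h y - h x\<bar> < r / 2"
          using \<open>r > 0\<close> unfolding continuous_at_eps_delta dist_real_def by (metis half_gt_zero)
        obtain N where N: "1 / real (Suc N) < min \<delta> (d - x)"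
          using nat_approx_posE[of "min \<delta> (d - x)"] \<delta> x by auto
        have "norm (real (Suc j) * (LINT y:{x..x + 1 / real (Suc j)}|lborel. f y) - h x) < r" if "j \<ge> N" for j
        proof -
          define l where "l = 1 / real (Suc j)"
          have l: "0 < l" "l < \<delta>" "x + l < d"
            using N that frac_le[of 1 1 "real (Suc N)" "real (Suc j)"] by (auto simp: l_def)
          have sub: "{x..x + l} \<subseteq> {c<..<d}" using l x by auto
          have fi: "set_integrable lborel {x..x + l} f"
            using w subset_trans[OF sub, of U] cd(2) by (force simp: weak_deriv_def loc_integrable_def)
          have ci: "set_integrable lborel {x..x + l} (\<lambda>y. C)" for C :: real
            using borel_integrable_compact[of "{x..x + l}" "\<lambda>_. C"] by (simp add: set_integrable_def)
          have "AE y in lborel. y \<in> {x..x + l} \<longrightarrow> \<bar>f y - h x\<bar> \<le> r / 2"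
            using k
          proof eventually_elim
            case (elim y)
            have "\<bar>h y - h x\<bar> \<le> r / 2" if "y \<in> {x..x + l}"
              using \<delta>(2)[of y] that l by auto
            then show ?case using elim sub by (auto simp: h_def)
          qed
          have "\<bar>(LINT y:{x..x + l}|lborel. f y - h x)\<bar> \<le> (LINT y:{x..x + l}|lborel. r / 2)"
          proof -
            have ii: "set_integrable lborel {x..x + l} (\<lambda>y. f y - h x)"
              using fi ci by (rule set_integral_diff)
            have "\<bar>(LINT y:{x..x + l}|lborel. f y - h x)\<bar> \<le> (LINT y:{x..x + l}|lborel. \<bar>f y - h x\<bar>)"
              using set_integral_norm_bound[OF ii] by simp
            also have "\<dots> \<le> (LINT y:{x..x + l}|lborel. r / 2)"
              by (rule set_integral_mono_AE[OF set_integrable_abs[OF ii]])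
                (use \<open>AE y in lborel. y \<in> {x..x + l} \<longrightarrow> _\<close> ci in auto)
            finally show ?thesis .
          qed
          also have "(LINT y:{x..x + l}|lborel. r / 2) = l * (r / 2)"
            using l by (simp add: set_lebesgue_integral_def)
          also have "(LINT y:{x..x + l}|lborel. f y - h x) = (LINT y:{x..x + l}|lborel. f y) - l * h x"
            using fi ci l by (subst set_integral_diff) (auto simp: set_lebesgue_integral_def)
          finally have "\<bar>(1 / l) * (LINT y:{x..x + l}|lborel. f y) - h x\<bar> \<le> r / 2"
            using l by (simp add: field_simps abs_le_iff)
          then show ?thesis using \<open>r > 0\<close> by (simp add: l_def)
        qed
        then show "\<exists>no. \<forall>j\<ge>no. norm (real (Suc j) * (LINT y:{x..x + 1 / real (Suc j)}|lborel. f y) - h x) < r"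
          by blast
      qed
      then show ?thesis unfolding v_def by (rule limI)
    qed
    then show ?thesis using ch k by (auto simp: h_def intro!: exI[of _ h])
  qed
  have ae: "AE x in lborel. x \<in> U \<longrightarrow> v x = f x"
  proof (rule AE_on_open_realI[OF U])
    fix c d :: real assume "c < d" "{c..d} \<subseteq> U"
    then obtain h where "\<forall>x\<in>{c<..<d}. v x = h x" "AE x in lborel. x \<in> {c<..<d} \<longrightarrow> f x = h x"
      using loc by blast
    then show "AE x in lborel. x \<in> {c<..<d} \<longrightarrow> v x = f x" by auto
  qed
  have cont: "continuous_on U v"
  proof (rule continuous_at_imp_continuous_on, rule ballI)
    fix x assume "x \<in> U"
    then obtain e where e: "e > 0" "cball x e \<subseteq> U" using U open_contains_cball by blast
    then obtain h where h: "continuous_on {x - e..x + e} h" "\<forall>y\<in>{x - e<..<x + e}. v y = h y"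
      using loc[of "x - e" "x + e"] by (auto simp: cball_eq_atLeastAtMost)
    have "continuous_on {x - e<..<x + e} h"
      by (rule continuous_on_subset[OF h(1)]) auto
    then have "continuous_on {x - e<..<x + e} v"
      using h(2) by (subst continuous_on_cong[OF refl, of _ v h]) auto
    then show "isCont v x"
      using e continuous_on_eq_continuous_at[of "{x - e<..<x + e}" v] by simp
  qed
  show thesis using that[OF ae weak_deriv_ac_on[OF U w cont ae] cont] .
qed

section \<open>The entropy density\<close>

text \<open>For n \<ge> 2 the integral diverges at r = 0 and takes its default value 0 there; its
  upper bounds are therefore stated for r > 0.\<close>

definition B_deriv :: "real \<Rightarrow> real \<Rightarrow> real" where
  "B_deriv n r = (LINT v:{r<..}|lborel. 1 / (v powr (n - 1) + v\<^sup>2))"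

lemma B_eq: "B n s = (LINT r:{0..s}|lborel. B_deriv n r)"
  by (simp add: B_def B_deriv_def)

lemma integrable_powr_tail:
  fixes r \<beta> :: real
  assumes "0 < r" "0 < \<beta>"
  shows "set_integrable lborel {r<..} (\<lambda>v. v powr (- 1 - \<beta>))"
    and "(LINT v:{r<..}|lborel. v powr (- 1 - \<beta>)) = r powr (- \<beta>) / \<beta>"
proof -
  have "((\<lambda>v. - (v powr (- \<beta>)) / \<beta>) \<longlongrightarrow> - 0 / \<beta>) at_top"
    using assms by (intro tendsto_intros tendsto_neg_powr filterlim_ident) auto
  then have lim: "((\<lambda>v. - (v powr (- \<beta>)) / \<beta>) \<longlongrightarrow> 0) at_top" by simp
  have nn: "(\<integral>\<^sup>+v. ennreal (v powr (- 1 - \<beta>)) * indicator {r..} v \<partial>lborel) = 0 - (- (r powr (- \<beta>)) / \<beta>)"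
  proof (rule nn_integral_FTC_atLeast[OF _ _ _ lim])
    fix x assume "r \<le> x"
    then show "((\<lambda>v. - (v powr (- \<beta>)) / \<beta>) has_real_derivative x powr (- 1 - \<beta>)) (at x)"
      using assms by (auto intro!: derivative_eq_intros simp: minus_diff_commute)
  qed auto
  have ae: "AE v in lborel. v \<noteq> r" by (rule AE_lborel_singleton)
  have "(\<integral>\<^sup>+v. ennreal (indicator {r<..} v * v powr (- 1 - \<beta>)) \<partial>lborel)
      = (\<integral>\<^sup>+v. ennreal (v powr (- 1 - \<beta>)) * indicator {r..} v \<partial>lborel)"
    by (rule nn_integral_cong_AE) (use ae in \<open>eventually_elim, auto simp: indicator_def\<close>)
  then have e: "(\<integral>\<^sup>+v. ennreal (indicator {r<..} v * v powr (- 1 - \<beta>)) \<partial>lborel) = ennreal (r powr (- \<beta>) / \<beta>)"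
    using nn by simp
  have "has_bochner_integral lborel (\<lambda>v. indicator {r<..} v * v powr (- 1 - \<beta>)) (r powr (- \<beta>) / \<beta>)"
    by (rule has_bochner_integral_nn_integral[OF _ _ _ e]) (use assms in auto)
  then show "set_integrable lborel {r<..} (\<lambda>v. v powr (- 1 - \<beta>))"
    "(LINT v:{r<..}|lborel. v powr (- 1 - \<beta>)) = r powr (- \<beta>) / \<beta>"
    by (auto simp: has_bochner_integral_iff set_integrable_def set_lebesgue_integral_def)
qed

text \<open>The exponent 1 + n / 3 lies between n - 1 and 2 for n < 3, so v^(1 + n / 3) is dominated
  by the first summand for v \<le> 1 and by the second for v > 1. It is chosen so that the tail
  integral is of order r^(- n / 3), which is integrable at 0 for n < 3.\<close>

lemma B_integrand_le:
  fixes v n :: real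
  assumes "0 < v" "0 < n" "n < 3"
  shows "1 / (v powr (n - 1) + v\<^sup>2) \<le> v powr (- 1 - 1)"
    and "1 / (v powr (n - 1) + v\<^sup>2) \<le> v powr (- 1 - n / 3)"
proof -
  have p: "v\<^sup>2 = v powr 2" using assms by simp
  have "1 / (v powr (n - 1) + v\<^sup>2) \<le> 1 / v\<^sup>2"
    using assms by (intro divide_left_mono mult_pos_pos add_nonneg_pos) auto
  also have "1 / v\<^sup>2 = v powr (- 1 - 1)" unfolding p by (simp add: powr_minus_divide)
  finally show "1 / (v powr (n - 1) + v\<^sup>2) \<le> v powr (- 1 - 1)" .
  have "v powr (1 + n / 3) \<le> v powr (n - 1) + v\<^sup>2"
  proof (cases "v \<le> 1")
    case True
    have "v powr (1 + n / 3) \<le> v powr (n - 1)"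
      using powr_mono'[of "n - 1" "1 + n / 3" v] assms True by simp
    then show ?thesis using zero_le_power2[of v] by linarith
  next
    case False
    have "v powr (1 + n / 3) \<le> v powr 2"
      using assms False by (intro powr_mono) auto
    then show ?thesis using p powr_ge_zero[of v "n - 1"] by linarith
  qed
  then have "1 / (v powr (n - 1) + v\<^sup>2) \<le> 1 / (v powr (1 + n / 3))"
    using assms by (intro divide_left_mono mult_pos_pos add_nonneg_pos) auto
  also have "\<dots> = v powr (- 1 - n / 3)"
    using powr_minus_divide[of v "1 + n / 3"] by simp
  finally show "1 / (v powr (n - 1) + v\<^sup>2) \<le> v powr (- 1 - n / 3)" .
qed

lemma B_integrand_integrable:
  fixes r n :: real
  assumes "0 < r" "0 < n" "n < 3"
  shows "set_integrable lborel {r<..} (\<lambda>v. 1 / (v powr (n - 1) + v\<^sup>2))"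
  unfolding set_integrable_def
proof (rule Bochner_Integration.integrable_bound)
  show "integrable lborel (\<lambda>v. indicator {r<..} v *\<^sub>R v powr (- 1 - 1))"
    using integrable_powr_tail(1)[of r 1] assms by (simp add: set_integrable_def)
  show "AE v in lborel. norm (indicator {r<..} v *\<^sub>R (1 / (v powr (n - 1) + v\<^sup>2)))
      \<le> norm (indicator {r<..} v *\<^sub>R v powr (- 1 - 1))"
  proof (rule AE_I2)
    fix v show "norm (indicator {r<..} v *\<^sub>R (1 / (v powr (n - 1) + v\<^sup>2)))
      \<le> norm (indicator {r<..} v *\<^sub>R v powr (- 1 - 1))"
      using B_integrand_le(1)[of v n] assms by (cases "r < v") auto
  qed
qed measurable

lemma B_deriv_nonneg: "0 \<le> B_deriv n r"
  unfolding B_deriv_def set_lebesgue_integral_def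
  by (intro Bochner_Integration.integral_nonneg) (auto simp: indicator_def)

text \<open>The bound 1 / r governs large r and yields the logarithmic growth of B. The other one
  governs r near 0: it makes B finite and controls the flux where u is smaller than
  \<epsilon>.\<close>

lemma B_deriv_le:
  assumes "0 < r" "0 < n" "n < 3"
  shows "B_deriv n r \<le> 1 / r" "B_deriv n r \<le> 3 / n * r powr (- n / 3)"
proof -
  have "B_deriv n r \<le> (LINT v:{r<..}|lborel. v powr (- 1 - 1))"
    unfolding B_deriv_def using assms
    by (intro set_integral_mono B_integrand_integrable integrable_powr_tail B_integrand_le) auto
  then show "B_deriv n r \<le> 1 / r"
    using integrable_powr_tail(2)[of r 1] assms by (simp add: powr_minus_divide)
  have "B_deriv n r \<le> (LINT v:{r<..}|lborel. v powr (- 1 - n / 3))"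
    unfolding B_deriv_def using assms
    by (intro set_integral_mono B_integrand_integrable integrable_powr_tail B_integrand_le) auto
  then show "B_deriv n r \<le> 3 / n * r powr (- n / 3)"
    using integrable_powr_tail(2)[of r "n / 3"] assms by (simp add: mult.commute)
qed

lemma B_deriv_continuous:
  assumes "0 < n" "n < 3"
  shows "continuous_on {0<..} (B_deriv n)"
proof -
  let ?q = "\<lambda>v. 1 / (v powr (n - 1) + v\<^sup>2)"
  have "ac_on {0<..} (\<lambda>r. - B_deriv n r) ?q"
    unfolding ac_on_def
  proof (intro allI impI)
    fix c d :: real assume cd: "c \<le> d \<and> {c..d} \<subseteq> {0<..}"
    then have c: "0 < c" by auto
    have ae: "AE v in lborel. v \<noteq> c" by (rule AE_lborel_singleton)
    have i1: "set_integrable lborel {c<..} ?q" "set_integrable lborel {d<..} ?q"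
      using B_integrand_integrable c cd assms by auto
    then have i2: "set_integrable lborel {c<..d} ?q"
      by (rule_tac set_integrable_subset[of _ "{c<..}"]) auto
    have m: "(\<lambda>v. indicator {c..d} v *\<^sub>R ?q v) \<in> borel_measurable lborel" by measurable
    have i3: "set_integrable lborel {c..d} ?q"
      unfolding set_integrable_def
      by (rule integrable_cong_AE_imp[OF i2[unfolded set_integrable_def] m])
        (use ae in \<open>eventually_elim, auto simp: indicator_def\<close>)
    have "(LINT v:{c..d}|lborel. ?q v) = (LINT v:{c<..d}|lborel. ?q v)"
      unfolding set_lebesgue_integral_def
      by (rule integral_cong_AE) (use ae in \<open>auto simp: indicator_def elim: eventually_mono\<close>)
    moreover have e: "{c<..} = {c<..d} \<union> {d<..}" using cd by auto
    have "B_deriv n c = (LINT v:{c<..d}|lborel. ?q v) + B_deriv n d"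
      unfolding B_deriv_def e by (rule set_integral_Un[OF _ i2 i1(2)]) auto
    ultimately show "set_integrable lborel {c..d} ?q \<and>
        (LINT v:{c..d}|lborel. ?q v) = - B_deriv n d - - B_deriv n c"
      using i3 by simp
  qed
  then have "continuous_on {0<..} (\<lambda>r. - B_deriv n r)"
    by (rule ac_on_continuous_on[rotated]) auto
  then show ?thesis using continuous_on_minus by fastforce
qed

lemma B_deriv_borel:
  assumes "0 < n" "n < 3"
  shows "set_borel_measurable lborel {0..s} (B_deriv n)"
proof -
  have "(\<lambda>r. indicator {0<..} r *\<^sub>R B_deriv n r) \<in> borel_measurable borel"
    by (rule borel_measurable_continuous_on_indicator) (auto intro: B_deriv_continuous assms)
  then have "(\<lambda>r. indicator {0..s} r *\<^sub>R (indicator {0<..} r *\<^sub>R B_deriv n r)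
      + indicator ({0} \<inter> {0..s}) r *\<^sub>R B_deriv n 0) \<in> borel_measurable borel"
    by measurable
  moreover have "(\<lambda>r. indicator {0..s} r *\<^sub>R (indicator {0<..} r *\<^sub>R B_deriv n r)
      + indicator ({0} \<inter> {0..s}) r *\<^sub>R B_deriv n 0) = (\<lambda>r. indicator {0..s} r *\<^sub>R B_deriv n r)"
    by (auto simp: indicator_def fun_eq_iff)
  ultimately show ?thesis by (simp add: set_borel_measurable_def)
qed

lemma B_deriv_integrable:
  assumes "0 < n" "n < 3" "0 \<le> s"
  shows "set_integrable lborel {0..s} (B_deriv n)"
proof -
  have "(\<lambda>x. x powr (- n / 3)) integrable_on {0..s}"
    using assms by (intro integrable_on_powr_from_0) auto
  then have "(\<lambda>x. x powr (- n / 3)) absolutely_integrable_on {0..s}"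
    by (intro nonnegative_absolutely_integrable_1) auto
  then have p: "integrable lborel (\<lambda>x. indicator {0..s} x *\<^sub>R x powr (- n / 3))"
    unfolding set_integrable_def by (subst (asm) integrable_completion) auto
  have ae: "AE x in lborel. x \<noteq> (0::real)" by (rule AE_lborel_singleton)
  show ?thesis
    unfolding set_integrable_def
  proof (rule Bochner_Integration.integrable_bound)
    show "integrable lborel (\<lambda>x. 3 / n * (indicator {0..s} x *\<^sub>R x powr (- n / 3)))"
      using p by (rule integrable_mult_right)
    show "(\<lambda>r. indicator {0..s} r *\<^sub>R B_deriv n r) \<in> borel_measurable lborel"
      using B_deriv_borel[OF assms(1,2)] by (simp add: set_borel_measurable_def)
    show "AE r in lborel. norm (indicator {0..s} r *\<^sub>R B_deriv n r)
        \<le> norm (3 / n * (indicator {0..s} r *\<^sub>R r powr (- n / 3)))"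
      using ae
    proof eventually_elim
      case (elim r)
      show ?case
        using B_deriv_le(2)[of r n] B_deriv_nonneg[of n r] assms elim
        by (cases "r \<in> {0..s}") auto
    qed
  qed
qed

lemma B_continuous:
  assumes "0 < n" "n < 3" shows "continuous_on {0..} (B n)"
proof -
  have "continuous_on {0..S} (B n)" for S
  proof (cases "0 \<le> S")
    case True
    have "B_deriv n integrable_on {0..S}"
      using B_deriv_integrable[OF assms True] set_borel_integral_eq_integral(1) by blast
    then have "continuous_on {0..S} (\<lambda>s. integral {0..s} (B_deriv n))"
      by (rule indefinite_integral_continuous_1)
    then show ?thesis
      using set_borel_integral_eq_integral(2)[OF B_deriv_integrable[OF assms]]
      by (subst continuous_on_cong[OF refl, of _ _ "\<lambda>s. integral {0..s} (B_deriv n)"]) (auto simp: B_eq)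
  qed auto
  then have c: "continuous_on {0..<S} (B n)" for S
    by (rule continuous_on_subset[of "{0..S}"]) auto
  show ?thesis
  proof (rule continuous_on_eq_continuous_within[THEN iffD2], rule ballI)
    fix x :: real assume "x \<in> {0..}"
    then have "continuous (at x within {0..<x + 1}) (B n)"
      using c[of "x + 1"] by (auto simp: continuous_on_eq_continuous_within)
    moreover have "at x within {0..<x + 1} = at x within {0..}"
      by (rule at_within_nhd[of _ "{..<x + 1}"]) auto
    ultimately show "continuous (at x within {0..}) (B n)" by simp
  qed
qed

lemma B_diff:
  assumes "0 < n" "n < 3" "0 \<le> c" "c \<le> s"
  shows "set_integrable lborel {c..s} (B_deriv n)" "B n s - B n c = (LINT r:{c..s}|lborel. B_deriv n r)"
proof -
  have i: "set_integrable lborel {0..s} (B_deriv n)" using assms by (intro B_deriv_integrable) auto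
  then show i2: "set_integrable lborel {c..s} (B_deriv n)"
    by (rule set_integrable_subset) (use assms in auto)
  have "AE x in lborel. \<not> (x \<in> {0..c} \<and> x \<in> {c..s})"
    using AE_lborel_singleton[of c] by (rule AE_mp) auto
  then have "(LINT r:{0..c} \<union> {c..s}|lborel. B_deriv n r) = B n c + (LINT r:{c..s}|lborel. B_deriv n r)"
    unfolding B_eq using assms by (intro set_integral_Un_AE B_deriv_integrable i2) auto
  moreover have "{0..c} \<union> {c..s} = {0..s}" using assms by auto
  ultimately show "B n s - B n c = (LINT r:{c..s}|lborel. B_deriv n r)"
    by (simp add: B_eq)
qed

lemma B_DERIV:
  assumes "0 < n" "n < 3" "0 < s"
  shows "(B n has_real_derivative B_deriv n s) (at s)"
proof -
  have ic: "isCont (B_deriv n) r" if "0 < r" for r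
    using B_deriv_continuous[OF assms(1,2)] that continuous_on_eq_continuous_at[of "{0::real<..}" "B_deriv n"] by auto
  obtain J where J: "\<And>r. 0 < r \<Longrightarrow> (J has_real_derivative B_deriv n r) (at r)"
    using einterval_antiderivative[of 0 "\<infinity>" "B_deriv n"] ic
    by (auto simp: has_real_derivative_iff_has_vector_derivative)
  \<comment> \<open>The base point s / 2 keeps the interval of integration inside r > 0, where the
    primitive J is available.\<close>
  have "B n r = J r + (B n (s/2) - J (s/2))" if "r > s / 2" for r
  proof -
    have "(LINT x:{s/2..r}|lborel. B_deriv n x) = J r - J (s/2)"
      using integral_FTC_Icc_real[of "s/2" r J "B_deriv n"] J ic assms that
      by (simp add: set_lebesgue_integral_def mult.commute)
    then show ?thesis using B_diff(2)[of n "s/2" r] assms that by simp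
  qed
  moreover have "((\<lambda>r. J r + (B n (s/2) - J (s/2))) has_real_derivative B_deriv n s) (at s)"
    using J[OF assms(3)] by (auto intro!: derivative_eq_intros)
  ultimately show ?thesis
    using has_field_derivative_transform_within_open[of "\<lambda>r. J r + (B n (s/2) - J (s/2))" _ s "{s/2<..}" "B n"] assms
    by auto
qed

lemma B_mono:
  assumes "0 < n" "n < 3" "0 \<le> c" "c \<le> s" shows "B n c \<le> B n s"
proof -
  have "0 \<le> (LINT r:{c..s}|lborel. B_deriv n r)"
    unfolding set_lebesgue_integral_def
    by (intro Bochner_Integration.integral_nonneg) (auto simp: indicator_def B_deriv_nonneg)
  then show ?thesis using B_diff(2)[OF assms] by simp
qed

lemma B_nonneg: "0 \<le> B n s"
  unfolding B_eq set_lebesgue_integral_def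
  by (intro Bochner_Integration.integral_nonneg) (auto simp: indicator_def B_deriv_nonneg)

lemma B_le_ln:
  assumes "0 < n" "n < 3" "1 \<le> s" shows "B n s \<le> B n 1 + ln s"
proof -
  have "\<exists>y. ((\<lambda>r. ln r - B n r) has_real_derivative y) (at x) \<and> 0 \<le> y" if "1 \<le> x" "x \<le> s" for x
  proof (intro exI[of _ "1 / x - B_deriv n x"] conjI)
    show "((\<lambda>r. ln r - B n r) has_real_derivative 1 / x - B_deriv n x) (at x)"
      using that assms by (auto intro!: derivative_eq_intros B_DERIV)
    show "0 \<le> 1 / x - B_deriv n x" using B_deriv_le(1)[of x n] that assms by simp
  qed
  from DERIV_nonneg_imp_nondecreasing[OF assms(3) this] show ?thesis by simp
qed

lemma B_eps_nonneg: "0 \<le> B_eps n \<epsilon> s"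
  by (simp add: B_eps_def B_nonneg)

text \<open>The leading constant 1 is what remains of ln (M / \<epsilon>) = ln M + |ln \<epsilon>|
  after the division by |ln \<epsilon>|.\<close>

lemma B_eps_le:
  assumes n: "0 < n" "n < 3" and e: "0 < \<epsilon>" "\<epsilon> \<le> 1/2" and u: "0 \<le> u" "u \<le> M" and M: "1 \<le> M"
  shows "B_eps n \<epsilon> u \<le> 1 + (B n 1 + ln M) / \<bar>ln \<epsilon>\<bar>"
proof -
  have l: "ln \<epsilon> < 0" using e by (simp add: ln_less_zero)
  have "B n (u / \<epsilon>) \<le> B n (M / \<epsilon>)" using assms by (intro B_mono) (auto intro: divide_right_mono)
  also have "\<dots> \<le> B n 1 + ln (M / \<epsilon>)" using assms by (intro B_le_ln) (auto simp: field_simps)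
  also have "\<dots> = B n 1 + ln M + \<bar>ln \<epsilon>\<bar>" using e M l by (simp add: ln_div)
  finally have "B_eps n \<epsilon> u \<le> (B n 1 + ln M + \<bar>ln \<epsilon>\<bar>) / \<bar>ln \<epsilon>\<bar>"
    unfolding B_eps_def by (intro divide_right_mono) auto
  also have "\<dots> = 1 + (B n 1 + ln M) / \<bar>ln \<epsilon>\<bar>" using l by (simp add: field_simps)
  finally show ?thesis .
qed

lemma B_eps_continuous:
  assumes "0 < n" "n < 3" "0 < \<epsilon>" shows "continuous_on {0..} (B_eps n \<epsilon>)"
proof -
  have "continuous_on {0..} (\<lambda>s. B n (s / \<epsilon>))"
    using assms by (intro continuous_on_compose2[OF B_continuous[of n]] continuous_intros) auto
  then have "continuous_on {0..} (\<lambda>s. B n (s / \<epsilon>) * (1 / \<bar>ln \<epsilon>\<bar>))"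
    by (intro continuous_intros)
  then show ?thesis unfolding B_eps_def[abs_def] by simp
qed

lemma deriv_B_eps:
  assumes "0 < n" "n < 3" "0 < \<epsilon>" "0 < s"
  shows "deriv (B_eps n \<epsilon>) s = B_deriv n (s / \<epsilon>) / (\<epsilon> * \<bar>ln \<epsilon>\<bar>)"
proof (rule DERIV_imp_deriv)
  have "((\<lambda>s. B n (s / \<epsilon>)) has_real_derivative B_deriv n (s / \<epsilon>) * (1 / \<epsilon>)) (at s)"
    using assms by (intro DERIV_chain2[OF B_DERIV]) (auto intro!: derivative_eq_intros)
  then have "((\<lambda>s. B n (s / \<epsilon>) / \<bar>ln \<epsilon>\<bar>) has_real_derivative B_deriv n (s / \<epsilon>) * (1 / \<epsilon>) / \<bar>ln \<epsilon>\<bar>) (at s)"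
    by (rule DERIV_cdivide)
  then show "(B_eps n \<epsilon> has_real_derivative B_deriv n (s / \<epsilon>) / (\<epsilon> * \<bar>ln \<epsilon>\<bar>)) (at s)"
    by (simp add: B_eps_def[abs_def])
qed

text \<open>In the variable s = u / \<epsilon> the mobility is u \<epsilon>^2 N and the flux is - I
  \<epsilon> N u u_xxx, where I = B'(s) and N = s^(n - 1) + s^2. So R^2 is I^2 N u times the
  dissipation density, and I^2 N u has to be bounded. The summand s^2 of N is handled by I s \<le> 1
  and costs M. So is s^(n - 1) if s \<ge> 1; for s < 1 the bound I \<le> (3 / n) s^(- n / 3) is
  used, and its square is the source of 9 / n^2.\<close>

lemma R_eps_square_le:
  assumes n: "0 < n" "n < 3" and e: "0 < \<epsilon>" "\<epsilon> \<le> 1/2" and u: "0 < u t x" "u t x \<le> M"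
  shows "(R_eps n \<epsilon> u uxxx t x)\<^sup>2 \<le> (2 * M + 9 / n\<^sup>2) * (mobility n \<epsilon> (u t x) * (uxxx t x)\<^sup>2)"
proof -
  define s where "s = u t x / \<epsilon>"
  define I where "I = B_deriv n s"
  define N where "N = s powr (n - 1) + s\<^sup>2"
  have s: "0 < s" "u t x = \<epsilon> * s" using u e by (auto simp: s_def)
  have l: "ln \<epsilon> < 0" using e by (simp add: ln_less_zero)
  have N0: "0 \<le> N" by (simp add: N_def)
  have eN: "\<epsilon> powr (3 - n) * u t x powr (n - 1) + (u t x)\<^sup>2 = \<epsilon>\<^sup>2 * N"
  proof -
    have "\<epsilon> powr (3 - n) * \<epsilon> powr (n - 1) = \<epsilon>\<^sup>2"
      using e by (simp add: powr_add[symmetric])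
    then show ?thesis using s e by (simp add: N_def powr_mult power_mult_distrib algebra_simps)
  qed
  have mob: "mobility n \<epsilon> (u t x) = u t x * (\<epsilon>\<^sup>2 * N)"
  proof -
    have "u t x powr n = u t x * u t x powr (n - 1)"
      using u powr_add[of "u t x" 1 "n - 1"] by simp
    then show ?thesis unfolding mobility_def eN[symmetric]
      by (simp add: power3_eq_cube power2_eq_square algebra_simps)
  qed
  have R: "R_eps n \<epsilon> u uxxx t x = - (I * \<epsilon> * N * u t x * uxxx t x)"
    unfolding R_eps_def eN using deriv_B_eps[OF n e(1) u(1)] l e
    by (simp add: I_def s_def power2_eq_square)
  have I: "0 \<le> I" "I * s \<le> 1" "I \<le> 3 / n * s powr (- n / 3)"
    using B_deriv_nonneg B_deriv_le[OF s(1) n] s by (auto simp: I_def field_simps)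
  have Is: "(I * s)\<^sup>2 \<le> 1" using I s by (simp add: power_le_one)
  have "I\<^sup>2 * s powr (n - 1) * u t x \<le> M + 9 / n\<^sup>2"
  proof (cases "1 \<le> s")
    case True
    have "s powr (n - 1) \<le> s powr 2" using n True by (intro powr_mono) auto
    then have "I\<^sup>2 * s powr (n - 1) \<le> I\<^sup>2 * s\<^sup>2" using s by (intro mult_left_mono) auto
    also have "\<dots> \<le> 1" using Is by (simp add: power_mult_distrib)
    finally have "I\<^sup>2 * s powr (n - 1) * u t x \<le> 1 * M" using u by (intro mult_mono) auto
    then show ?thesis using n by (simp add: add_increasing2)
  next
    case False
    have "I\<^sup>2 \<le> (3 / n * s powr (- n / 3))\<^sup>2" using I by (intro power_mono) auto
    also have "\<dots> = 9 / n\<^sup>2 * s powr (- 2 * n / 3)"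
    proof -
      have "(s powr (- n / 3))\<^sup>2 = s powr (- 2 * n / 3)"
        by (simp add: power2_eq_square powr_add[symmetric])
      then show ?thesis by (simp only: power_mult_distrib power_divide) simp
    qed
    finally have "I\<^sup>2 * (s powr (n - 1) * s) \<le> 9 / n\<^sup>2 * s powr (- 2 * n / 3) * (s powr (n - 1) * s)"
      using s by (intro mult_right_mono) auto
    also have "s powr (n - 1) * s = s powr n" using s powr_add[of s "n - 1" 1] by simp
    also have "9 / n\<^sup>2 * s powr (- 2 * n / 3) * s powr n = 9 / n\<^sup>2 * s powr (n / 3)"
      by (simp add: powr_add[symmetric] mult.assoc)
    also have "\<dots> \<le> 9 / n\<^sup>2 * 1"
      using False s n by (intro mult_left_mono powr_le1) auto
    finally have "I\<^sup>2 * s powr n \<le> 9 / n\<^sup>2" by simp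
    then have "\<epsilon> * (I\<^sup>2 * s powr n) \<le> 1 * (9 / n\<^sup>2)" using e by (intro mult_mono) auto
    moreover have "I\<^sup>2 * s powr (n - 1) * u t x = \<epsilon> * (I\<^sup>2 * s powr n)"
    proof -
      have "I\<^sup>2 * s powr (n - 1) * u t x = \<epsilon> * (I\<^sup>2 * (s powr (n - 1) * s))"
        by (simp only: s(2) ac_simps)
      then show ?thesis by (simp only: \<open>s powr (n - 1) * s = s powr n\<close>)
    qed
    ultimately show ?thesis using u by linarith
  qed
  moreover have "I\<^sup>2 * s\<^sup>2 * u t x \<le> 1 * M"
    using Is u by (intro mult_mono) (auto simp: power_mult_distrib)
  ultimately have c: "I\<^sup>2 * N * u t x \<le> 2 * M + 9 / n\<^sup>2"
    by (simp add: N_def algebra_simps)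
  have "(R_eps n \<epsilon> u uxxx t x)\<^sup>2 = (I\<^sup>2 * N * u t x) * (mobility n \<epsilon> (u t x) * (uxxx t x)\<^sup>2)"
    unfolding R mob by (simp add: power2_eq_square algebra_simps)
  also have "\<dots> \<le> (2 * M + 9 / n\<^sup>2) * (mobility n \<epsilon> (u t x) * (uxxx t x)\<^sup>2)"
    using c u N0 by (intro mult_right_mono) (auto simp: mob)
  finally show ?thesis .
qed

section \<open>Truncation near zero\<close>

text \<open>\<open>trunc \<delta> \<kappa>\<close> approximates \<open>y\<^sup>2 / (\<delta> + y)\<close> and vanishes for \<open>y \<le> \<kappa>\<close>. Composed with \<open>u\<close>, it is supported
  away from \<open>{u = 0}\<close>, where nothing is known about the higher derivatives of \<open>u\<close>.\<close>

definition trunc :: "real \<Rightarrow> real \<Rightarrow> real \<Rightarrow> real" where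
  "trunc \<delta> \<kappa> y = (max 0 (y - \<kappa>))^3 * (1 / (y * (\<delta> + y)))"

text \<open>The cube in \<open>trunc\<close> is the smallest integer power for which the first two
  derivatives, \<open>trunc1\<close> and \<open>trunc2\<close>, are continuous across y =
  \<kappa>.\<close>

definition trunc1 :: "real \<Rightarrow> real \<Rightarrow> real \<Rightarrow> real" where
  "trunc1 \<delta> \<kappa> y = 3 * (max 0 (y - \<kappa>))^2 * (1 / (y * (\<delta> + y)))
     + (max 0 (y - \<kappa>))^3 * (- (1 / (y^2 * (\<delta> + y)) + 1 / (y * (\<delta> + y)^2)))"

definition trunc2 :: "real \<Rightarrow> real \<Rightarrow> real \<Rightarrow> real" where
  "trunc2 \<delta> \<kappa> y = 6 * max 0 (y - \<kappa>) * (1 / (y * (\<delta> + y)))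
     + 6 * (max 0 (y - \<kappa>))^2 * (- (1 / (y^2 * (\<delta> + y)) + 1 / (y * (\<delta> + y)^2)))
     + (max 0 (y - \<kappa>))^3 * (2 / (y^3 * (\<delta> + y)) + 2 / (y^2 * (\<delta> + y)^2) + 2 / (y * (\<delta> + y)^3))"

lemma max_power_DERIV:
  "((\<lambda>y. (max 0 (y - \<kappa>)) ^ Suc (Suc m)) has_real_derivative real (Suc (Suc m)) * (max 0 (y - \<kappa>)) ^ Suc m) (at y)"
proof -
  consider "y > \<kappa>" | "y < \<kappa>" | "y = \<kappa>" by linarith
  then show ?thesis
  proof cases
    case 1
    have "((\<lambda>y. (y - \<kappa>) ^ Suc (Suc m)) has_real_derivative real (Suc (Suc m)) * (max 0 (y - \<kappa>)) ^ Suc m) (at y)"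
      using 1 by (auto intro!: derivative_eq_intros simp del: power_Suc)
    then show ?thesis
      by (rule has_field_derivative_transform_within_open[of _ _ _ "{\<kappa><..}"]) (use 1 in auto)
  next
    case 2
    have "((\<lambda>y. 0) has_real_derivative real (Suc (Suc m)) * (max 0 (y - \<kappa>)) ^ Suc m) (at y)"
      using 2 by auto
    then show ?thesis
      by (rule has_field_derivative_transform_within_open[of _ _ _ "{..<\<kappa>}"]) (use 2 in auto)
  next
    case 3
    have "((\<lambda>h::real. (max 0 h) ^ Suc (Suc m) / h) \<longlongrightarrow> 0) (at 0)"
    proof (rule Lim_null_comparison)
      show "\<forall>\<^sub>F h in at (0::real). norm ((max 0 h) ^ Suc (Suc m) / h) \<le> \<bar>h\<bar> ^ Suc m"
      proof (intro always_eventually allI)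
        fix h :: real
        show "norm ((max 0 h) ^ Suc (Suc m) / h) \<le> \<bar>h\<bar> ^ Suc m"
        proof (cases "h > 0")
          case False
          then have "max 0 h = 0" by auto
          then show ?thesis by (simp del: power_Suc add: power_0_Suc)
        qed auto
      qed
      show "((\<lambda>h::real. \<bar>h\<bar> ^ Suc m) \<longlongrightarrow> 0) (at 0)"
        by (auto intro!: tendsto_eq_intros)
    qed
    then show ?thesis using 3 by (simp add: DERIV_def)
  qed
qed

lemma trunc_DERIV:
  assumes "0 < y" "0 < \<delta>"
  shows "(trunc \<delta> \<kappa> has_real_derivative trunc1 \<delta> \<kappa> y) (at y)"
    and "(trunc1 \<delta> \<kappa> has_real_derivative trunc2 \<delta> \<kappa> y) (at y)"
proof -
  have nz: "y \<noteq> 0" "\<delta> + y \<noteq> 0" using assms by auto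
  have q3: "((\<lambda>y. (max 0 (y - \<kappa>))^3) has_real_derivative 3 * (max 0 (y - \<kappa>))^2) (at y)"
    using max_power_DERIV[of \<kappa> 1 y] by (simp add: eval_nat_numeral)
  have q2: "((\<lambda>y. (max 0 (y - \<kappa>))^2) has_real_derivative 2 * max 0 (y - \<kappa>)) (at y)"
    using max_power_DERIV[of \<kappa> 0 y] by (simp add: eval_nat_numeral)
  have h: "((\<lambda>y. 1 / (y * (\<delta> + y))) has_real_derivative - (1 / (y^2 * (\<delta> + y)) + 1 / (y * (\<delta> + y)^2))) (at y)"
    using nz by (auto intro!: derivative_eq_intros simp: divide_simps) (simp add: algebra_simps power2_eq_square)
  have h1: "((\<lambda>y. - (1 / (y^2 * (\<delta> + y)) + 1 / (y * (\<delta> + y)^2))) has_real_derivative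
      2 / (y^3 * (\<delta> + y)) + 2 / (y^2 * (\<delta> + y)^2) + 2 / (y * (\<delta> + y)^3)) (at y)"
    using nz by (auto intro!: derivative_eq_intros)
      (simp add: divide_simps, simp add: algebra_simps eval_nat_numeral)
  show "(trunc \<delta> \<kappa> has_real_derivative trunc1 \<delta> \<kappa> y) (at y)"
    unfolding trunc_def[abs_def] trunc1_def
    using DERIV_mult[OF q3 h] by (simp add: algebra_simps)
  show "(trunc1 \<delta> \<kappa> has_real_derivative trunc2 \<delta> \<kappa> y) (at y)"
    unfolding trunc1_def[abs_def] trunc2_def
    by (rule DERIV_cong[OF DERIV_add[OF DERIV_mult[OF DERIV_cmult[OF q2] h] DERIV_mult[OF q3 h1]]])
      (simp add: algebra_simps)
qed

lemma trunc_continuous_on: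
  assumes "0 < \<delta>"
  shows "continuous_on {0<..} (trunc1 \<delta> \<kappa>)" "continuous_on {0<..} (trunc2 \<delta> \<kappa>)"
  unfolding trunc1_def[abs_def] trunc2_def[abs_def] using assms
  by (auto intro!: continuous_intros)

lemma trunc_eq_0: "y \<le> \<kappa> \<Longrightarrow> trunc \<delta> \<kappa> y = 0 \<and> trunc1 \<delta> \<kappa> y = 0 \<and> trunc2 \<delta> \<kappa> y = 0"
  by (simp add: trunc_def trunc1_def trunc2_def)

text \<open>The bounds do not depend on \<kappa>, as dominated convergence for \<kappa> -> 0
  requires. The constants come from estimating each summand separately by means of max 0 (y -
  \<kappa>) \<le> y \<le> \<delta> + y; the factor 1 / \<delta> is harmless because \<delta> is
  fixed in that limit.\<close>

lemma trunc_bounds: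
  assumes y: "0 < y" and \<delta>: "0 < \<delta>" and \<kappa>: "0 < \<kappa>"
  shows "0 \<le> trunc \<delta> \<kappa> y" "trunc \<delta> \<kappa> y \<le> y" "\<bar>trunc1 \<delta> \<kappa> y\<bar> \<le> 5" "\<bar>trunc2 \<delta> \<kappa> y\<bar> \<le> 24 / \<delta>"
proof -
  define q where "q = max 0 (y - \<kappa>)"
  define A where "A = \<delta> + y"
  have q: "0 \<le> q" "q \<le> y" using y \<kappa> by (auto simp: q_def)
  have A: "0 < A" "y \<le> A" "\<delta> \<le> A" using y \<delta> by (auto simp: A_def)
  have q2: "q^2 \<le> y^2" and q3: "q^3 \<le> y^3" using q by (auto intro: power_mono)
  have yA: "y / A \<le> 1" "0 \<le> y / A" using A y by auto
  then have yA2: "(y / A)^2 \<le> 1" by (simp add: power_le_one)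
  show "0 \<le> trunc \<delta> \<kappa> y" using q y A by (simp add: trunc_def flip: q_def A_def)
  have "trunc \<delta> \<kappa> y \<le> y^3 * (1 / (y * A))"
    unfolding trunc_def q_def[symmetric] A_def[symmetric]
    using q3 y A by (intro mult_right_mono) auto
  also have "\<dots> = y * (y / A)" using y by (simp add: eval_nat_numeral)
  also have "\<dots> \<le> y * 1" using yA y by (intro mult_left_mono) auto
  also have "\<dots> = y" by simp
  finally show "trunc \<delta> \<kappa> y \<le> y" .
  have a: "\<bar>3 * q^2 * (1 / (y * A))\<bar> \<le> 3"
  proof -
    have "\<bar>3 * q^2 * (1 / (y * A))\<bar> = 3 * q^2 * (1 / (y * A))" using y A q by simp
    also have "\<dots> \<le> 3 * y^2 * (1 / (y * A))" using q2 y A by (intro mult_right_mono) auto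
    also have "\<dots> = 3 * (y / A)" using y by (simp add: eval_nat_numeral)
    also have "\<dots> \<le> 3" using yA by simp
    finally show ?thesis .
  qed
  have abs_neg: "\<bar>s * (- W)\<bar> = s * W" if "0 \<le> s" "0 \<le> W" for s W :: real
    using that by simp
  have b: "\<bar>q^3 * (- (1 / (y^2 * A) + 1 / (y * A^2)))\<bar> \<le> 2"
  proof -
    have "\<bar>q^3 * (- (1 / (y^2 * A) + 1 / (y * A^2)))\<bar> = q^3 * (1 / (y^2 * A) + 1 / (y * A^2))"
      using y A q by (intro abs_neg) auto
    also have "\<dots> \<le> y^3 * (1 / (y^2 * A) + 1 / (y * A^2))" using q3 y A by (intro mult_right_mono) auto
    also have "\<dots> = y / A + (y / A)^2" using y A by (simp add: divide_simps) (simp add: eval_nat_numeral algebra_simps)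
    also have "\<dots> \<le> 2" using yA yA2 by simp
    finally show ?thesis .
  qed
  show "\<bar>trunc1 \<delta> \<kappa> y\<bar> \<le> 5"
    unfolding trunc1_def q_def[symmetric] A_def[symmetric] using a b by linarith
  have c: "\<bar>6 * q * (1 / (y * A))\<bar> \<le> 6 / A"
  proof -
    have "\<bar>6 * q * (1 / (y * A))\<bar> = 6 * q * (1 / (y * A))" using y A q by simp
    also have "\<dots> \<le> 6 * y * (1 / (y * A))" using q y A by (intro mult_right_mono) auto
    also have "\<dots> = 6 / A" using y by simp
    finally show ?thesis .
  qed
  have d: "\<bar>6 * q^2 * (- (1 / (y^2 * A) + 1 / (y * A^2)))\<bar> \<le> 12 / A"
  proof -
    have "\<bar>6 * q^2 * (- (1 / (y^2 * A) + 1 / (y * A^2)))\<bar> = 6 * q^2 * (1 / (y^2 * A) + 1 / (y * A^2))"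
      using y A q by (intro abs_neg) auto
    also have "\<dots> \<le> 6 * y^2 * (1 / (y^2 * A) + 1 / (y * A^2))" using q2 y A by (intro mult_right_mono) auto
    also have "\<dots> = (6 + 6 * (y / A)) / A" using y A by (simp add: divide_simps) (simp add: eval_nat_numeral algebra_simps)
    also have "\<dots> \<le> 12 / A" using yA A by (intro divide_right_mono) linarith+
    finally show ?thesis .
  qed
  have e: "\<bar>q^3 * (2 / (y^3 * A) + 2 / (y^2 * A^2) + 2 / (y * A^3))\<bar> \<le> 6 / A"
  proof -
    have "\<bar>q^3 * (2 / (y^3 * A) + 2 / (y^2 * A^2) + 2 / (y * A^3))\<bar>
        = q^3 * (2 / (y^3 * A) + 2 / (y^2 * A^2) + 2 / (y * A^3))"
      using y A q by (simp add: abs_mult)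
    also have "\<dots> \<le> y^3 * (2 / (y^3 * A) + 2 / (y^2 * A^2) + 2 / (y * A^3))"
      using q3 y A by (intro mult_right_mono) auto
    also have "\<dots> = (2 + 2 * (y / A) + 2 * (y / A)^2) / A"
      using y A by (simp add: divide_simps) (simp add: eval_nat_numeral algebra_simps)
    also have "\<dots> \<le> 6 / A" using yA yA2 A by (intro divide_right_mono) linarith+
    finally show ?thesis .
  qed
  have "\<bar>trunc2 \<delta> \<kappa> y\<bar> \<le> 6 / A + 12 / A + 6 / A"
    unfolding trunc2_def q_def[symmetric] A_def[symmetric]
    by (rule order_trans[OF abs_triangle_ineq add_mono[OF order_trans[OF abs_triangle_ineq add_mono[OF c d]] e]])
  also have "\<dots> = 24 / A" by (simp add: field_simps)
  also have "\<dots> \<le> 24 / \<delta>" using A \<delta> by (intro divide_left_mono) auto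
  finally show "\<bar>trunc2 \<delta> \<kappa> y\<bar> \<le> 24 / \<delta>" .
qed

text \<open>From y^2 / (\<delta> + y) = y - \<delta> + \<delta>^2 / (\<delta> + y) one reads off
  that the limits are this function and its first two derivatives.\<close>

lemma trunc_tendsto:
  assumes y: "0 < y" and \<delta>: "0 < \<delta>" and \<kappa>: "\<kappa> \<longlonglongrightarrow> 0"
  shows "(\<lambda>j. trunc \<delta> (\<kappa> j) y) \<longlonglongrightarrow> y^2 / (\<delta> + y)"
    and "(\<lambda>j. trunc1 \<delta> (\<kappa> j) y) \<longlonglongrightarrow> 1 - \<delta>^2 / (\<delta> + y)^2"
    and "(\<lambda>j. trunc2 \<delta> (\<kappa> j) y) \<longlonglongrightarrow> 2 * \<delta>^2 / (\<delta> + y)^3"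
proof -
  have "(\<lambda>j. max 0 (y - \<kappa> j)) \<longlonglongrightarrow> max 0 (y - 0)"
    by (intro tendsto_intros \<kappa>)
  then have q: "(\<lambda>j. max 0 (y - \<kappa> j)) \<longlonglongrightarrow> y" using y by simp
  have nz: "y \<noteq> 0" "\<delta> + y \<noteq> 0" using y \<delta> by auto
  have "(\<lambda>j. trunc \<delta> (\<kappa> j) y) \<longlonglongrightarrow> y^3 * (1 / (y * (\<delta> + y)))"
    unfolding trunc_def by (intro tendsto_intros q)
  moreover have "y^3 * (1 / (y * (\<delta> + y))) = y^2 / (\<delta> + y)"
    using nz by (simp add: eval_nat_numeral)
  ultimately show "(\<lambda>j. trunc \<delta> (\<kappa> j) y) \<longlonglongrightarrow> y^2 / (\<delta> + y)" by simp
  have "(\<lambda>j. trunc1 \<delta> (\<kappa> j) y) \<longlonglongrightarrow> 3 * y^2 * (1 / (y * (\<delta> + y)))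
     + y^3 * (- (1 / (y^2 * (\<delta> + y)) + 1 / (y * (\<delta> + y)^2)))"
    unfolding trunc1_def by (intro tendsto_intros q)
  moreover have "3 * y^2 * (1 / (y * (\<delta> + y)))
     + y^3 * (- (1 / (y^2 * (\<delta> + y)) + 1 / (y * (\<delta> + y)^2))) = 1 - \<delta>^2 / (\<delta> + y)^2"
    using nz by (simp add: divide_simps) (simp add: eval_nat_numeral algebra_simps)
  ultimately show "(\<lambda>j. trunc1 \<delta> (\<kappa> j) y) \<longlonglongrightarrow> 1 - \<delta>^2 / (\<delta> + y)^2" by simp
  have "(\<lambda>j. trunc2 \<delta> (\<kappa> j) y) \<longlonglongrightarrow> 6 * y * (1 / (y * (\<delta> + y)))
     + 6 * y^2 * (- (1 / (y^2 * (\<delta> + y)) + 1 / (y * (\<delta> + y)^2)))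
     + y^3 * (2 / (y^3 * (\<delta> + y)) + 2 / (y^2 * (\<delta> + y)^2) + 2 / (y * (\<delta> + y)^3))"
    unfolding trunc2_def by (intro tendsto_intros q)
  moreover have "6 * y * (1 / (y * (\<delta> + y)))
     + 6 * y^2 * (- (1 / (y^2 * (\<delta> + y)) + 1 / (y * (\<delta> + y)^2)))
     + y^3 * (2 / (y^3 * (\<delta> + y)) + 2 / (y^2 * (\<delta> + y)^2) + 2 / (y * (\<delta> + y)^3)) = 2 * \<delta>^2 / (\<delta> + y)^3"
    using nz by (simp add: divide_simps) (simp add: eval_nat_numeral algebra_simps)
  ultimately show "(\<lambda>j. trunc2 \<delta> (\<kappa> j) y) \<longlonglongrightarrow> 2 * \<delta>^2 / (\<delta> + y)^3" by simp
qed

section \<open>The localised entropy production at a fixed time\<close>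

text \<open>One time slice, with v, w, z in the roles of u_x, u_xx, u_xxx. Only u is differentiable
  on all of \<Omega>; v and w are merely locally absolutely continuous, and only where u >
  0.\<close>

locale profile =
  fixes \<Omega> :: "real set" and u v w z :: "real \<Rightarrow> real"
  assumes open_\<Omega>: "open \<Omega>"
    and u_DERIV: "\<And>x. x \<in> \<Omega> \<Longrightarrow> (u has_real_derivative v x) (at x)"
    and v_cont: "continuous_on \<Omega> v"
    and u_nonneg: "\<And>x. x \<in> \<Omega> \<Longrightarrow> 0 \<le> u x"
    and v_ac: "ac_on {x\<in>\<Omega>. u x > 0} v w"
    and w_ac: "ac_on {x\<in>\<Omega>. u x > 0} w z"
    and z_loc: "loc_integrable {x\<in>\<Omega>. u x > 0} z"
begin

abbreviation "P \<equiv> {x\<in>\<Omega>. u x > 0}"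

lemma u_cont: "continuous_on \<Omega> u"
  using u_DERIV by (meson DERIV_isCont continuous_at_imp_continuous_on)

lemma open_P: "open P"
proof -
  have "open (u -` {0<..} \<inter> \<Omega>)"
    using continuous_on_open_vimage[OF open_\<Omega>] u_cont open_greaterThan by blast
  moreover have "u -` {0<..} \<inter> \<Omega> = P" by auto
  ultimately show ?thesis by simp
qed

text \<open>A zero of the non-negative u is an interior minimum.\<close>

lemma v_eq_0: "x \<in> \<Omega> \<Longrightarrow> x \<notin> P \<Longrightarrow> v x = 0"
proof -
  assume x: "x \<in> \<Omega>" "x \<notin> P"
  then have "u x = 0" using u_nonneg[of x] by auto
  obtain d where "d > 0" "ball x d \<subseteq> \<Omega>" using open_\<Omega> x open_contains_ball by blast
  then show "v x = 0"
    using DERIV_local_min[OF u_DERIV[OF x(1)], of d] u_nonneg \<open>u x = 0\<close>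
    by (auto simp: ball_def dist_real_def subset_eq)
qed

context
  fixes \<phi> :: "real \<Rightarrow> real" and \<delta> :: real
  assumes \<phi>: "test_fun \<Omega> \<phi>" and \<delta>: "0 < \<delta>"
begin

text \<open>With K the truncated multiplier, this is the derivative of K(u) v w \<phi> - K'(u) v^3
  \<phi> / 3 - K(u) v^2 \<phi>' / 2. The coefficients are chosen so that the mixed terms K' v^2 w
  \<phi> and K v w \<phi>' cancel; 5/6 arises as 1/3 + 1/2.\<close>

definition "trunc_integrand \<kappa> x =
  trunc \<delta> \<kappa> (u x) * (v x * z x * \<phi> x + (w x)\<^sup>2 * \<phi> x - 1/2 * (v x)\<^sup>2 * deriv (deriv \<phi>) x)
  - 1/3 * (trunc2 \<delta> \<kappa> (u x) * (v x)^4 * \<phi> x) - 5/6 * (trunc1 \<delta> \<kappa> (u x) * (v x)^3 * deriv \<phi> x)"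

text \<open>The integrand is the derivative of a function with compact support in {u > 0}, so no
  boundary term arises however irregular that set is.\<close>

lemma trunc_integral_zero:
  assumes \<kappa>: "0 < \<kappa>"
  shows "set_integrable lborel P (trunc_integrand \<kappa>)" "(LINT x:P|lborel. trunc_integrand \<kappa> x) = 0"
proof -
  have uP: "x \<in> P \<Longrightarrow> (u has_real_derivative v x) (at x)" for x using u_DERIV by auto
  have sub: "P \<subseteq> \<Omega>" by auto
  have K: "ac_on P (\<lambda>x. trunc \<delta> \<kappa> (u x)) (\<lambda>x. trunc1 \<delta> \<kappa> (u x) * v x)"
  proof (rule ac_on_C1[OF open_P])
    show "continuous_on P (\<lambda>x. trunc1 \<delta> \<kappa> (u x) * v x)"
      by (intro continuous_intros continuous_on_compose2[OF trunc_continuous_on(1)[OF \<delta>]]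
          continuous_on_subset[OF u_cont] continuous_on_subset[OF v_cont]) auto
  qed (use \<delta> in \<open>auto intro!: DERIV_chain2[OF trunc_DERIV(1)] uP\<close>)
  have K1: "ac_on P (\<lambda>x. trunc1 \<delta> \<kappa> (u x)) (\<lambda>x. trunc2 \<delta> \<kappa> (u x) * v x)"
  proof (rule ac_on_C1[OF open_P])
    show "continuous_on P (\<lambda>x. trunc2 \<delta> \<kappa> (u x) * v x)"
      by (intro continuous_intros continuous_on_compose2[OF trunc_continuous_on(2)[OF \<delta>]]
          continuous_on_subset[OF u_cont] continuous_on_subset[OF v_cont]) auto
  qed (use \<delta> in \<open>auto intro!: DERIV_chain2[OF trunc_DERIV(2)] uP\<close>)
  have f: "ac_on P \<phi> (deriv \<phi>)" "ac_on P (deriv \<phi>) (deriv (deriv \<phi>))"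
    using test_fun_smooth[OF \<phi>] by (auto intro!: ac_on_test open_P smooth_deriv)
  have v2: "ac_on P (\<lambda>x. v x * v x) (\<lambda>x. w x * v x + v x * w x)"
    by (rule ac_on_mult[OF v_ac v_ac])
  have v3: "ac_on P (\<lambda>x. (v x * v x) * v x) (\<lambda>x. (w x * v x + v x * w x) * v x + v x * v x * w x)"
    by (rule ac_on_mult[OF v2 v_ac])
  note p1 = ac_on_mult[OF K ac_on_mult[OF v_ac ac_on_mult[OF w_ac f(1)]]]
  note p2 = ac_on_cmult[OF ac_on_mult[OF K1 ac_on_mult[OF v3 f(1)]], of "- 1/3"]
  note p3 = ac_on_cmult[OF ac_on_mult[OF K ac_on_mult[OF v2 f(2)]], of "- 1/2"]
  note p = ac_on_add[OF p1 ac_on_add[OF p2 p3]]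
  \<comment> \<open>This is where the truncation pays off: the part of the support with u \<ge>
    \<kappa> is compact and, as \<kappa> > 0, lies inside {u > 0}.\<close>
  define S where "S = {x\<in>supp \<phi>. \<kappa> \<le> u x}"
  have "closed ({x\<in>supp \<phi>. u x \<in> {\<kappa>..}})"
    using continuous_on_closed_Collect_le[of "supp \<phi>" "\<lambda>_. \<kappa>" u]
      continuous_on_subset[OF u_cont test_fun_supp(2)[OF \<phi>]] compact_imp_closed[OF test_fun_supp(1)[OF \<phi>]]
    by auto
  moreover have "S = supp \<phi> \<inter> {x\<in>supp \<phi>. u x \<in> {\<kappa>..}}" by (auto simp: S_def)
  ultimately have S: "compact S"
    using compact_Int_closed[OF test_fun_supp(1)[OF \<phi>]] by simp
  have S': "S \<subseteq> P"
    using test_fun_supp(2)[OF \<phi>] \<kappa> by (auto simp: S_def)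
  have z0: "x \<in> P \<Longrightarrow> x \<notin> S \<Longrightarrow> (trunc \<delta> \<kappa> (u x) = 0 \<and> trunc1 \<delta> \<kappa> (u x) = 0 \<and> trunc2 \<delta> \<kappa> (u x) = 0)
      \<or> (\<phi> x = 0 \<and> deriv \<phi> x = 0 \<and> deriv (deriv \<phi>) x = 0)" for x
  proof (cases "x \<in> supp \<phi>")
    case True
    assume "x \<notin> S"
    then have "u x \<le> \<kappa>" using True by (auto simp: S_def)
    then show ?thesis using trunc_eq_0 by blast
  next
    case False
    have "supp (deriv \<phi>) \<subseteq> supp \<phi>"
      by (rule supp_subset_closed) (auto simp: deriv_eq_0_outside_supp supp_def)
    then have "x \<notin> supp (deriv \<phi>)" using False by blast
    then show ?thesis using False by (simp add: not_in_supp deriv_eq_0_outside_supp)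
  qed
  note q = ac_on_compact_support[OF open_P p S S']
  have e: "trunc1 \<delta> \<kappa> (u x) * v x * (v x * (w x * \<phi> x)) +
      trunc \<delta> \<kappa> (u x) * (w x * (w x * \<phi> x) + v x * (z x * \<phi> x + w x * deriv \<phi> x)) +
      (- 1 / 3 * (trunc2 \<delta> \<kappa> (u x) * v x * (v x * v x * v x * \<phi> x) +
        trunc1 \<delta> \<kappa> (u x) * (((w x * v x + v x * w x) * v x + v x * v x * w x) * \<phi> x + v x * v x * v x * deriv \<phi> x)) +
       - 1 / 2 * (trunc1 \<delta> \<kappa> (u x) * v x * (v x * v x * deriv \<phi> x) +
        trunc \<delta> \<kappa> (u x) * ((w x * v x + v x * w x) * deriv \<phi> x + v x * v x * deriv (deriv \<phi>) x)))
      = trunc_integrand \<kappa> x" for x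
    unfolding trunc_integrand_def by (simp add: power2_eq_square eval_nat_numeral algebra_simps)
  have q0: "trunc \<delta> \<kappa> (u x) * (v x * (w x * \<phi> x)) +
      (- 1 / 3 * (trunc1 \<delta> \<kappa> (u x) * (v x * v x * v x * \<phi> x)) +
       - 1 / 2 * (trunc \<delta> \<kappa> (u x) * (v x * v x * deriv \<phi> x))) = 0 \<and> trunc_integrand \<kappa> x = 0"
    if "x \<in> P" "x \<notin> S" for x
    using z0[OF that] by (auto simp: trunc_integrand_def)
  show "set_integrable lborel P (trunc_integrand \<kappa>)" "(LINT x:P|lborel. trunc_integrand \<kappa> x) = 0"
    using q[unfolded e, OF q0] by blast+
qed

definition "limit_integrand x =
  (u x)\<^sup>2 / (\<delta> + u x) * (v x * z x * \<phi> x + (w x)\<^sup>2 * \<phi> x - 1/2 * (v x)\<^sup>2 * deriv (deriv \<phi>) x)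
  - 1/3 * (2 * \<delta>\<^sup>2 / (\<delta> + u x)^3 * (v x)^4 * \<phi> x)
  - 5/6 * ((1 - \<delta>\<^sup>2 / (\<delta> + u x)\<^sup>2) * (v x)^3 * deriv \<phi> x)"

lemma cont_test_integrable:
  assumes "continuous_on \<Omega> f" "test_fun \<Omega> \<psi>"
  shows "set_integrable lborel P (\<lambda>x. f x * \<psi> x)"
proof -
  have "set_integrable lborel \<Omega> (\<lambda>x. f x * \<psi> x)"
    by (intro loc_integrable_mult_test loc_integrable_continuous assms)
  then show ?thesis
    by (rule set_integrable_subset) (use open_P in auto)
qed

text \<open>The two hypotheses dominate the terms containing w and z, which may blow up at the
  boundary of {u > 0}. The other terms are products of functions continuous on \<Omega> with test
  functions.\<close>

lemma limit_integral_zero: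
  assumes i1: "set_integrable lborel P (\<lambda>x. u x * (w x)\<^sup>2 * \<phi> x)"
    and i2: "set_integrable lborel P (\<lambda>x. u x * v x * z x * \<phi> x)"
  shows "set_integrable lborel P limit_integrand" "(LINT x:P|lborel. limit_integrand x) = 0"
proof -
  define \<kappa> where "\<kappa> j = 1 / real (Suc j)" for j
  have \<kappa>: "\<kappa> \<longlonglongrightarrow> 0" unfolding \<kappa>_def by (rule LIMSEQ_Suc[OF lim_1_over_n])
  have \<kappa>0: "0 < \<kappa> j" for j by (simp add: \<kappa>_def)
  \<comment> \<open>The majorant uses trunc \<le> u. The coefficient 8 / \<delta> is one third of
    the bound 24 / \<delta> for \<open>trunc2\<close>, and 5 is the bound for \<open>trunc1\<close>,
    which is even multiplied by 5/6.\<close>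
  define G where "G x = \<bar>u x * v x * z x * \<phi> x\<bar> + \<bar>u x * (w x)\<^sup>2 * \<phi> x\<bar>
      + \<bar>1/2 * (u x * (v x)\<^sup>2) * deriv (deriv \<phi>) x\<bar> + \<bar>8 / \<delta> * (v x)^4 * \<phi> x\<bar> + \<bar>5 * (v x)^3 * deriv \<phi> x\<bar>" for x
  note \<phi>' = test_fun_deriv[OF \<phi>]
  note \<phi>'' = test_fun_deriv[OF \<phi>']
  have j1: "set_integrable lborel P (\<lambda>x. 1/2 * (u x * (v x)\<^sup>2) * deriv (deriv \<phi>) x)"
    "set_integrable lborel P (\<lambda>x. 8 / \<delta> * (v x)^4 * \<phi> x)"
    "set_integrable lborel P (\<lambda>x. 5 * (v x)^3 * deriv \<phi> x)"
    by (intro cont_test_integrable \<phi> \<phi>' \<phi>'' continuous_intros u_cont v_cont)+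
  have G: "set_integrable lborel P G"
    unfolding G_def using i1 i2 j1 by (intro set_integral_add set_integrable_abs)
  have dom: "\<bar>trunc_integrand (\<kappa> j) x\<bar> \<le> G x" if "x \<in> P" for j x
  proof -
    have ux: "0 < u x" using that by auto
    note b = trunc_bounds[OF ux \<delta> \<kappa>0[of j]]
    define A where "A = trunc \<delta> (\<kappa> j) (u x)"
    have A: "0 \<le> A" "A \<le> u x" using b by (auto simp: A_def)
    have "\<bar>A * (v x * z x * \<phi> x + (w x)\<^sup>2 * \<phi> x - 1/2 * (v x)\<^sup>2 * deriv (deriv \<phi>) x)\<bar>
        \<le> u x * (\<bar>v x * z x * \<phi> x\<bar> + \<bar>(w x)\<^sup>2 * \<phi> x\<bar> + \<bar>1/2 * (v x)\<^sup>2 * deriv (deriv \<phi>) x\<bar>)"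
      unfolding abs_mult[of A] using A by (intro mult_mono) auto
    also have "\<dots> = \<bar>u x * v x * z x * \<phi> x\<bar> + \<bar>u x * (w x)\<^sup>2 * \<phi> x\<bar> + \<bar>1/2 * (u x * (v x)\<^sup>2) * deriv (deriv \<phi>) x\<bar>"
      using ux by (simp add: abs_mult algebra_simps)
    finally have 1: "\<bar>A * (v x * z x * \<phi> x + (w x)\<^sup>2 * \<phi> x - 1/2 * (v x)\<^sup>2 * deriv (deriv \<phi>) x)\<bar> \<le> \<dots>" .
    have "\<bar>trunc2 \<delta> (\<kappa> j) (u x)\<bar> * \<bar>(v x)^4 * \<phi> x\<bar> \<le> 24 / \<delta> * \<bar>(v x)^4 * \<phi> x\<bar>"
      using b(4) by (intro mult_right_mono) auto
    then have 2: "\<bar>1/3 * (trunc2 \<delta> (\<kappa> j) (u x) * (v x)^4 * \<phi> x)\<bar> \<le> \<bar>8 / \<delta> * (v x)^4 * \<phi> x\<bar>"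
      using \<delta> by (simp add: abs_mult mult.assoc)
    have "\<bar>trunc1 \<delta> (\<kappa> j) (u x)\<bar> * \<bar>(v x)^3 * deriv \<phi> x\<bar> \<le> 5 * \<bar>(v x)^3 * deriv \<phi> x\<bar>"
      using b(3) by (intro mult_right_mono) auto
    moreover have "\<bar>5/6 * (trunc1 \<delta> (\<kappa> j) (u x) * (v x)^3 * deriv \<phi> x)\<bar>
        = 5/6 * (\<bar>trunc1 \<delta> (\<kappa> j) (u x)\<bar> * \<bar>(v x)^3 * deriv \<phi> x\<bar>)"
      by (simp add: abs_mult)
    moreover have "\<bar>5 * (v x)^3 * deriv \<phi> x\<bar> = 5 * \<bar>(v x)^3 * deriv \<phi> x\<bar>" by (simp add: abs_mult)
    ultimately have 3: "\<bar>5/6 * (trunc1 \<delta> (\<kappa> j) (u x) * (v x)^3 * deriv \<phi> x)\<bar> \<le> \<bar>5 * (v x)^3 * deriv \<phi> x\<bar>"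
      using abs_ge_zero[of "(v x)^3 * deriv \<phi> x"] by linarith
    show ?thesis unfolding trunc_integrand_def A_def[symmetric] G_def using 1 2 3 by linarith
  qed
  have lim: "(\<lambda>j. trunc_integrand (\<kappa> j) x) \<longlonglongrightarrow> limit_integrand x" if "x \<in> P" for x
    unfolding trunc_integrand_def limit_integrand_def
    using trunc_tendsto[OF _ \<delta> \<kappa>, of "u x"] that by (intro tendsto_intros) auto
  have lim': "(\<lambda>j. indicator P x *\<^sub>R trunc_integrand (\<kappa> j) x) \<longlonglongrightarrow> indicator P x *\<^sub>R limit_integrand x" for x
    using lim[of x] by (cases "x \<in> P") auto
  have m: "(\<lambda>x. indicator P x *\<^sub>R trunc_integrand (\<kappa> j) x) \<in> borel_measurable lborel" for j
    using trunc_integral_zero(1)[OF \<kappa>0, of j] by (auto simp: set_integrable_def)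
  have m': "(\<lambda>x. indicator P x *\<^sub>R limit_integrand x) \<in> borel_measurable lborel"
    by (rule borel_measurable_LIMSEQ_real[OF _ m]) (rule lim')
  have dom': "AE x in lborel. norm (indicator P x *\<^sub>R trunc_integrand (\<kappa> j) x) \<le> indicator P x *\<^sub>R G x" for j
    by (rule AE_I2) (use dom[of _ j] in \<open>auto simp: indicator_def\<close>)
  note dc = m' m G[unfolded set_integrable_def] AE_I2[OF lim'] dom'
  show "set_integrable lborel P limit_integrand"
    unfolding set_integrable_def by (rule integrable_dominated_convergence[OF dc])
  have "(\<lambda>j. LINT x:P|lborel. trunc_integrand (\<kappa> j) x) \<longlonglongrightarrow> (LINT x:P|lborel. limit_integrand x)"
    unfolding set_lebesgue_integral_def by (rule integral_dominated_convergence[OF dc])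
  then show "(LINT x:P|lborel. limit_integrand x) = 0"
    using trunc_integral_zero(2)[OF \<kappa>0] by (simp add: LIMSEQ_const_iff)
qed

end

text \<open>Young's inequality absorbs the cubic term into the quartic one, which has a good sign because
  \<open>y - y\<^sup>2 / (\<delta> + y)\<close> is concave. This is the reason for taking fourth powers as test functions.\<close>

lemma young_cubic_quartic:
  fixes X Y A :: real
  assumes "0 \<le> X" "0 \<le> Y" "0 < A"
  shows "10/3 * X^3 * Y / A^2 \<le> 2/3 * X^4 / A^3 + 417 * Y^4 * A"
proof -
  define Z where "Z = Y * A"
  have Z: "0 \<le> Z" using assms by (simp add: Z_def)
  have "10/3 * X^3 * Z \<le> 2/3 * X^4 + 417 * Z^4"
  \<comment> \<open>The threshold 5 makes 10/3 X^3 Z at most 2/3 X^4 in the first case. In the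
    second, X < 5 Z leaves 10/3 * 125 Z^4, and 1250/3 < 417.\<close>
  proof (cases "5 * Z \<le> X")
    case True
    then have "X^3 * (5 * Z) \<le> X^3 * X" using assms by (intro mult_left_mono) auto
    then have "10/3 * X^3 * Z \<le> 2/3 * X^4" by (simp add: eval_nat_numeral)
    then show ?thesis by (smt (verit) zero_le_power[OF Z, of 4])
  next
    case False
    then have "X^3 \<le> (5 * Z)^3" using assms by (intro power_mono) auto
    then have "X^3 * Z \<le> (5 * Z)^3 * Z" using Z by (intro mult_right_mono) auto
    then have "10/3 * X^3 * Z \<le> 417 * Z^4" using zero_le_power[OF Z, of 4] by (simp add: eval_nat_numeral)
    then show ?thesis using zero_le_power[OF assms(1), of 4] by linarith
  qed
  then have "(10/3 * X^3 * Z) / A^3 \<le> (2/3 * X^4 + 417 * Z^4) / A^3"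
    using assms by (intro divide_right_mono) auto
  moreover have "(10/3 * X^3 * Z) / A^3 = 10/3 * X^3 * Y / A^2"
    using assms by (simp add: Z_def eval_nat_numeral)
  moreover have "(2/3 * X^4 + 417 * Z^4) / A^3 = 2/3 * X^4 / A^3 + 417 * Y^4 * A"
    using assms by (simp add: Z_def eval_nat_numeral add_divide_distrib)
  ultimately show ?thesis by simp
qed

text \<open>The inequality between arithmetic and geometric means, weighted by \<delta>, leaves y^4
  q^2 / (\<delta> + y)^2; then 4 \<delta> y \<le> (\<delta> + y)^2 trades one power of y for 1 /
  \<delta>. The aim is y^3 because the dissipation controls u^3 u_xxx^2.\<close>

lemma weighted_product_le:
  fixes y p q \<delta> :: real
  assumes y: "0 < y" and \<delta>: "0 < \<delta>"
  shows "y\<^sup>2 / (\<delta> + y) * \<bar>p * q\<bar> \<le> \<delta> / 2 * p\<^sup>2 + y^3 * q\<^sup>2 / (8 * \<delta>\<^sup>2)"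
proof -
  define A where "A = \<delta> + y"
  define Q where "Q = y\<^sup>2 / A * \<bar>q\<bar>"
  have A: "0 < A" using y \<delta> by (simp add: A_def)
  have "0 \<le> (\<delta> * \<bar>p\<bar> - Q)\<^sup>2" by simp
  then have "2 * \<delta> * (\<bar>p\<bar> * Q) \<le> \<delta>\<^sup>2 * p\<^sup>2 + Q\<^sup>2"
    by (simp add: power2_diff power_mult_distrib algebra_simps)
  then have "\<bar>p\<bar> * Q \<le> (\<delta>\<^sup>2 * p\<^sup>2 + Q\<^sup>2) / (2 * \<delta>)" using \<delta> by (simp add: field_simps)
  also have "\<dots> = \<delta> / 2 * p\<^sup>2 + Q\<^sup>2 / (2 * \<delta>)" using \<delta> by (simp add: add_divide_distrib power2_eq_square)
  also have "Q\<^sup>2 \<le> y^3 * q\<^sup>2 / (4 * \<delta>)"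
  proof -
    have "4 * \<delta> * y \<le> A\<^sup>2" using zero_le_power2[of "\<delta> - y"] by (simp add: A_def power2_diff power2_sum)
    then have "y / A\<^sup>2 \<le> 1 / (4 * \<delta>)" using A \<delta> by (simp add: field_simps)
    then have "y^3 * q\<^sup>2 * (y / A\<^sup>2) \<le> y^3 * q\<^sup>2 * (1 / (4 * \<delta>))"
      using y by (intro mult_left_mono) auto
    moreover have "Q\<^sup>2 = y^3 * q\<^sup>2 * (y / A\<^sup>2)"
      by (simp add: Q_def power_mult_distrib power_divide eval_nat_numeral)
    ultimately show ?thesis by simp
  qed
  then have "\<delta> / 2 * p\<^sup>2 + Q\<^sup>2 / (2 * \<delta>) \<le> \<delta> / 2 * p\<^sup>2 + (y^3 * q\<^sup>2 / (4 * \<delta>)) / (2 * \<delta>)"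
    using \<delta> by (intro add_left_mono divide_right_mono) auto
  also have "(y^3 * q\<^sup>2 / (4 * \<delta>)) / (2 * \<delta>) = y^3 * q\<^sup>2 / (8 * \<delta>\<^sup>2)"
    by (simp add: power2_eq_square)
  finally show ?thesis by (simp add: Q_def A_def abs_mult mult_ac)
qed

lemma production_lower_bound:
  assumes \<chi>: "test_fun \<Omega> h" "\<And>x. 0 \<le> h x" and \<delta>: "0 < \<delta>" "\<delta> \<le> 1"
    and bnd: "\<Omega> = {a<..<b}" "a < b" "\<And>x. x \<in> \<Omega> \<Longrightarrow> u x \<le> M"
    and c0: "\<And>x. (h x)^4 \<le> c0" and c1: "\<And>x. \<bar>deriv h x\<bar> \<le> c1"
    and c2: "\<And>x. \<bar>deriv (deriv (\<lambda>x. (h x)^4)) x\<bar> \<le> c2"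
    and i1: "set_integrable lborel P (\<lambda>x. u x * (w x)\<^sup>2)"
    and i2: "set_integrable lborel P (\<lambda>x. u x * v x * z x * (h x)^4)"
    and i3: "set_integrable lborel P (\<lambda>x. (u x)^3 * (z x)\<^sup>2)"
    and i4: "set_integrable lborel \<Omega> (\<lambda>x. (v x)\<^sup>2)"
  shows "- (417 * c1^4 * \<delta>\<^sup>2 * (\<delta> + M) * (b - a) + \<delta> * (c0 + c2) * (LINT x:\<Omega>|lborel. (v x)\<^sup>2)
        + c0 / (8 * \<delta>\<^sup>2) * (LINT x:P|lborel. (u x)^3 * (z x)\<^sup>2))
     \<le> (LINT x:\<Omega>|lborel. u x * (w x)\<^sup>2 * (h x)^4)
       - 5/6 * (LINT x:\<Omega>|lborel. (v x)^3 * deriv (\<lambda>x. (h x)^4) x)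
       - 1/2 * (LINT x:\<Omega>|lborel. u x * (v x)\<^sup>2 * deriv (deriv (\<lambda>x. (h x)^4)) x)"
proof -
  define \<phi> where "\<phi> x = (h x)^4" for x
  have \<phi>: "test_fun \<Omega> \<phi>"
    unfolding \<phi>_def using test_fun_power[OF \<chi>(1), of 4] by simp
  note \<phi>' = test_fun_deriv[OF \<phi>]
  note \<phi>'' = test_fun_deriv[OF \<phi>']
  have d\<phi>: "deriv \<phi> x = 4 * (h x)^3 * deriv h x" for x
    unfolding \<phi>_def[abs_def]
    by (rule DERIV_imp_deriv) (auto intro!: derivative_eq_intros smooth_DERIV[OF test_fun_smooth[OF \<chi>(1)]])
  have \<phi>0: "0 \<le> \<phi> x" "\<phi> x \<le> c0" for x using c0 \<chi> by (auto simp: \<phi>_def)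
  have c0': "0 \<le> c0" using \<phi>0[of 0] by linarith
  have c1': "0 \<le> c1" using c1[of 0] by linarith
  have c2': "0 \<le> c2" using c2[of 0] by linarith
  have "(a + b) / 2 \<in> \<Omega>" using bnd(1,2) by auto
  then have M: "0 \<le> M" using bnd(3) u_nonneg by fastforce
  obtain C where C: "\<And>x. \<bar>\<phi> x\<bar> \<le> C" using test_fun_bounded[OF \<phi>] by blast
  have i1': "set_integrable lborel P (\<lambda>x. u x * (w x)\<^sup>2 * \<phi> x)"
  proof -
    have "integrable lborel (\<lambda>x. (indicator P x *\<^sub>R (u x * (w x)\<^sup>2)) * \<phi> x)"
      using i1 test_fun_borel[OF \<phi>] C by (intro integrable_mult_bounded) (auto simp: set_integrable_def)
    then show ?thesis by (simp add: set_integrable_def mult.assoc)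
  qed
  have i2': "set_integrable lborel P (\<lambda>x. u x * v x * z x * \<phi> x)" using i2 by (simp add: \<phi>_def)
  note L = limit_integral_zero[OF \<phi> \<delta>(1) i1' i2']
  have j: "set_integrable lborel P (\<lambda>x. (v x)^3 * deriv \<phi> x)"
    "set_integrable lborel P (\<lambda>x. u x * (v x)\<^sup>2 * deriv (deriv \<phi>) x)"
    by (intro cont_test_integrable[OF \<phi> \<delta>(1)] \<phi>' \<phi>'' continuous_intros u_cont v_cont)+
  have z: "x \<in> \<Omega> \<Longrightarrow> x \<notin> P \<Longrightarrow> u x = 0 \<and> v x = 0" for x
    using v_eq_0[of x] u_nonneg[of x] by auto
  have toP: "(LINT x:\<Omega>|lborel. f x) = (LINT x:P|lborel. f x)" if "\<And>x. x \<in> \<Omega> \<Longrightarrow> x \<notin> P \<Longrightarrow> f x = 0" for f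
    unfolding set_lebesgue_integral_def using that
    by (intro Bochner_Integration.integral_cong) (auto simp: indicator_def)
  define N where "N x = u x * (w x)\<^sup>2 * \<phi> x - 5/6 * ((v x)^3 * deriv \<phi> x)
     - 1/2 * (u x * (v x)\<^sup>2 * deriv (deriv \<phi>) x)" for x
  have N: "set_integrable lborel P N"
    unfolding N_def using i1' j by (intro set_integral_diff set_integrable_mult_right) auto
  have rhs: "(LINT x:\<Omega>|lborel. u x * (w x)\<^sup>2 * \<phi> x) - 5/6 * (LINT x:\<Omega>|lborel. (v x)^3 * deriv \<phi> x)
       - 1/2 * (LINT x:\<Omega>|lborel. u x * (v x)\<^sup>2 * deriv (deriv \<phi>) x) = (LINT x:P|lborel. N x)"
  proof -
    have "(LINT x:P|lborel. N x) = (LINT x:P|lborel. u x * (w x)\<^sup>2 * \<phi> x) - 5/6 * (LINT x:P|lborel. (v x)^3 * deriv \<phi> x)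
       - 1/2 * (LINT x:P|lborel. u x * (v x)\<^sup>2 * deriv (deriv \<phi>) x)"
      unfolding N_def using i1' j by (simp add: set_integral_diff)
    moreover have "(LINT x:\<Omega>|lborel. u x * (w x)\<^sup>2 * \<phi> x) = (LINT x:P|lborel. u x * (w x)\<^sup>2 * \<phi> x)"
      "(LINT x:\<Omega>|lborel. (v x)^3 * deriv \<phi> x) = (LINT x:P|lborel. (v x)^3 * deriv \<phi> x)"
      "(LINT x:\<Omega>|lborel. u x * (v x)\<^sup>2 * deriv (deriv \<phi>) x) = (LINT x:P|lborel. u x * (v x)\<^sup>2 * deriv (deriv \<phi>) x)"
      by (rule toP, use z in simp)+
    ultimately show ?thesis by simp
  qed
  define E where "E x = 417 * c1^4 * \<delta>\<^sup>2 * (\<delta> + M) + \<delta> * (c0 + c2) * (v x)\<^sup>2 + c0 / (8 * \<delta>\<^sup>2) * ((u x)^3 * (z x)\<^sup>2)" for x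
  have pointwise: "- E x \<le> N x - limit_integrand \<phi> \<delta> x" if x: "x \<in> P" for x
  proof -
    have ux: "0 < u x" "u x \<le> M" using x bnd(3)[of x] by auto
    define A where "A = \<delta> + u x"
    have A: "0 < A" "A \<le> \<delta> + M" using ux \<delta> by (auto simp: A_def)
    have F: "u x - (u x)\<^sup>2 / A = \<delta> * u x / A" using A by (simp add: A_def field_simps power2_eq_square)
    have F\<delta>: "\<delta> * u x / A \<le> \<delta>" using A ux \<delta> by (simp add: A_def field_simps)
    have F0: "0 \<le> \<delta> * u x / A" using A ux \<delta> by simp
    \<comment> \<open>Subtracting the integrand of vanishing integral replaces the multiplier u by
      F(u) = \<delta> u / (\<delta> + u). As F' = \<delta>^2 / (\<delta> + u)^2 and F'' = - 2
      \<delta>^2 / (\<delta> + u)^3, the terms with v^3 and v^4 keep a factor \<delta>^2.\<close>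
    have eq: "N x - limit_integrand \<phi> \<delta> x
      = (u x - (u x)\<^sup>2 / A) * (w x)\<^sup>2 * \<phi> x
        - 1/2 * ((u x - (u x)\<^sup>2 / A) * (v x)\<^sup>2 * deriv (deriv \<phi>) x)
        - (u x)\<^sup>2 / A * (v x * z x * \<phi> x)
        + \<delta>\<^sup>2 * (2/3 * ((v x)^4 * \<phi> x) / A^3 - 5/6 * ((v x)^3 * deriv \<phi> x) / A\<^sup>2)"
      unfolding N_def limit_integrand_def[OF \<phi> \<delta>(1)] A_def[symmetric] by (simp add: algebra_simps)
    have t1: "0 \<le> (u x - (u x)\<^sup>2 / A) * (w x)\<^sup>2 * \<phi> x" unfolding F using F0 \<phi>0 by (intro mult_nonneg_nonneg) auto
    have t2: "1/2 * ((u x - (u x)\<^sup>2 / A) * (v x)\<^sup>2 * deriv (deriv \<phi>) x) \<le> \<delta> / 2 * (v x)\<^sup>2 * c2"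
    proof -
      have "(\<delta> * u x / A) * ((v x)\<^sup>2 * deriv (deriv \<phi>) x) \<le> \<bar>\<delta> * u x / A\<bar> * \<bar>(v x)\<^sup>2 * deriv (deriv \<phi>) x\<bar>"
        unfolding abs_mult[symmetric] by (rule abs_ge_self)
      also have "\<dots> \<le> \<delta> * ((v x)\<^sup>2 * c2)"
        using F0 F\<delta> c2[of x] \<delta> by (intro mult_mono) (auto simp: abs_mult \<phi>_def[abs_def] intro!: mult_left_mono)
      finally show ?thesis unfolding F by (simp add: mult_ac)
    qed
    have t3: "(u x)\<^sup>2 / A * (v x * z x * \<phi> x) \<le> c0 * (\<delta> / 2 * (v x)\<^sup>2 + (u x)^3 * (z x)\<^sup>2 / (8 * \<delta>\<^sup>2))"
    proof -
      have "(u x)\<^sup>2 / A * (v x * z x * \<phi> x) \<le> (u x)\<^sup>2 / A * \<bar>v x * z x\<bar> * \<phi> x"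
        using A \<phi>0[of x] mult_right_mono[OF abs_ge_self[of "v x * z x"] \<phi>0(1)[of x]]
        by (simp add: mult.assoc mult_left_mono divide_right_mono)
      also have "\<dots> \<le> (\<delta> / 2 * (v x)\<^sup>2 + (u x)^3 * (z x)\<^sup>2 / (8 * \<delta>\<^sup>2)) * c0"
        using weighted_product_le[OF ux(1) \<delta>(1), of "v x" "z x"] \<phi>0 A ux \<delta>
        by (intro mult_mono) (auto simp: A_def)
      finally show ?thesis by (simp add: mult.commute)
    qed
    have t4: "- (417 * c1^4 * (\<delta> + M)) \<le> 2/3 * ((v x)^4 * \<phi> x) / A^3 - 5/6 * ((v x)^3 * deriv \<phi> x) / A\<^sup>2"
    proof -
      \<comment> \<open>Since \<phi>' = 4 h^3 h', the cubic term is 10/3 X^3 |h'| up to its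
        denominator, and the quartic one is 2/3 X^4: both are powers of the same quantity.\<close>
      define X where "X = \<bar>v x\<bar> * h x"
      have X: "0 \<le> X" using \<chi> by (simp add: X_def)
      have "5/6 * ((v x)^3 * deriv \<phi> x) \<le> \<bar>5/6 * ((v x)^3 * deriv \<phi> x)\<bar>" by (rule abs_ge_self)
      also have "\<dots> = 10/3 * X^3 * \<bar>deriv h x\<bar>"
        using \<chi>(2)[of x] by (simp add: d\<phi> X_def abs_mult power_mult_distrib power_abs)
      finally have "5/6 * ((v x)^3 * deriv \<phi> x) / A\<^sup>2 \<le> 10/3 * X^3 * \<bar>deriv h x\<bar> / A\<^sup>2"
        by (intro divide_right_mono) auto
      also have "\<dots> \<le> 2/3 * X^4 / A^3 + 417 * \<bar>deriv h x\<bar>^4 * A"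
        by (intro young_cubic_quartic X A) auto
      finally have "5/6 * ((v x)^3 * deriv \<phi> x) / A\<^sup>2 \<le> 2/3 * X^4 / A^3 + 417 * \<bar>deriv h x\<bar>^4 * A" .
      moreover have "\<bar>deriv h x\<bar>^4 * A \<le> c1^4 * (\<delta> + M)"
        using c1[of x] A by (intro mult_mono power_mono) auto
      ultimately have "5/6 * ((v x)^3 * deriv \<phi> x) / A\<^sup>2 \<le> 2/3 * X^4 / A^3 + 417 * (c1^4 * (\<delta> + M))" by linarith
      moreover have "2/3 * X^4 / A^3 = 2/3 * ((v x)^4 * \<phi> x) / A^3"
        by (simp add: X_def \<phi>_def power_mult_distrib)
      ultimately show ?thesis by linarith
    qed
    have t5: "- (\<delta>\<^sup>2 * (417 * c1^4 * (\<delta> + M))) \<le> \<delta>\<^sup>2 * (2/3 * ((v x)^4 * \<phi> x) / A^3 - 5/6 * ((v x)^3 * deriv \<phi> x) / A\<^sup>2)"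
      using mult_left_mono[OF t4 zero_le_power2[of \<delta>]] by (simp only: mult_minus_right)
    have t6: "\<delta> / 2 * (v x)\<^sup>2 * c2 + c0 * (\<delta> / 2 * (v x)\<^sup>2) \<le> \<delta> * (c0 + c2) * (v x)\<^sup>2"
    proof -
      have "0 \<le> \<delta> * ((c0 + c2) * (v x)\<^sup>2)" using \<delta> c0' c2' by simp
      then show ?thesis by (simp add: algebra_simps)
    qed
    have Ex: "E x = \<delta>\<^sup>2 * (417 * c1^4 * (\<delta> + M)) + \<delta> * (c0 + c2) * (v x)\<^sup>2 + c0 * ((u x)^3 * (z x)\<^sup>2 / (8 * \<delta>\<^sup>2))"
      by (simp add: E_def mult_ac)
    have gen: "- (d + e + c) \<le> r1 - r2 - r3 + r5"
      if "0 \<le> r1" "r2 \<le> a" "r3 \<le> b + c" "- d \<le> r5" "a + b \<le> e" for r1 r2 r3 r5 a b c d e :: real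
      using that by linarith
    show ?thesis unfolding eq Ex by (rule gen[OF t1 t2 t3[unfolded distrib_left] t5 t6])
  qed
  have "set_integrable lborel {a..b} (\<lambda>x. (1::real))"
    unfolding set_integrable_def by (rule borel_integrable_compact) auto
  then have "set_integrable lborel \<Omega> (\<lambda>x. (1::real))"
    by (rule set_integrable_subset) (use bnd in auto)
  then have ic: "set_integrable lborel \<Omega> (\<lambda>x. C)" for C :: real
    using set_integrable_mult_right[of C lborel \<Omega> "\<lambda>_. 1"] by simp
  have sP: "set_integrable lborel P f" if "set_integrable lborel \<Omega> f" for f :: "real \<Rightarrow> real"
    using that by (rule set_integrable_subset) (use open_P in auto)
  have iE: "set_integrable lborel P E"
    unfolding E_def by (intro set_integral_add(1) set_integrable_mult_right sP[OF ic] sP[OF i4] i3)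
  have "- (LINT x:P|lborel. E x) = (LINT x:P|lborel. - E x)"
    using iE by (simp add: set_integral_uminus)
  also have "\<dots> \<le> (LINT x:P|lborel. N x - limit_integrand \<phi> \<delta> x)"
    using iE N L(1) pointwise
    by (intro set_integral_mono set_integral_diff) (auto simp: set_integrable_def)
  also have "\<dots> = (LINT x:P|lborel. N x)"
    using N L by (simp add: set_integral_diff)
  finally have 1: "- (LINT x:P|lborel. E x) \<le> (LINT x:P|lborel. N x)" .
  define K where "K = 417 * c1^4 * \<delta>\<^sup>2 * (\<delta> + M)"
  have K: "0 \<le> K" using c1' M \<delta> by (simp add: K_def)
  have "(LINT x:P|lborel. E x) = (LINT x:P|lborel. K) + \<delta> * (c0 + c2) * (LINT x:P|lborel. (v x)\<^sup>2)
      + c0 / (8 * \<delta>\<^sup>2) * (LINT x:P|lborel. (u x)^3 * (z x)\<^sup>2)"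
  proof -
    have "(LINT x:P|lborel. E x) = (LINT x:P|lborel. K + \<delta> * (c0 + c2) * (v x)\<^sup>2)
      + (LINT x:P|lborel. c0 / (8 * \<delta>\<^sup>2) * ((u x)^3 * (z x)\<^sup>2))"
      unfolding E_def K_def by (intro set_integral_add set_integrable_mult_right sP[OF ic] sP[OF i4] i3)
    also have "(LINT x:P|lborel. K + \<delta> * (c0 + c2) * (v x)\<^sup>2) = (LINT x:P|lborel. K) + (LINT x:P|lborel. \<delta> * (c0 + c2) * (v x)\<^sup>2)"
      by (intro set_integral_add set_integrable_mult_right sP[OF ic] sP[OF i4])
    finally show ?thesis by simp
  qed
  also have "(LINT x:P|lborel. (v x)\<^sup>2) = (LINT x:\<Omega>|lborel. (v x)\<^sup>2)"
    by (rule toP[symmetric]) (use z in auto)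
  also have "(LINT x:P|lborel. K) \<le> (LINT x:\<Omega>|lborel. K)"
    unfolding set_lebesgue_integral_def
    using ic[of K] sP[OF ic[of K]] K by (intro integral_mono) (auto simp: set_integrable_def indicator_def)
  also have "(LINT x:\<Omega>|lborel. K) = K * (b - a)"
    using bnd by (simp add: set_lebesgue_integral_def)
  finally have 2: "(LINT x:P|lborel. E x) \<le> K * (b - a) + \<delta> * (c0 + c2) * (LINT x:\<Omega>|lborel. (v x)\<^sup>2)
      + c0 / (8 * \<delta>\<^sup>2) * (LINT x:P|lborel. (u x)^3 * (z x)\<^sup>2)" by simp
  show ?thesis
    using 1 2 rhs unfolding \<phi>_def[abs_def] K_def by linarith
qed

end

section \<open>From distributional to pointwise monotonicity\<close>

text \<open>One-sided: the mass lies to the right of 0, so that shifts by s > 0 stay inside the open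
  half-line of times.\<close>

definition mollifier :: "real \<Rightarrow> real \<Rightarrow> real" where
  "mollifier l r = bump 0 l r / (\<integral>q. bump 0 l q \<partial>lborel)"

lemma test_fun_integrable: "test_fun UNIV f \<Longrightarrow> integrable lborel f" for f :: "real \<Rightarrow> real"
  using loc_integrable_mult_test[OF loc_integrable_continuous[OF continuous_on_const[of _ 1]], of UNIV f]
  by (simp add: set_integrable_def)

lemma bump_integral_pos:
  assumes "c < d" shows "0 < (\<integral>q. bump c d q \<partial>lborel)"
proof -
  have i: "integrable lborel (bump c d)" by (rule test_fun_integrable[OF test_fun_bump]) auto
  have "(\<integral>q. bump c d q \<partial>lborel) \<noteq> 0"
  proof
    assume "(\<integral>q. bump c d q \<partial>lborel) = 0"
    then have "AE q in lborel. bump c d q = 0"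
      using integral_nonneg_eq_0_iff_AE[OF i] bump_nonneg by auto
    then have "AE q in lborel. q \<in> {c<..<d} \<longrightarrow> (1::real) = 0"
      by (rule AE_mp) (auto simp: bump_eq_0_iff)
    from AE_eq_continuous_imp_eq[OF _ _ _ this, of "(c + d)/2"] assms show False by auto
  qed
  moreover have "0 \<le> (\<integral>q. bump c d q \<partial>lborel)"
    by (rule Bochner_Integration.integral_nonneg) (auto simp: bump_nonneg)
  ultimately show ?thesis by linarith
qed

lemma mollifier:
  assumes "0 < l"
  shows "smooth (mollifier l)" "0 \<le> mollifier l r" "r \<notin> {0..l} \<Longrightarrow> mollifier l r = 0"
    "integrable lborel (mollifier l)" "(\<integral>r. mollifier l r \<partial>lborel) = 1"
proof -
  let ?I = "\<integral>q. bump 0 l q \<partial>lborel"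
  have I: "0 < ?I" using bump_integral_pos[OF assms] .
  have "smooth (\<lambda>r. (1 / ?I) * bump 0 l r)" by (rule smooth_cmult[OF smooth_bump])
  then show "smooth (mollifier l)" by (simp add: mollifier_def[abs_def])
  show "0 \<le> mollifier l r" using I bump_nonneg[of 0 l r] by (simp add: mollifier_def)
  show "r \<notin> {0..l} \<Longrightarrow> mollifier l r = 0" using bump_eq_0_iff[of 0 l r] by (auto simp: mollifier_def)
  have i: "integrable lborel (bump 0 l)" by (rule test_fun_integrable[OF test_fun_bump]) auto
  then show "integrable lborel (mollifier l)" by (simp add: mollifier_def[abs_def])
  show "(\<integral>r. mollifier l r \<partial>lborel) = 1" using I by (simp add: mollifier_def)
qed

lemma mollifier_primitive:
  assumes l: "0 < l"
  obtains G where "smooth G" "deriv G = mollifier l" "\<And>r. r \<le> 0 \<Longrightarrow> G r = 0" "\<And>r. l \<le> r \<Longrightarrow> G r = 1" "mono G"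
proof -
  note m = mollifier[OF l]
  have cont: "isCont (mollifier l) x" for x
    using smooth_continuous_on[OF m(1), of UNIV] continuous_on_eq_continuous_at[of UNIV] by auto
  obtain F where F: "\<And>x. (F has_real_derivative mollifier l x) (at x)"
    using einterval_antiderivative[of "-\<infinity>" "\<infinity>" "mollifier l"] cont
    by (auto simp: has_real_derivative_iff_has_vector_derivative)
  have FTC: "(LINT x:{x..y}|lborel. mollifier l x) = F y - F x" if "x \<le> y" for x y
    using integral_FTC_Icc_real[OF that F cont] by (simp add: set_lebesgue_integral_def mult.commute)
  define G where "G r = F r - F 0" for r
  have G: "(G has_real_derivative mollifier l r) (at r)" for r
    unfolding G_def[abs_def] using F[of r] by (auto intro!: derivative_eq_intros)
  have mono: "mono G"
    by (rule monoI, rule DERIV_nonneg_imp_nondecreasing) (use G m(2) in blast)+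
  have z: "mollifier l r = 0" if "r \<le> 0 \<or> l \<le> r" for r
    using that by (auto simp: mollifier_def bump_eq_0_iff)
  have 0: "G r = 0" if "r \<le> 0" for r
  proof -
    have "(\<lambda>x. indicator {r..0} x *\<^sub>R mollifier l x) = (\<lambda>x. 0)"
      using z by (auto simp: fun_eq_iff indicator_def)
    then show ?thesis using FTC[OF that] by (simp add: set_lebesgue_integral_def G_def)
  qed
  have 1: "G r = 1" if "l \<le> r" for r
  proof -
    have "(\<lambda>x. indicator {0..r} x *\<^sub>R mollifier l x) = mollifier l"
    proof
      fix x show "indicator {0..r} x *\<^sub>R mollifier l x = mollifier l x"
        using z[of x] that by (cases "x \<le> 0 \<or> l \<le> x") (auto simp: indicator_def)
    qed
    then show ?thesis using FTC[of 0 r] that l m(5) by (simp add: set_lebesgue_integral_def G_def)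
  qed
  have "smooth G" using smoothI_DERIV[OF G m(1)] .
  moreover have "deriv G = mollifier l" using G DERIV_imp_deriv by blast
  ultimately show thesis using that 0 1 mono by blast
qed

lemma mollify_tendsto:
  fixes m :: "real \<Rightarrow> real"
  assumes m: "continuous_on {0<..} m" and s: "0 < s"
  shows "(\<lambda>j. LINT r:{0<..}|lborel. m r * mollifier (1 / real (Suc j)) (r - s)) \<longlonglongrightarrow> m s"
proof (rule LIMSEQ_I)
  fix e :: real assume "e > 0"
  have "isCont m s" using m s continuous_on_eq_continuous_at[of "{0::real<..}" m] by auto
  then obtain d where d: "d > 0" "\<And>r. \<bar>r - s\<bar> < d \<Longrightarrow> \<bar>m r - m s\<bar> < e / 2"
    using \<open>e > 0\<close> unfolding continuous_at_eps_delta dist_real_def by (metis half_gt_zero)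
  obtain N where N: "1 / real (Suc N) < d" using nat_approx_posE[OF d(1)] by auto
  show "\<exists>no. \<forall>j\<ge>no. norm ((LINT r:{0<..}|lborel. m r * mollifier (1 / real (Suc j)) (r - s)) - m s) < e"
  proof (intro exI[of _ N] allI impI)
    fix j assume "N \<le> j"
    define l where "l = 1 / real (Suc j)"
    have l: "0 < l" "l < d" using N \<open>N \<le> j\<close> frac_le[of 1 1 "real (Suc N)" "real (Suc j)"] by (auto simp: l_def)
    note M = mollifier[OF l(1)]
    define k where "k r = mollifier l (r - s)" for r
    have k0: "r \<notin> {s..s + l} \<Longrightarrow> k r = 0" "0 \<le> k r" for r using M(2)[of "r - s"] M(3)[of "r - s"] by (auto simp: k_def)
    have ki: "has_bochner_integral lborel k 1"
      using lborel_integrable_real_affine[OF M(4), of 1 "- s"] lborel_integral_real_affine[of 1 "mollifier l" "- s"] M(5)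
      by (simp add: has_bochner_integral_iff k_def[abs_def])
    have km: "k \<in> borel_measurable borel"
      using ki by (auto simp: has_bochner_integral_iff)
    define f where "f r = indicator {s..s + l} r *\<^sub>R m r" for r
    have cs: "continuous_on {s..s + l} m" by (rule continuous_on_subset[OF m]) (use s in auto)
    have fm: "integrable lborel f" unfolding f_def by (rule borel_integrable_compact) (use cs in auto)
    have fk: "f r * k r = m r * k r" for r using k0(1)[of r] by (auto simp: f_def indicator_def)
    obtain C where C: "\<And>r. \<bar>f r\<bar> \<le> C"
    proof -
      have "bounded (m ` {s..s + l})" using cs compact_continuous_image compact_imp_bounded by blast
      then obtain C where "\<And>r. r \<in> {s..s + l} \<Longrightarrow> \<bar>m r\<bar> \<le> C" unfolding bounded_iff by (metis imageI real_norm_def)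
      then have "\<bar>f r\<bar> \<le> max C 0" for r by (auto simp: f_def indicator_def le_max_iff_disj)
      then show thesis by (rule that)
    qed
    have "integrable lborel (\<lambda>r. k r * f r)"
      using ki fm C by (intro integrable_mult_bounded) (auto simp: has_bochner_integral_iff)
    then have mk: "integrable lborel (\<lambda>r. m r * k r)" by (simp add: mult.commute fk)
    have "(\<lambda>r. indicator {0<..} r *\<^sub>R (m r * k r)) = (\<lambda>r. m r * k r)"
      using k0(1) s by (fastforce simp: indicator_def fun_eq_iff)
    then have "(LINT r:{0<..}|lborel. m r * k r) - m s = (\<integral>r. m r * k r \<partial>lborel) - (\<integral>r. m s * k r \<partial>lborel)"
      using ki by (simp add: set_lebesgue_integral_def has_bochner_integral_iff)
    also have "\<dots> = (\<integral>r. (m r - m s) * k r \<partial>lborel)"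
      using mk ki by (subst Bochner_Integration.integral_diff[symmetric])
        (auto simp: has_bochner_integral_iff left_diff_distrib)
    finally have "\<bar>(LINT r:{0<..}|lborel. m r * k r) - m s\<bar> \<le> (\<integral>r. \<bar>(m r - m s) * k r\<bar> \<partial>lborel)"
      using integral_abs_bound by metis
    also have "\<dots> \<le> (\<integral>r. e / 2 * k r \<partial>lborel)"
    proof (rule integral_mono)
      have "integrable lborel (\<lambda>r. m r * k r - m s * k r)"
        using mk ki by (auto simp: has_bochner_integral_iff)
      then show "integrable lborel (\<lambda>r. \<bar>(m r - m s) * k r\<bar>)"
        by (intro integrable_abs) (simp add: left_diff_distrib)
      show "integrable lborel (\<lambda>r. e / 2 * k r)" using ki by (auto simp: has_bochner_integral_iff)
      fix r
      have "\<bar>m r - m s\<bar> * k r \<le> e / 2 * k r" if "r \<in> {s..s + l}"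
        using d(2)[of r] that l k0(2)[of r] by (intro mult_right_mono) auto
      then show "\<bar>(m r - m s) * k r\<bar> \<le> e / 2 * k r"
        using k0[of r] by (cases "r \<in> {s..s + l}") (auto simp: abs_mult)
    qed
    also have "\<dots> = e / 2" using ki by (simp add: has_bochner_integral_iff)
    finally show "norm ((LINT r:{0<..}|lborel. m r * mollifier (1 / real (Suc j)) (r - s)) - m s) < e"
      using \<open>e > 0\<close> by (simp add: k_def l_def)
  qed
qed

text \<open>With G a smooth step of width l, the function \<eta>(r) = G(r - s) - G(r - t) is a
  smoothed indicator of [s, t]. Its derivative is a difference of two mollifiers, so - \<integral> m
  \<eta>' tends to m t - m s as l -> 0. Its values lie in [0, 1], and l \<le> 1 keeps its support in
  [s, t + 1]; hence the same E serves for all l.\<close>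

lemma increment_ge_if_distributional:
  fixes m :: "real \<Rightarrow> real"
  assumes m: "continuous_on {0<..} m" and st: "0 < s" "s < t"
    and D: "\<And>\<eta>. test_fun {0<..} \<eta> \<Longrightarrow> (\<And>r. 0 \<le> \<eta> r \<and> \<eta> r \<le> 1) \<Longrightarrow> (\<And>r. r \<notin> {s..t + 1} \<Longrightarrow> \<eta> r = 0) \<Longrightarrow>
       - E \<le> - (LINT r:{0<..}|lborel. m r * deriv \<eta> r)"
  shows "- E \<le> m t - m s"
proof -
  let ?f = "\<lambda>a j. LINT r:{0<..}|lborel. m r * mollifier (1 / real (Suc j)) (r - a)"
  have lim: "(\<lambda>j. ?f t j - ?f s j) \<longlonglongrightarrow> m t - m s"
    using st by (intro tendsto_diff mollify_tendsto m) auto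
  have "- E \<le> ?f t j - ?f s j" for j
  proof -
    define l where "l = 1 / real (Suc j)"
    have l: "0 < l" "l \<le> 1" by (auto simp: l_def)
    obtain G where G: "smooth G" "deriv G = mollifier l" "\<And>r. r \<le> 0 \<Longrightarrow> G r = 0" "\<And>r. l \<le> r \<Longrightarrow> G r = 1" "mono G"
      using mollifier_primitive[OF l(1)] by metis
    have G01: "0 \<le> G r" "G r \<le> 1" for r
      using monoD[OF G(5), of "min r 0" r] monoD[OF G(5), of r "max r l"] G(3)[of "min r 0"] G(4)[of "max r l"] by auto
    define \<eta> where "\<eta> r = G (r + (- s)) - G (r + (- t))" for r
    have sm: "smooth \<eta>" unfolding \<eta>_def by (intro smooth_diff smooth_translate G(1))
    have z: "\<eta> r = 0" if "r \<notin> {s..t + 1}" for r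
      using that G(3)[of "r - s"] G(3)[of "r - t"] G(4)[of "r - s"] G(4)[of "r - t"] l st by (auto simp: \<eta>_def)
    have t: "test_fun {0<..} \<eta>"
      by (rule test_funI[OF sm, of "{s..t + 1}"]) (use st z in auto)
    have b: "0 \<le> \<eta> r \<and> \<eta> r \<le> 1" for r
      using monoD[OF G(5), of "r - t" "r - s"] G01[of "r - s"] G01[of "r - t"] st by (auto simp: \<eta>_def)
    have d: "deriv \<eta> r = mollifier l (r - s) - mollifier l (r - t)" for r
    proof (rule DERIV_imp_deriv)
      have "((\<lambda>r. G (r + c)) has_real_derivative mollifier l (r + c)) (at r)" for c
        using smooth_DERIV[OF G(1), of "r + c"] G(2) DERIV_shift by metis
      from DERIV_diff[OF this[of "- s"] this[of "- t"]]
      show "(\<eta> has_real_derivative mollifier l (r - s) - mollifier l (r - t)) (at r)"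
        by (simp add: \<eta>_def[abs_def])
    qed
    have i: "set_integrable lborel {0<..} (\<lambda>r. m r * mollifier l (r - a))" if "0 < a" for a
    proof (rule loc_integrable_mult_test[OF loc_integrable_continuous[OF m]])
      have "smooth (\<lambda>r. mollifier l (r + (- a)))" by (rule smooth_translate[OF mollifier(1)[OF l(1)]])
      then have "smooth (\<lambda>r. mollifier l (r - a))" by simp
      then show "test_fun {0<..} (\<lambda>r. mollifier l (r - a))"
        by (rule test_funI[of _ "{a..a + l}"]) (use that mollifier(3)[OF l(1)] in auto)
    qed
    have "- E \<le> - (LINT r:{0<..}|lborel. m r * deriv \<eta> r)" by (rule D[OF t b z])
    also have "(LINT r:{0<..}|lborel. m r * deriv \<eta> r) = ?f s j - ?f t j"
      unfolding d l_def[symmetric] right_diff_distrib using i[of s] i[of t] st by (intro set_integral_diff) auto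
    finally show ?thesis by simp
  qed
  then show ?thesis using LIMSEQ_le_const[OF lim] by blast
qed

lemma test_fun_tensor:
  fixes \<eta> \<phi> :: "real \<Rightarrow> real"
  assumes "test_fun U \<eta>" "test_fun V \<phi>"
  shows "test_fun (U \<times> V) (\<lambda>(t, x). \<eta> t * \<phi> x)"
proof (rule test_funI[of _ "supp \<eta> \<times> supp \<phi>"])
  show "smooth (\<lambda>(t, x). \<eta> t * \<phi> x)"
    using assms by (intro smooth_tensor test_fun_smooth)
  show "compact (supp \<eta> \<times> supp \<phi>)" "supp \<eta> \<times> supp \<phi> \<subseteq> U \<times> V"
    using test_fun_supp[OF assms(1)] test_fun_supp[OF assms(2)] by (auto intro: compact_Times)
  show "(case z of (t, x) \<Rightarrow> \<eta> t * \<phi> x) = 0" if "z \<notin> supp \<eta> \<times> supp \<phi>" for z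
    using that not_in_supp[of "fst z" \<eta>] not_in_supp[of "snd z" \<phi>] by (cases z) auto
qed

lemma ennreal_add_leD:
  fixes x y z :: ennreal
  assumes "x + y \<le> z" shows "x \<le> z" "y \<le> z"
  using order_trans[OF add_increasing2[OF zero_le order_refl] assms]
    order_trans[OF add_increasing[OF zero_le order_refl] assms] by auto

lemma borel_measurable_section:
  fixes f :: "real \<times> real \<Rightarrow> real"
  assumes "f \<in> borel_measurable borel" shows "(\<lambda>x. f (t, x)) \<in> borel_measurable borel"
proof -
  have "f \<in> borel_measurable (borel \<Otimes>\<^sub>M borel)" using assms by (simp add: borel_prod)
  then show ?thesis by measurable
qed

text \<open>As f is only locally integrable, Fubini's theorem applies after multiplication by both
  test functions. Integrability of a slice is therefore obtained only at times with \<eta> t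
  \<noteq> 0.\<close>

lemma tensor_Fubini:
  fixes f :: "real \<Rightarrow> real \<Rightarrow> real"
  assumes f: "loc_integrable (U \<times> V) (\<lambda>(t, x). f t x)" and \<eta>: "test_fun U \<eta>" and \<phi>: "test_fun V \<phi>"
  shows "integrable lborel (\<lambda>t. \<eta> t * (LINT x:V|lborel. f t x * \<phi> x))"
    and "(LINT (t, x):U \<times> V|lborel. f t x * (\<eta> t * \<phi> x)) = (\<integral>t. \<eta> t * (LINT x:V|lborel. f t x * \<phi> x) \<partial>lborel)"
    and "AE t in lborel. \<eta> t \<noteq> 0 \<longrightarrow> set_integrable lborel V (\<lambda>x. f t x * \<phi> x)"
proof -
  let ?g = "\<lambda>(t, x). indicator V x * (f t x * (\<eta> t * \<phi> x))"
  have *: "indicator (U \<times> V) z *\<^sub>R ((case z of (t, x) \<Rightarrow> f t x) * (case z of (t, x) \<Rightarrow> \<eta> t * \<phi> x)) = ?g z" for z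
    using test_fun_supp(3)[OF \<eta>] by (cases z) (auto simp: indicator_def)
  have "set_integrable lborel (U \<times> V) (\<lambda>z. (case z of (t, x) \<Rightarrow> f t x) * (case z of (t, x) \<Rightarrow> \<eta> t * \<phi> x))"
    by (rule loc_integrable_mult_test[OF f test_fun_tensor[OF \<eta> \<phi>]])
  then have g: "integrable (lborel \<Otimes>\<^sub>M lborel) ?g"
    unfolding set_integrable_def * lborel_prod .
  have sec: "(\<integral>x. ?g (t, x) \<partial>lborel) = \<eta> t * (LINT x:V|lborel. f t x * \<phi> x)" for t
  proof -
    have "(\<integral>x. ?g (t, x) \<partial>lborel) = (\<integral>x. \<eta> t * (indicator V x *\<^sub>R (f t x * \<phi> x)) \<partial>lborel)"
      by (intro Bochner_Integration.integral_cong) (auto simp: mult_ac)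
    then show ?thesis by (simp add: set_lebesgue_integral_def)
  qed
  show "integrable lborel (\<lambda>t. \<eta> t * (LINT x:V|lborel. f t x * \<phi> x))"
    using lborel_pair.integrable_fst'[OF g] by (simp only: sec)
  have "(\<integral>t. \<eta> t * (LINT x:V|lborel. f t x * \<phi> x) \<partial>lborel) = integral\<^sup>L lborel ?g"
    using lborel_pair.integral_fst'[OF g] by (simp only: sec lborel_prod)
  also have "\<dots> = (LINT (t, x):U \<times> V|lborel. f t x * (\<eta> t * \<phi> x))"
    unfolding set_lebesgue_integral_def *[symmetric]
    by (intro Bochner_Integration.integral_cong) (auto simp: split_beta)
  finally show "(LINT (t, x):U \<times> V|lborel. f t x * (\<eta> t * \<phi> x)) = (\<integral>t. \<eta> t * (LINT x:V|lborel. f t x * \<phi> x) \<partial>lborel)"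
    by simp
  show "AE t in lborel. \<eta> t \<noteq> 0 \<longrightarrow> set_integrable lborel V (\<lambda>x. f t x * \<phi> x)"
    using lborel_pair.AE_integrable_fst'[OF g]
  proof eventually_elim
    case (elim t)
    have "integrable lborel (\<lambda>x. \<eta> t * (indicator V x *\<^sub>R (f t x * \<phi> x)))"
      by (rule Bochner_Integration.integrable_cong[THEN iffD1, OF refl _ elim]) (auto simp: mult_ac)
    then show ?case by (auto simp: set_integrable_def)
  qed
qed

section \<open>Estimates for one solution\<close>

text \<open>The existentially quantified derivatives become parameters, and the initial energy is
  replaced by one constant C0 common to all \<epsilon>. Thus the estimates depend on \<epsilon> only
  where it is displayed.\<close>

locale film =
  fixes a b n \<epsilon> C0 :: real and \<Omega> :: "real set" and u ux uxx uxxx :: "real \<Rightarrow> real \<Rightarrow> real"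
  assumes ab: "a < b" and \<Omega>: "\<Omega> = {a<..<b}" and n: "0 < n" "n < 3" and \<epsilon>: "0 < \<epsilon>" "\<epsilon> \<le> 1/2" and C0: "0 \<le> C0"
    and u_cont: "continuous_on ({0..} \<times> closure \<Omega>) (\<lambda>(t, x). u t x)"
    and u_nonneg: "\<forall>t\<ge>0. \<forall>x\<in>closure \<Omega>. 0 \<le> u t x"
    and der: "derivatives \<Omega> u ux uxx uxxx"
    and mass: "\<forall>t>0. (LINT x:\<Omega>|lborel. u t x) = 1"
    and energy: "\<forall>t>0.
           (\<integral>\<^sup>+x\<in>\<Omega>. ennreal ((ux t x)\<^sup>2 / 2) \<partial>lborel)
           + (\<integral>\<^sup>+z\<in>{(s, x). 0 < s \<and> s < t \<and> x \<in> \<Omega> \<and> u s x > 0}.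
                (case z of (s, x) \<Rightarrow>
                   ennreal (\<bar>ln \<epsilon>\<bar> * mobility n \<epsilon> (u s x) * (uxxx s x)\<^sup>2)) \<partial>lborel)
           \<le> ennreal C0"
    and entropy: "\<forall>t>0.
           (\<integral>\<^sup>+z\<in>{0<..<t} \<times> \<Omega>. (case z of (s, x) \<Rightarrow> ennreal (u s x * (uxx s x)\<^sup>2)) \<partial>lborel)
           + (\<integral>\<^sup>+x\<in>\<Omega>. ennreal (B_eps n \<epsilon> (u 0 x)) \<partial>lborel)
           \<le> (\<integral>\<^sup>+x\<in>\<Omega>. ennreal (B_eps n \<epsilon> (u t x)) \<partial>lborel)"
    and C1: "AE t\<in>{0<..} in lborel. \<exists>v. continuous_on (closure \<Omega>) v \<and>
           (\<forall>x\<in>closure \<Omega>. (u t has_real_derivative v x) (at x within closure \<Omega>)) \<and>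
           (\<forall>x\<in>frontier \<Omega>. v x = 0)"
    and evolution: "distr_eq \<Omega> (\<lambda>t x. B_eps n \<epsilon> (u t x)) (T_eps u ux uxxx) (R_eps n \<epsilon> u uxxx)"
    and T_formula: "AE t\<in>{0<..} in lborel. \<forall>\<phi>. smooth \<phi> \<longrightarrow>
           (LINT x:\<Omega>|lborel. T_eps u ux uxxx t x * \<phi> x)
           = (LINT x:\<Omega>|lborel. u t x * (uxx t x)\<^sup>2 * \<phi> x)
             - 5 / 6 * (LINT x:\<Omega>|lborel. (ux t x) ^ 3 * deriv \<phi> x)
             - 1 / 2 * (LINT x:\<Omega>|lborel. u t x * (ux t x)\<^sup>2 * deriv (deriv \<phi>) x)"
begin

text \<open>A bound for u that is uniform in t and \<epsilon>: the mean value of a function with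
  mass 1, a margin of 1 that yields a strict contradiction with the mass, and the bound for the
  oscillation.\<close>

definition "M = 1 / (b - a) + 1 + ((b - a) / 2 + C0)"

lemma M_ge_1: "1 \<le> M"
  using ab C0 by (simp add: M_def)

lemma ln_pos: "0 < \<bar>ln \<epsilon>\<bar>"
  using \<epsilon> by (simp add: ln_less_zero)

lemma open_\<Omega>: "open \<Omega>" by (simp add: \<Omega>)

lemma closure_\<Omega>: "closure \<Omega> = {a..b}" using ab by (simp add: \<Omega>)

lemma \<Omega>_borel[measurable]: "\<Omega> \<in> sets borel" by (simp add: \<Omega>)

lemma const_integrable: "set_integrable lborel \<Omega> (\<lambda>x. c :: real)"
proof -
  have "set_integrable lborel {a..b} (\<lambda>x. c)"
    unfolding set_integrable_def by (rule borel_integrable_compact) auto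
  then show ?thesis by (rule set_integrable_subset) (auto simp: \<Omega>)
qed

lemma const_integral: "(LINT x:\<Omega>|lborel. c :: real) = c * (b - a)"
  using ab by (simp add: \<Omega> set_lebesgue_integral_def)

lemma cont_integrable:
  assumes "continuous_on {a..b} (f :: real \<Rightarrow> real)" shows "set_integrable lborel \<Omega> f"
proof -
  have "set_integrable lborel {a..b} f"
    unfolding set_integrable_def by (rule borel_integrable_compact) (use assms in auto)
  then show ?thesis by (rule set_integrable_subset) (auto simp: \<Omega>)
qed

lemma u_cont_x: "0 \<le> t \<Longrightarrow> continuous_on {a..b} (u t)"
proof -
  assume "0 \<le> t"
  moreover have "continuous_on {a..b} (Pair t)"
    by (intro continuous_on_Pair continuous_on_const continuous_on_id)
  ultimately show ?thesis
    using continuous_on_compose2[OF u_cont, of "{a..b}" "Pair t"] by (auto simp: closure_\<Omega>)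
qed

lemma u_nonneg': "0 \<le> t \<Longrightarrow> x \<in> \<Omega> \<Longrightarrow> 0 \<le> u t x"
  using u_nonneg closure_subset by blast

lemma gradient_bound:
  assumes "0 < t" shows "(\<integral>\<^sup>+x\<in>\<Omega>. ennreal ((ux t x)\<^sup>2 / 2) \<partial>lborel) \<le> ennreal C0"
  by (rule ennreal_add_leD(1)[OF energy[rule_format, OF assms]])

text \<open>The inequality |u_x| \<le> 1/2 + u_x^2 / 2 is integrated over [x, y]. The first summand
  gives at most (b - a) / 2, the second at most C0 by the energy inequality.\<close>

lemma oscillation:
  assumes t: "0 < t" and xy: "x \<in> \<Omega>" "y \<in> \<Omega>" "x \<le> y"
  shows "\<bar>u t y - u t x\<bar> \<le> (b - a) / 2 + C0"
proof -
  have w: "weak_deriv \<Omega> (u t) (ux t)" using der t by (auto simp: derivatives_def)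
  have "ac_on \<Omega> (u t) (ux t)"
  proof (rule weak_deriv_ac_on[OF open_\<Omega> w])
    show "continuous_on \<Omega> (u t)"
      by (rule continuous_on_subset[OF u_cont_x]) (use t in \<open>auto simp: \<Omega>\<close>)
  qed simp
  moreover have sub: "{x..y} \<subseteq> \<Omega>" using xy by (auto simp: \<Omega>)
  ultimately have i: "set_integrable lborel {x..y} (ux t)" and e: "(LINT q:{x..y}|lborel. ux t q) = u t y - u t x"
    using xy by (auto simp: ac_on_def)
  define g where "g q = indicator {x..y} q * ux t q" for q
  have g[measurable]: "integrable lborel g" using i by (simp add: set_integrable_def g_def[abs_def])
  then have gm[measurable]: "g \<in> borel_measurable borel" by auto
  have "ennreal \<bar>u t y - u t x\<bar> \<le> (\<integral>\<^sup>+q. ennreal (norm (g q)) \<partial>lborel)"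
    using integral_norm_bound_ennreal[OF g] e by (simp add: set_lebesgue_integral_def g_def[abs_def])
  also have "\<dots> \<le> (\<integral>\<^sup>+q. ennreal (1/2 * indicator {x..y} q) + ennreal ((g q)\<^sup>2 / 2) \<partial>lborel)"
  proof (rule nn_integral_mono)
    fix q
    have "0 \<le> (\<bar>g q\<bar> - 1)\<^sup>2" by simp
    then have "\<bar>g q\<bar> \<le> 1/2 + (g q)\<^sup>2 / 2" by (simp add: power2_diff)
    then have "\<bar>g q\<bar> \<le> 1/2 * indicator {x..y} q + (g q)\<^sup>2 / 2"
      by (cases "q \<in> {x..y}") (auto simp: g_def)
    then show "ennreal (norm (g q)) \<le> ennreal (1/2 * indicator {x..y} q) + ennreal ((g q)\<^sup>2 / 2)"
      by (metis ennreal_leI ennreal_plus real_norm_def zero_le_divide_iff zero_le_power2 indicator_pos_le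
          mult_nonneg_nonneg zero_le_numeral zero_le_one)
  qed
  also have "\<dots> = (\<integral>\<^sup>+q. ennreal (1/2 * indicator {x..y} q) \<partial>lborel) + (\<integral>\<^sup>+q. ennreal ((g q)\<^sup>2 / 2) \<partial>lborel)"
    by (rule nn_integral_add) auto
  also have "(\<integral>\<^sup>+q. ennreal (1/2 * indicator {x..y} q) \<partial>lborel) = ennreal ((y - x) / 2)"
  proof -
    have "(\<integral>\<^sup>+q. ennreal (1/2 * indicator {x..y} q) \<partial>lborel) = (\<integral>\<^sup>+q. ennreal (1/2) * indicator {x..y} q \<partial>lborel)"
      by (intro nn_integral_cong) (auto simp: indicator_def)
    also have "\<dots> = ennreal (1/2) * ennreal (y - x)"
      using xy by (subst nn_integral_cmult_indicator) auto
    also have "\<dots> = ennreal ((y - x) / 2)" by (subst ennreal_mult'[symmetric]) auto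
    finally show ?thesis .
  qed
  also have "ennreal ((y - x) / 2) \<le> ennreal ((b - a) / 2)" using xy by (intro ennreal_leI) (auto simp: \<Omega>)
  also have "(\<integral>\<^sup>+q. ennreal ((g q)\<^sup>2 / 2) \<partial>lborel) \<le> (\<integral>\<^sup>+x\<in>\<Omega>. ennreal ((ux t x)\<^sup>2 / 2) \<partial>lborel)"
    using sub by (intro nn_integral_mono) (auto simp: g_def indicator_def)
  also have "\<dots> \<le> ennreal C0" by (rule gradient_bound[OF t])
  finally have "ennreal \<bar>u t y - u t x\<bar> \<le> ennreal ((b - a) / 2) + ennreal C0"
    by (simp add: add_mono)
  also have "\<dots> = ennreal ((b - a) / 2 + C0)" using ab C0 by (subst ennreal_plus) auto
  finally show ?thesis using ab C0 by (subst (asm) ennreal_le_iff) auto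
qed

text \<open>If u exceeded the mean value by more than 1 everywhere, its mass would be at least 1 +
  (b - a). So u is small at some point, and the oscillation bound carries this to all
  others.\<close>

lemma u_le_M:
  assumes t: "0 < t" and x: "x \<in> \<Omega>" shows "u t x \<le> M"
proof -
  have "\<exists>y\<in>\<Omega>. u t y \<le> 1 / (b - a) + 1"
  proof (rule ccontr)
    assume "\<not> ?thesis"
    then have "(LINT x:\<Omega>|lborel. 1 / (b - a) + 1) \<le> (LINT x:\<Omega>|lborel. u t x)"
      using t by (intro set_integral_mono const_integrable cont_integrable u_cont_x) auto
    then have "(1 / (b - a) + 1) * (b - a) \<le> 1" using mass t by (simp only: const_integral)
    moreover have "(1 / (b - a) + 1) * (b - a) = 1 + (b - a)" using ab by (simp add: distrib_right)
    ultimately show False using ab by linarith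
  qed
  then obtain y where y: "y \<in> \<Omega>" "u t y \<le> 1 / (b - a) + 1" by blast
  have "\<bar>u t x - u t y\<bar> \<le> (b - a) / 2 + C0"
    using oscillation[OF t x y(1)] oscillation[OF t y(1) x] by (cases "x \<le> y") auto
  then show ?thesis using y by (simp add: M_def)
qed

definition "Q = {0::real<..} \<times> \<Omega>"
definition "Pos = {(t, x). 0 < t \<and> x \<in> \<Omega> \<and> u t x > 0}"

text \<open>Measurability is always stated for functions cut off by \<open>Q\<close> or
  \<open>Pos\<close>, since nothing is known about u and its derivatives outside these sets.\<close>

lemma u_measurable[measurable]: "(\<lambda>z. indicator Q z * (case z of (t, x) \<Rightarrow> u t x)) \<in> borel_measurable borel"
proof -
  have "open Q" unfolding Q_def by (intro open_Times open_\<Omega> open_greaterThan)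
  moreover have "continuous_on Q (\<lambda>(t, x). u t x)"
    by (rule continuous_on_subset[OF u_cont]) (use closure_subset[of \<Omega>] in \<open>auto simp: Q_def\<close>)
  ultimately show ?thesis
    using borel_measurable_continuous_on_indicator[of Q "\<lambda>(t, x). u t x"] by simp
qed

lemma Q_borel[measurable]: "Q \<in> sets borel"
  unfolding Q_def by (intro borel_open open_Times open_\<Omega> open_greaterThan)

lemma Pos_borel[measurable]: "Pos \<in> sets borel"
proof -
  have "Pos = {z\<in>space borel. 0 < indicator Q z * (case z of (t, x) \<Rightarrow> u t x)}"
    by (auto simp: Pos_def Q_def indicator_def split: if_splits)
  also have "\<dots> \<in> sets borel" by measurable
  finally show ?thesis .
qed

lemma derivatives_measurable[measurable]:
  "(\<lambda>z. indicator Q z * (case z of (t, x) \<Rightarrow> ux t x)) \<in> borel_measurable borel"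
  "(\<lambda>z. indicator Pos z * (case z of (t, x) \<Rightarrow> uxx t x)) \<in> borel_measurable borel"
  "(\<lambda>z. indicator Pos z * (case z of (t, x) \<Rightarrow> uxxx t x)) \<in> borel_measurable borel"
  using der by (auto simp: derivatives_def set_borel_measurable_def Q_def Pos_def)

text \<open>The factor |ln \<epsilon>| of the energy inequality is left out, so that the integral is
  at most C0 / |ln \<epsilon>|. All smallness in \<epsilon> comes from here.\<close>

definition "dissipation z = indicator Pos z * (case z of (t, x) \<Rightarrow> mobility n \<epsilon> (u t x) * (uxxx t x)\<^sup>2)"

lemma mobility_nonneg: "0 \<le> s \<Longrightarrow> 0 \<le> mobility n \<epsilon> s"
  by (simp add: mobility_def)

lemma dissipation_nonneg: "0 \<le> dissipation z"
  by (auto simp: dissipation_def Pos_def indicator_def intro!: mult_nonneg_nonneg mobility_nonneg)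

lemma dissipation_measurable[measurable]: "dissipation \<in> borel_measurable borel"
proof -
  have "dissipation = (\<lambda>z. mobility n \<epsilon> (indicator Q z * (case z of (t, x) \<Rightarrow> u t x))
      * (indicator Pos z * (case z of (t, x) \<Rightarrow> uxxx t x))\<^sup>2)"
    by (auto simp: dissipation_def fun_eq_iff Pos_def Q_def indicator_def)
  moreover have "\<dots> \<in> borel_measurable borel"
    unfolding mobility_def by measurable
  ultimately show ?thesis by simp
qed

lemma dissipation_bound:
  assumes T: "0 < T"
  shows "integrable lborel (\<lambda>z. indicator ({0<..<T} \<times> UNIV) z * dissipation z)"
    and "(\<integral>z. indicator ({0<..<T} \<times> UNIV) z * dissipation z \<partial>lborel) \<le> C0 / \<bar>ln \<epsilon>\<bar>"
proof -
  let ?f = "\<lambda>z. indicator ({0<..<T} \<times> UNIV) z * dissipation z"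
  have [measurable]: "{0<..<T} \<times> (UNIV :: real set) \<in> sets borel"
    by (intro borel_open open_Times) auto
  have m: "?f \<in> borel_measurable lborel" by measurable
  have nn: "0 \<le> ?f z" for z using dissipation_nonneg[of z] by simp
  have "ennreal \<bar>ln \<epsilon>\<bar> * (\<integral>\<^sup>+z. ennreal (?f z) \<partial>lborel) = (\<integral>\<^sup>+z. ennreal \<bar>ln \<epsilon>\<bar> * ennreal (?f z) \<partial>lborel)"
    using m by (intro nn_integral_cmult[symmetric]) auto
  also have "\<dots> = (\<integral>\<^sup>+z\<in>{(s, x). 0 < s \<and> s < T \<and> x \<in> \<Omega> \<and> u s x > 0}.
                (case z of (s, x) \<Rightarrow> ennreal (\<bar>ln \<epsilon>\<bar> * mobility n \<epsilon> (u s x) * (uxxx s x)\<^sup>2)) \<partial>lborel)"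
    by (intro nn_integral_cong)
      (auto simp: dissipation_def Pos_def indicator_def ennreal_mult'[symmetric] mult.assoc)
  also have "\<dots> \<le> ennreal C0" by (rule ennreal_add_leD(2)[OF energy[rule_format, OF T]])
  finally have "ennreal \<bar>ln \<epsilon>\<bar> * (\<integral>\<^sup>+z. ennreal (?f z) \<partial>lborel) \<le> ennreal C0" .
  then have "ennreal (1 / \<bar>ln \<epsilon>\<bar>) * (ennreal \<bar>ln \<epsilon>\<bar> * (\<integral>\<^sup>+z. ennreal (?f z) \<partial>lborel)) \<le> ennreal (1 / \<bar>ln \<epsilon>\<bar>) * ennreal C0"
    by (rule mult_left_mono) simp
  moreover have "ennreal (1 / \<bar>ln \<epsilon>\<bar>) * (ennreal \<bar>ln \<epsilon>\<bar> * N) = N" for N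
    using ln_pos by (simp add: mult.assoc[symmetric] ennreal_mult'[symmetric])
  moreover have "ennreal (1 / \<bar>ln \<epsilon>\<bar>) * ennreal C0 = ennreal (C0 / \<bar>ln \<epsilon>\<bar>)"
    by (simp add: ennreal_mult'[symmetric])
  ultimately have le: "(\<integral>\<^sup>+z. ennreal (?f z) \<partial>lborel) \<le> ennreal (C0 / \<bar>ln \<epsilon>\<bar>)" by simp
  then have fin: "(\<integral>\<^sup>+z. ennreal (?f z) \<partial>lborel) < \<infinity>" by (simp add: le_less_trans)
  show i: "integrable lborel ?f"
    using m nn fin by (intro integrableI_nonneg) auto
  have "ennreal (\<integral>z. ?f z \<partial>lborel) = (\<integral>\<^sup>+z. ennreal (?f z) \<partial>lborel)"
    using i nn by (intro nn_integral_eq_integral[symmetric]) auto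
  then have "ennreal (\<integral>z. ?f z \<partial>lborel) \<le> ennreal (C0 / \<bar>ln \<epsilon>\<bar>)" using le by (simp only:)
  then show "(\<integral>z. ?f z \<partial>lborel) \<le> C0 / \<bar>ln \<epsilon>\<bar>"
    by (subst (asm) ennreal_le_iff) (use C0 in auto)
qed

text \<open>By the entropy inequality the production up to T is at most the integral of
  \<open>B_eps\<close> at time T, which is finite as u \<le> M. Tonelli's theorem makes almost every
  slice finite. This supplies the integrability of u u_xx^2 for
  \<open>production_lower_bound\<close>.\<close>

lemma entropy_production_finite:
  assumes T: "0 < T"
  shows "AE t in lborel. t \<in> {0<..<T} \<longrightarrow> (\<integral>\<^sup>+x\<in>\<Omega>. ennreal (u t x * (uxx t x)\<^sup>2) \<partial>lborel) < \<infinity>"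
proof -
  let ?f = "\<lambda>z. (case z of (s, x) \<Rightarrow> ennreal (u s x * (uxx s x)\<^sup>2)) * indicator ({0<..<T} \<times> \<Omega>) z"
  have [measurable]: "{0<..<T} \<times> \<Omega> \<in> sets borel"
    using open_\<Omega> by (intro borel_open open_Times) auto
  have eq: "?f = (\<lambda>z. ennreal ((indicator Q z * (case z of (t, x) \<Rightarrow> u t x))
      * (indicator Pos z * (case z of (t, x) \<Rightarrow> uxx t x))\<^sup>2) * indicator ({0<..<T} \<times> \<Omega>) z)"
  proof
    fix z :: "real \<times> real"
    obtain s x where z: "z = (s, x)" by (cases z)
    show "?f z = ennreal ((indicator Q z * (case z of (t, x) \<Rightarrow> u t x))
      * (indicator Pos z * (case z of (t, x) \<Rightarrow> uxx t x))\<^sup>2) * indicator ({0<..<T} \<times> \<Omega>) z"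
      using u_nonneg'[of s x] by (cases "u s x = 0") (auto simp: z Q_def Pos_def indicator_def)
  qed
  have m: "?f \<in> borel_measurable (lborel \<Otimes>\<^sub>M lborel)"
    unfolding lborel_prod eq by measurable
  have "(\<integral>\<^sup>+z. ?f z \<partial>lborel) \<le> (\<integral>\<^sup>+x\<in>\<Omega>. ennreal (B_eps n \<epsilon> (u T x)) \<partial>lborel)"
    by (rule ennreal_add_leD(1)[OF entropy[rule_format, OF T]])
  also have "\<dots> \<le> (\<integral>\<^sup>+x. ennreal (1 + (B n 1 + ln M) / \<bar>ln \<epsilon>\<bar>) * indicator \<Omega> x \<partial>lborel)"
    using B_eps_le[OF n \<epsilon> u_nonneg' u_le_M[OF T] M_ge_1] T
    by (intro nn_integral_mono) (auto simp: indicator_def intro!: ennreal_leI)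
  also have "\<dots> = ennreal (1 + (B n 1 + ln M) / \<bar>ln \<epsilon>\<bar>) * emeasure lborel \<Omega>"
    by (subst nn_integral_cmult_indicator) auto
  also have "\<dots> < \<infinity>" using ab by (simp add: \<Omega> ennreal_mult_less_top)
  finally have fin: "(\<integral>\<^sup>+z. ?f z \<partial>(lborel \<Otimes>\<^sub>M lborel)) < \<infinity>" by (simp only: lborel_prod)
  have "(\<integral>\<^sup>+t. (\<integral>\<^sup>+x. ?f (t, x) \<partial>lborel) \<partial>lborel) \<noteq> \<infinity>"
    using lborel.nn_integral_fst[OF m] fin by simp
  then have "AE t in lborel. (\<integral>\<^sup>+x. ?f (t, x) \<partial>lborel) \<noteq> \<infinity>"
    using m by (intro nn_integral_PInf_AE lborel.borel_measurable_nn_integral_fst) auto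
  then show ?thesis
  proof eventually_elim
    case (elim t)
    have "(\<integral>\<^sup>+x. ?f (t, x) \<partial>lborel) = (\<integral>\<^sup>+x\<in>\<Omega>. ennreal (u t x * (uxx t x)\<^sup>2) \<partial>lborel)" if "t \<in> {0<..<T}"
      using that by (intro nn_integral_cong) (auto simp: indicator_def)
    then show ?case using elim by (auto simp: top.not_eq_extremum)
  qed
qed

end

section \<open>The production bound along a solution\<close>

context film
begin

lemma sections_measurable:
  "(\<lambda>x. indicator Pos (t, x) * uxx t x) \<in> borel_measurable borel"
  "(\<lambda>x. indicator Pos (t, x) * uxxx t x) \<in> borel_measurable borel"
  "(\<lambda>x. indicator Q (t, x) * ux t x) \<in> borel_measurable borel"
  using derivatives_measurable[THEN borel_measurable_section, of t] by simp_all

text \<open>Almost every time slice is turned into a \<open>profile\<close>: \<open>ux\<close> is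
  replaced by the classical derivative v, \<open>uxx\<close> by its continuous representative w on
  {u > 0}, and \<open>uxxx\<close> is kept. The bound is stated where \<eta> t \<noteq> 0 because
  \<open>T_eps\<close> is only locally integrable in space-time, so the integrability of its slices
  is known only there.\<close>

lemma production_lower_bound_ae:
  assumes h: "test_fun \<Omega> h" "\<And>x. 0 \<le> h x" and \<delta>: "0 < \<delta>" "\<delta> \<le> 1"
    and c0: "\<And>x. (h x)^4 \<le> c0" and c1: "\<And>x. \<bar>deriv h x\<bar> \<le> c1"
    and c2: "\<And>x. \<bar>deriv (deriv (\<lambda>x. (h x)^4)) x\<bar> \<le> c2"
    and T: "0 < T" and \<eta>: "test_fun {0<..} \<eta>"
  shows "AE t in lborel. t \<in> {0<..<T} \<and> \<eta> t \<noteq> 0 \<longrightarrow>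
    - (417 * c1^4 * \<delta>\<^sup>2 * (\<delta> + M) * (b - a) + \<delta> * (c0 + c2) * (2 * C0)
        + c0 / (8 * \<delta>\<^sup>2) * (\<integral>x. indicator ({0<..<T} \<times> UNIV) (t, x) * dissipation (t, x) \<partial>lborel))
     \<le> (LINT x:\<Omega>|lborel. T_eps u ux uxxx t x * (h x)^4)"
proof -
  define \<phi> where "\<phi> x = (h x)^4" for x
  have \<phi>: "test_fun \<Omega> \<phi>"
    unfolding \<phi>_def using test_fun_power[OF h(1), of 4] by (simp)
  note \<phi>m[measurable] = test_fun_borel[OF \<phi>]
  have locT: "loc_integrable ({0<..} \<times> \<Omega>) (\<lambda>(t, x). T_eps u ux uxxx t x)"
    using evolution by (simp add: distr_eq_def)
  have ae1: "AE t in lborel. \<eta> t \<noteq> 0 \<longrightarrow> set_integrable lborel \<Omega> (\<lambda>x. T_eps u ux uxxx t x * \<phi> x)"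
    by (rule tensor_Fubini(3)[OF locT \<eta> \<phi>])
  have ae2: "AE t in lborel. integrable lborel (\<lambda>x. indicator ({0<..<T} \<times> UNIV) (t, x) * dissipation (t, x))"
    using dissipation_bound(1)[OF T] by (intro lborel_pair.AE_integrable_fst') (simp add: lborel_prod)
  have ae3: "AE t\<in>{0<..} in lborel. weak_deriv {x\<in>\<Omega>. u t x > 0} (ux t) (uxx t) \<and>
                              weak_deriv {x\<in>\<Omega>. u t x > 0} (uxx t) (uxxx t)"
    using der by (simp add: derivatives_def)
  show ?thesis
    using ae1 ae2 ae3 entropy_production_finite[OF T] C1 T_formula
  proof eventually_elim
    case (elim t)
    show ?case
    proof (intro impI, elim conjE)
      assume t: "t \<in> {0<..<T}" "\<eta> t \<noteq> 0"
      then have t0: "0 < t" by simp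
      have iT: "set_integrable lborel \<Omega> (\<lambda>x. T_eps u ux uxxx t x * \<phi> x)" using elim(1) t by simp
      have iD: "integrable lborel (\<lambda>x. indicator ({0<..<T} \<times> UNIV) (t, x) * dissipation (t, x))" by (rule elim(2))
      let ?P = "{x\<in>\<Omega>. u t x > 0}"
      have w1: "weak_deriv ?P (ux t) (uxx t)" and w2: "weak_deriv ?P (uxx t) (uxxx t)"
        using elim(3) t0 by auto
      have fin: "(\<integral>\<^sup>+x\<in>\<Omega>. ennreal (u t x * (uxx t x)\<^sup>2) \<partial>lborel) < \<infinity>" using elim(4) t by simp
      obtain v where v: "continuous_on {a..b} v"
        "\<And>x. x \<in> {a..b} \<Longrightarrow> (u t has_real_derivative v x) (at x within {a..b})"
        using elim(5) t0 by (auto simp: closure_\<Omega>)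
      have form: "(LINT x:\<Omega>|lborel. T_eps u ux uxxx t x * \<phi> x)
           = (LINT x:\<Omega>|lborel. u t x * (uxx t x)\<^sup>2 * \<phi> x)
             - 5 / 6 * (LINT x:\<Omega>|lborel. (ux t x) ^ 3 * deriv \<phi> x)
             - 1 / 2 * (LINT x:\<Omega>|lborel. u t x * (ux t x)\<^sup>2 * deriv (deriv \<phi>) x)"
        using elim(6) t0 test_fun_smooth[OF \<phi>] by simp
      have uD: "(u t has_real_derivative v x) (at x)" if "x \<in> \<Omega>" for x
        using v(2)[of x] that at_within_Icc_at[of a x b] by (auto simp: \<Omega>)
      have vc: "continuous_on \<Omega> v" by (rule continuous_on_subset[OF v(1)]) (auto simp: \<Omega>)
      have uc: "continuous_on \<Omega> (u t)"
        by (rule continuous_on_subset[OF u_cont_x[of t]]) (use t0 in \<open>auto simp: \<Omega>\<close>)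
      have acu: "ac_on \<Omega> (u t) v" by (rule ac_on_C1[OF open_\<Omega> uD vc])
      have "weak_deriv \<Omega> (u t) v"
        unfolding weak_deriv_def
        using ac_on_imp_weak[OF open_\<Omega> acu] loc_integrable_continuous[OF uc] loc_integrable_continuous[OF vc] by blast
      moreover have "weak_deriv \<Omega> (u t) (ux t)" using der t0 by (auto simp: derivatives_def)
      ultimately have uxv: "AE x in lborel. x \<in> \<Omega> \<longrightarrow> v x = ux t x"
        by (rule weak_deriv_unique[OF open_\<Omega>])
      have openP: "open ?P"
      proof -
        have "open (u t -` {0<..} \<inter> \<Omega>)"
          using continuous_on_open_vimage[OF open_\<Omega>] uc open_greaterThan by blast
        moreover have "u t -` {0<..} \<inter> \<Omega> = ?P" by auto
        ultimately show ?thesis by simp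
      qed
      have Pm[measurable]: "?P \<in> sets borel" using openP by simp
      have vcP: "continuous_on ?P v" and ucP: "continuous_on ?P (u t)"
        using vc uc by (auto intro: continuous_on_subset)
      have "AE x in lborel. x \<in> ?P \<longrightarrow> v x = ux t x" using uxv by eventually_elim auto
      then have acv: "ac_on ?P v (uxx t)" by (rule weak_deriv_ac_on[OF openP w1 vcP])
      \<comment> \<open>\<open>uxx\<close> is determined only up to null sets, whereas integration
        by parts needs the representative that is a primitive of \<open>uxxx\<close>.\<close>
      obtain w where w: "AE x in lborel. x \<in> ?P \<longrightarrow> w x = uxx t x" "ac_on ?P w (uxxx t)" "continuous_on ?P w"
        by (rule weak_deriv_representative[OF openP w2])
      have "AE x in lborel. x \<in> ?P \<longrightarrow> uxx t x = w x" using w(1) by eventually_elim auto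
      then have acw: "ac_on ?P v w"
        by (rule ac_on_cong[OF acv refl]) (rule loc_integrable_continuous[OF w(3)])
      interpret profile \<Omega> "u t" v w "uxxx t"
        by unfold_locales
          (use open_\<Omega> uD vc u_nonneg'[of t] t0 acw w(2) w2 in \<open>auto simp: weak_deriv_def\<close>)
      have Q: "indicator Q (t, x) = (indicator \<Omega> x :: real)" for x
        using t0 by (auto simp: Q_def indicator_def)
      have Pos: "indicator Pos (t, x) = (indicator ?P x :: real)" for x
        using t0 by (auto simp: Pos_def indicator_def)
      note sm[measurable] = sections_measurable[of t, unfolded Q Pos]
      have cm[measurable]: "(\<lambda>x. indicator ?P x * f x) \<in> borel_measurable borel" if "continuous_on ?P f" for f :: "real \<Rightarrow> real"
        using borel_measurable_continuous_on_indicator[OF Pm that] by simp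
      have cO[measurable]: "(\<lambda>x. indicator \<Omega> x * f x) \<in> borel_measurable borel" if "continuous_on \<Omega> f" for f :: "real \<Rightarrow> real"
        using borel_measurable_continuous_on_indicator[OF \<Omega>_borel that] by simp
      note [measurable] = cm[OF ucP] cm[OF vcP] cm[OF w(3)] cO[OF uc] cO[OF vc]
      have uww: "AE x in lborel. indicator \<Omega> x * (u t x * (uxx t x)\<^sup>2) = indicator ?P x * (u t x * (w x)\<^sup>2)"
        using w(1)
      proof eventually_elim
        case (elim x)
        then show ?case using u_nonneg'[of t x] t0 by (cases "x \<in> \<Omega>"; cases "u t x = 0") (auto simp: indicator_def)
      qed
      have i1: "set_integrable lborel ?P (\<lambda>x. u t x * (w x)\<^sup>2)"
        unfolding set_integrable_def
      proof (rule integrableI_nonneg)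
        show "(\<lambda>x. indicator ?P x *\<^sub>R (u t x * (w x)\<^sup>2)) \<in> borel_measurable lborel"
          using cm[OF continuous_on_mult[OF ucP continuous_on_power[OF w(3), of 2]]] by simp
        show "AE x in lborel. 0 \<le> indicator ?P x *\<^sub>R (u t x * (w x)\<^sup>2)"
          by (auto simp: indicator_def)
        have "(\<integral>\<^sup>+x. ennreal (indicator ?P x *\<^sub>R (u t x * (w x)\<^sup>2)) \<partial>lborel)
            = (\<integral>\<^sup>+x\<in>\<Omega>. ennreal (u t x * (uxx t x)\<^sup>2) \<partial>lborel)"
          by (rule nn_integral_cong_AE) (use uww in \<open>eventually_elim, auto simp: indicator_def split: if_splits\<close>)
        then show "(\<integral>\<^sup>+x. ennreal (indicator ?P x *\<^sub>R (u t x * (w x)\<^sup>2)) \<partial>lborel) < \<infinity>"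
          using fin by simp
      qed
      \<comment> \<open>Up to the sign and a null set this is \<open>T_eps\<close> times \<phi>,
        whose slice is integrable by Fubini's theorem.\<close>
      have i2: "set_integrable lborel ?P (\<lambda>x. u t x * v x * uxxx t x * (h x)^4)"
      proof -
        have "integrable lborel (\<lambda>x. indicator \<Omega> x *\<^sub>R (- (T_eps u ux uxxx t x * \<phi> x)))"
          using iT by (simp add: set_integrable_def)
        then show ?thesis
          unfolding set_integrable_def
        proof (rule integrable_cong_AE_imp)
          have "(\<lambda>x. (indicator ?P x * u t x) * (indicator ?P x * v x) * (indicator ?P x * uxxx t x) * \<phi> x) \<in> borel_measurable borel"
            by measurable
          moreover have "(\<lambda>x. (indicator ?P x * u t x) * (indicator ?P x * v x) * (indicator ?P x * uxxx t x) * \<phi> x)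
              = (\<lambda>x. indicator ?P x *\<^sub>R (u t x * v x * uxxx t x * (h x)^4))"
            by (auto simp: fun_eq_iff indicator_def \<phi>_def)
          ultimately show "(\<lambda>x. indicator ?P x *\<^sub>R (u t x * v x * uxxx t x * (h x)^4)) \<in> borel_measurable lborel"
            by simp
          show "AE x in lborel. indicator \<Omega> x *\<^sub>R (- (T_eps u ux uxxx t x * \<phi> x))
              = indicator ?P x *\<^sub>R (u t x * v x * uxxx t x * (h x)^4)"
            using uxv
          proof eventually_elim
            case (elim x)
            then show ?case using u_nonneg'[of t x] t0
              by (cases "x \<in> \<Omega>"; cases "u t x = 0") (auto simp: indicator_def T_eps_def \<phi>_def)
          qed
        qed
      qed
      have D: "indicator ({0<..<T} \<times> UNIV) (t, x) * dissipation (t, x) = indicator ?P x * (mobility n \<epsilon> (u t x) * (uxxx t x)\<^sup>2)" for x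
        using t by (auto simp: dissipation_def Pos_def indicator_def)
      have le: "(u t x)^3 * (uxxx t x)\<^sup>2 \<le> mobility n \<epsilon> (u t x) * (uxxx t x)\<^sup>2" for x
        by (intro mult_right_mono) (auto simp: mobility_def)
      have i3: "set_integrable lborel ?P (\<lambda>x. (u t x)^3 * (uxxx t x)\<^sup>2)"
        unfolding set_integrable_def
      proof (rule Bochner_Integration.integrable_bound[OF iD[unfolded D]])
        have "(\<lambda>x. (indicator ?P x * u t x)^3 * (indicator ?P x * uxxx t x)\<^sup>2) \<in> borel_measurable borel"
          by measurable
        moreover have "(\<lambda>x. (indicator ?P x * u t x)^3 * (indicator ?P x * uxxx t x)\<^sup>2)
            = (\<lambda>x. indicator ?P x *\<^sub>R ((u t x)^3 * (uxxx t x)\<^sup>2))"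
          by (auto simp: fun_eq_iff indicator_def)
        ultimately show "(\<lambda>x. indicator ?P x *\<^sub>R ((u t x)^3 * (uxxx t x)\<^sup>2)) \<in> borel_measurable lborel" by simp
        show "AE x in lborel. norm (indicator ?P x *\<^sub>R ((u t x)^3 * (uxxx t x)\<^sup>2))
            \<le> norm (indicator ?P x * (mobility n \<epsilon> (u t x) * (uxxx t x)\<^sup>2))"
        proof (rule AE_I2)
          fix x show "norm (indicator ?P x *\<^sub>R ((u t x)^3 * (uxxx t x)\<^sup>2))
            \<le> norm (indicator ?P x * (mobility n \<epsilon> (u t x) * (uxxx t x)\<^sup>2))"
            using le[of x] mobility_nonneg[of "u t x"] by (cases "x \<in> ?P") (auto simp: abs_mult)
        qed
      qed
      have i4: "set_integrable lborel \<Omega> (\<lambda>x. (v x)\<^sup>2)"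
        by (rule cont_integrable) (intro continuous_intros v(1))
      have v2: "(LINT x:\<Omega>|lborel. (v x)\<^sup>2) \<le> 2 * C0"
      proof -
        have i: "integrable lborel (\<lambda>x. indicator \<Omega> x * ((v x)\<^sup>2 / 2))"
          using set_integrable_divide[OF i4, of 2] by (simp add: set_integrable_def)
        have "ennreal (\<integral>x. indicator \<Omega> x * ((v x)\<^sup>2 / 2) \<partial>lborel) = (\<integral>\<^sup>+x. ennreal (indicator \<Omega> x * ((v x)\<^sup>2 / 2)) \<partial>lborel)"
          using i by (intro nn_integral_eq_integral[symmetric]) auto
        also have "\<dots> = (\<integral>\<^sup>+x\<in>\<Omega>. ennreal ((ux t x)\<^sup>2 / 2) \<partial>lborel)"
          by (rule nn_integral_cong_AE) (use uxv in \<open>eventually_elim, auto simp: indicator_def\<close>)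
        also have "\<dots> \<le> ennreal C0" by (rule gradient_bound[OF t0])
        finally have "(\<integral>x. indicator \<Omega> x * ((v x)\<^sup>2 / 2) \<partial>lborel) \<le> C0" using C0 by simp
        then show ?thesis by (simp add: set_lebesgue_integral_def)
      qed
      have u3: "(LINT x:?P|lborel. (u t x)^3 * (uxxx t x)\<^sup>2)
          \<le> (\<integral>x. indicator ({0<..<T} \<times> UNIV) (t, x) * dissipation (t, x) \<partial>lborel)"
        unfolding set_lebesgue_integral_def D
        using i3 iD[unfolded D] le by (intro integral_mono) (auto simp: set_integrable_def indicator_def)
      have e1: "(LINT x:\<Omega>|lborel. u t x * (uxx t x)\<^sup>2 * \<phi> x) = (LINT x:\<Omega>|lborel. u t x * (w x)\<^sup>2 * \<phi> x)"
        unfolding set_lebesgue_integral_def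
      proof (rule integral_cong_AE)
        have "(\<lambda>x. (indicator ?P x * u t x) * (indicator ?P x * uxx t x)\<^sup>2 * \<phi> x) \<in> borel_measurable borel"
          "(\<lambda>x. (indicator ?P x * u t x) * (indicator ?P x * w x)\<^sup>2 * \<phi> x) \<in> borel_measurable borel"
          by measurable
        moreover have "(\<lambda>x. (indicator ?P x * u t x) * (indicator ?P x * f x)\<^sup>2 * \<phi> x)
            = (\<lambda>x. indicator \<Omega> x *\<^sub>R (u t x * (f x)\<^sup>2 * \<phi> x))" for f :: "real \<Rightarrow> real"
        proof
          fix x show "(indicator ?P x * u t x) * (indicator ?P x * f x)\<^sup>2 * \<phi> x = indicator \<Omega> x *\<^sub>R (u t x * (f x)\<^sup>2 * \<phi> x)"
            using u_nonneg'[of t x] t0 by (cases "x \<in> \<Omega>"; cases "u t x = 0") (auto simp: indicator_def)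
        qed
        ultimately show "(\<lambda>x. indicator \<Omega> x *\<^sub>R (u t x * (uxx t x)\<^sup>2 * \<phi> x)) \<in> borel_measurable lborel"
          "(\<lambda>x. indicator \<Omega> x *\<^sub>R (u t x * (w x)\<^sup>2 * \<phi> x)) \<in> borel_measurable lborel"
          by auto
        show "AE x in lborel. indicator \<Omega> x *\<^sub>R (u t x * (uxx t x)\<^sup>2 * \<phi> x) = indicator \<Omega> x *\<^sub>R (u t x * (w x)\<^sup>2 * \<phi> x)"
          using w(1)
        proof eventually_elim
          case (elim x)
          then show ?case using u_nonneg'[of t x] t0
            by (cases "x \<in> \<Omega>"; cases "u t x = 0") (auto simp: indicator_def)
        qed
      qed
      have toux: "(LINT x:\<Omega>|lborel. g x * (ux t x)^k * \<psi> x) = (LINT x:\<Omega>|lborel. g x * (v x)^k * \<psi> x)"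
        if g: "continuous_on \<Omega> g" and \<psi>: "test_fun \<Omega> \<psi>" and k: "k \<noteq> 0" for g \<psi> k
        unfolding set_lebesgue_integral_def
      proof (rule integral_cong_AE)
        note [measurable] = cO[OF g] test_fun_borel[OF \<psi>]
        have "(\<lambda>x. (indicator \<Omega> x * g x) * (indicator \<Omega> x * ux t x)^k * \<psi> x) \<in> borel_measurable borel"
          "(\<lambda>x. (indicator \<Omega> x * g x) * (indicator \<Omega> x * v x)^k * \<psi> x) \<in> borel_measurable borel"
          by measurable
        moreover have "(\<lambda>x. (indicator \<Omega> x * g x) * (indicator \<Omega> x * f x)^k * \<psi> x) = (\<lambda>x. indicator \<Omega> x *\<^sub>R (g x * (f x)^k * \<psi> x))" for f :: "real \<Rightarrow> real"
          using k by (auto simp: fun_eq_iff indicator_def)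
        ultimately show "(\<lambda>x. indicator \<Omega> x *\<^sub>R (g x * (ux t x)^k * \<psi> x)) \<in> borel_measurable lborel"
          "(\<lambda>x. indicator \<Omega> x *\<^sub>R (g x * (v x)^k * \<psi> x)) \<in> borel_measurable lborel"
          by auto
        show "AE x in lborel. indicator \<Omega> x *\<^sub>R (g x * (ux t x)^k * \<psi> x) = indicator \<Omega> x *\<^sub>R (g x * (v x)^k * \<psi> x)"
          using uxv by eventually_elim (auto simp: indicator_def)
      qed
      have e2: "(LINT x:\<Omega>|lborel. (ux t x) ^ 3 * deriv \<phi> x) = (LINT x:\<Omega>|lborel. (v x) ^ 3 * deriv \<phi> x)"
        using toux[of "\<lambda>_. 1" "deriv \<phi>" 3] test_fun_deriv[OF \<phi>] by simp
      have e3: "(LINT x:\<Omega>|lborel. u t x * (ux t x)\<^sup>2 * deriv (deriv \<phi>) x) = (LINT x:\<Omega>|lborel. u t x * (v x)\<^sup>2 * deriv (deriv \<phi>) x)"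
        using toux[of "u t" "deriv (deriv \<phi>)" 2] uc test_fun_deriv[OF test_fun_deriv[OF \<phi>]] by simp
      have c00: "0 \<le> c0" "0 \<le> c2" using c0[of 0] c2[of 0] zero_le_power[OF h(2)[of 0], of 4] by linarith+
      have "\<delta> * (c0 + c2) * (LINT x:\<Omega>|lborel. (v x)\<^sup>2) \<le> \<delta> * (c0 + c2) * (2 * C0)"
        using v2 \<delta> c00 by (intro mult_left_mono) auto
      moreover have "c0 / (8 * \<delta>\<^sup>2) * (LINT x:?P|lborel. (u t x)^3 * (uxxx t x)\<^sup>2)
          \<le> c0 / (8 * \<delta>\<^sup>2) * (\<integral>x. indicator ({0<..<T} \<times> UNIV) (t, x) * dissipation (t, x) \<partial>lborel)"
        using u3 c00 by (intro mult_left_mono) auto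
      moreover note production_lower_bound[OF h \<delta> \<Omega> ab u_le_M[OF t0] c0 c1 c2 i1 i2 i3 i4]
      ultimately show "- (417 * c1^4 * \<delta>\<^sup>2 * (\<delta> + M) * (b - a) + \<delta> * (c0 + c2) * (2 * C0)
        + c0 / (8 * \<delta>\<^sup>2) * (\<integral>x. indicator ({0<..<T} \<times> UNIV) (t, x) * dissipation (t, x) \<partial>lborel))
         \<le> (LINT x:\<Omega>|lborel. T_eps u ux uxxx t x * (h x)^4)"
        using form e1 e2 e3 unfolding \<phi>_def[abs_def] by linarith
    qed
  qed
qed

end

section \<open>The increment of the localised integral of \<open>B_eps\<close> over a time
  interval\<close>

context film
begin

lemma B_eps_u_le: "0 < t \<Longrightarrow> x \<in> \<Omega> \<Longrightarrow> B_eps n \<epsilon> (u t x) \<le> 1 + (B n 1 + ln M) / \<bar>ln \<epsilon>\<bar>"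
  using B_eps_le[OF n \<epsilon> u_nonneg' u_le_M M_ge_1] by simp

lemma rho_cont_x: "0 \<le> t \<Longrightarrow> continuous_on \<Omega> (\<lambda>x. B_eps n \<epsilon> (u t x))"
  by (rule continuous_on_compose2[OF B_eps_continuous[OF n \<epsilon>(1)] continuous_on_subset[OF u_cont_x]])
    (auto simp: \<Omega> intro!: u_nonneg'[unfolded \<Omega>])

lemma rho_cont_t: "x \<in> \<Omega> \<Longrightarrow> continuous_on {0<..} (\<lambda>t. B_eps n \<epsilon> (u t x))"
proof -
  assume x: "x \<in> \<Omega>"
  have "continuous_on {0<..} (\<lambda>t::real. (t, x))"
    by (intro continuous_on_Pair continuous_on_const continuous_on_id)
  then have "continuous_on {0<..} (\<lambda>t. u t x)"
  proof -
    have "(\<lambda>t::real. (t, x)) ` {0<..} \<subseteq> {0..} \<times> closure \<Omega>" using x closure_subset[of \<Omega>] by auto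
    from continuous_on_compose2[OF u_cont \<open>continuous_on {0<..} (\<lambda>t::real. (t, x))\<close> this] show ?thesis by simp
  qed
  then show ?thesis
    by (rule continuous_on_compose2[OF B_eps_continuous[OF n \<epsilon>(1)]]) (use x u_nonneg' in auto)
qed

text \<open>Continuity in t is what allows an inequality between distributions in time to be read at
  individual times. It follows by dominated convergence from the uniform bound on
  \<open>B_eps\<close>.\<close>

lemma rho_mass_continuous:
  assumes \<phi>: "test_fun \<Omega> \<phi>"
  shows "continuous_on {0<..} (\<lambda>t. LINT x:\<Omega>|lborel. B_eps n \<epsilon> (u t x) * \<phi> x)"
  unfolding continuous_on_sequentially comp_def
proof (intro allI ballI impI, elim conjE)
  fix s :: "nat \<Rightarrow> real" and t assume t: "t \<in> {0<..}" and s: "\<forall>n. s n \<in> {0<..}" "s \<longlonglongrightarrow> t"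
  obtain C where C: "\<And>x. \<bar>\<phi> x\<bar> \<le> C" using test_fun_bounded[OF \<phi>] by blast
  define L where "L = 1 + (B n 1 + ln M) / \<bar>ln \<epsilon>\<bar>"
  have m: "(\<lambda>x. indicator \<Omega> x *\<^sub>R (B_eps n \<epsilon> (u r x) * \<phi> x)) \<in> borel_measurable lborel" if "0 < r" for r
    using borel_measurable_continuous_on_indicator[OF \<Omega>_borel continuous_on_mult[OF rho_cont_x[of r]
          smooth_continuous_on[OF test_fun_smooth[OF \<phi>], of \<Omega>]]] that by simp
  show "(\<lambda>k. LINT x:\<Omega>|lborel. B_eps n \<epsilon> (u (s k) x) * \<phi> x) \<longlonglongrightarrow> (LINT x:\<Omega>|lborel. B_eps n \<epsilon> (u t x) * \<phi> x)"
    unfolding set_lebesgue_integral_def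
  proof (rule integral_dominated_convergence)
    show "integrable lborel (\<lambda>x. indicator \<Omega> x *\<^sub>R (L * C))"
      using const_integrable by (simp add: set_integrable_def)
    show "AE x in lborel. (\<lambda>k. indicator \<Omega> x *\<^sub>R (B_eps n \<epsilon> (u (s k) x) * \<phi> x)) \<longlonglongrightarrow> indicator \<Omega> x *\<^sub>R (B_eps n \<epsilon> (u t x) * \<phi> x)"
    proof (rule AE_I2)
      fix x
      show "(\<lambda>k. indicator \<Omega> x *\<^sub>R (B_eps n \<epsilon> (u (s k) x) * \<phi> x)) \<longlonglongrightarrow> indicator \<Omega> x *\<^sub>R (B_eps n \<epsilon> (u t x) * \<phi> x)"
      proof (cases "x \<in> \<Omega>")
        case True
        have "(\<lambda>k. B_eps n \<epsilon> (u (s k) x)) \<longlonglongrightarrow> B_eps n \<epsilon> (u t x)"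
          using rho_cont_t[OF True] t s unfolding continuous_on_sequentially comp_def by blast
        then show ?thesis by (intro tendsto_intros)
      qed simp
    qed
    show "AE x in lborel. norm (indicator \<Omega> x *\<^sub>R (B_eps n \<epsilon> (u (s k) x) * \<phi> x)) \<le> indicator \<Omega> x *\<^sub>R (L * C)" for k
    proof (rule AE_I2)
      fix x
      have "\<bar>B_eps n \<epsilon> (u (s k) x)\<bar> * \<bar>\<phi> x\<bar> \<le> L * C" if "x \<in> \<Omega>"
        using B_eps_u_le[of "s k" x] s that C[of x] B_eps_nonneg[of n \<epsilon> "u (s k) x"]
        by (intro mult_mono) (auto simp: L_def intro: order_trans)
      then show "norm (indicator \<Omega> x *\<^sub>R (B_eps n \<epsilon> (u (s k) x) * \<phi> x)) \<le> indicator \<Omega> x *\<^sub>R (L * C)"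
        by (auto simp: indicator_def abs_mult)
    qed
  qed (use m t s in auto)
qed

text \<open>Young's inequality with weight \<delta> makes the quadratic bound for R linear: a
  constant of order \<delta> plus the dissipation divided by \<delta>. Both can be integrated
  directly against a bounded test function.\<close>

lemma R_eps_le:
  assumes \<delta>: "0 < \<delta>" and t: "0 < t" and x: "x \<in> \<Omega>"
  shows "\<bar>R_eps n \<epsilon> u uxxx t x\<bar> \<le> \<delta> / 2 + (2 * M + 9 / n\<^sup>2) / (2 * \<delta>) * dissipation (t, x)"
proof (cases "u t x = 0")
  case True
  have "0 \<le> (2 * M + 9 / n\<^sup>2) / (2 * \<delta>) * dissipation (t, x)"
    using M_ge_1 \<delta> dissipation_nonneg by (intro mult_nonneg_nonneg) auto
  \<comment> \<open>The factor u annihilates the flux here, whatever value \<open>deriv\<close> has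
    at 0.\<close>
  moreover have "R_eps n \<epsilon> u uxxx t x = 0" using True by (simp add: R_eps_def)
  ultimately show ?thesis using \<delta> by simp
next
  case False
  then have u: "0 < u t x" using u_nonneg'[of t x] t x by simp
  define R where "R = R_eps n \<epsilon> u uxxx t x"
  define C where "C = 2 * M + 9 / n\<^sup>2"
  have "R\<^sup>2 \<le> C * dissipation (t, x)"
    using R_eps_square_le[of n \<epsilon> u t x M uxxx] n \<epsilon> u_le_M[OF t x] t x u
    by (simp add: R_def C_def dissipation_def Pos_def)
  moreover have "2 * \<delta> * \<bar>R\<bar> \<le> \<delta>\<^sup>2 + R\<^sup>2"
    using zero_le_power2[of "\<delta> - \<bar>R\<bar>"] by (simp add: power2_diff)
  ultimately have "2 * \<delta> * \<bar>R\<bar> \<le> \<delta>\<^sup>2 + C * dissipation (t, x)" by linarith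
  then have "\<bar>R\<bar> \<le> (\<delta>\<^sup>2 + C * dissipation (t, x)) / (2 * \<delta>)"
    using \<delta> by (simp add: field_simps)
  also have "\<dots> = \<delta> / 2 + C / (2 * \<delta>) * dissipation (t, x)"
    using \<delta> by (simp add: add_divide_distrib power2_eq_square)
  finally show ?thesis by (simp add: R_def C_def)
qed

text \<open>The evolution equation is tested with \<eta>(t) h(x)^4; the production is bounded from
  below at each time and the flux in absolute value. The length t + 1 - s is that of the window
  containing the support of \<eta>. The parameter \<epsilon> enters only through C0 / |ln
  \<epsilon>|, the bound for the total dissipation.\<close>

lemma increment_lower_bound:
  assumes h: "test_fun \<Omega> h" "\<And>x. 0 \<le> h x" and \<delta>: "0 < \<delta>" "\<delta> \<le> 1"
    and c0: "\<And>x. (h x)^4 \<le> c0" and c1: "\<And>x. \<bar>deriv h x\<bar> \<le> c1"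
    and c2: "\<And>x. \<bar>deriv (deriv (\<lambda>x. (h x)^4)) x\<bar> \<le> c2"
    and c3: "\<And>x. \<bar>deriv (\<lambda>x. (h x)^4) x\<bar> \<le> c3"
    and st: "0 < s" "s < t"
  shows "- ((417 * c1^4 * \<delta>\<^sup>2 * (\<delta> + M) * (b - a) + \<delta> * (c0 + c2) * (2 * C0)) * (t + 1 - s)
        + c0 / (8 * \<delta>\<^sup>2) * (C0 / \<bar>ln \<epsilon>\<bar>)
        + (c3 * \<delta> / 2 * ((t + 1 - s) * (b - a)) + c3 * (2 * M + 9 / n\<^sup>2) / (2 * \<delta>) * (C0 / \<bar>ln \<epsilon>\<bar>)))
     \<le> (LINT x:\<Omega>|lborel. B_eps n \<epsilon> (u t x) * (h x)^4) - (LINT x:\<Omega>|lborel. B_eps n \<epsilon> (u s x) * (h x)^4)"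
proof -
  define \<phi> where "\<phi> = (\<lambda>x. (h x)^4)"
  have \<phi>: "test_fun \<Omega> \<phi>"
    unfolding \<phi>_def using test_fun_power[OF h(1), of 4] by (simp)
  define m where "m r = (LINT x:\<Omega>|lborel. B_eps n \<epsilon> (u r x) * \<phi> x)" for r
  define A1 where "A1 = 417 * c1^4 * \<delta>\<^sup>2 * (\<delta> + M) * (b - a) + \<delta> * (c0 + c2) * (2 * C0)"
  define CR where "CR = 2 * M + 9 / n\<^sup>2"
  \<comment> \<open>The window of \<eta> reaches up to t + 1, which has to lie inside the open
    interval on which the dissipation is integrated.\<close>
  define T where "T = t + 2"
  have T: "0 < T" using st by (simp add: T_def)
  have c00: "0 \<le> c0" using c0[of 0] zero_le_power[OF h(2)[of 0], of 4] by linarith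
  have c10: "0 \<le> c1" using c1[of 0] by linarith
  have c20: "0 \<le> c2" using c2[of 0] by linarith
  have c30: "0 \<le> c3" using c3[of 0] by linarith
  have CR0: "0 \<le> CR" using M_ge_1 by (simp add: CR_def)
  have A10: "0 \<le> A1" using c00 c10 c20 \<delta> M_ge_1 C0 ab by (auto simp: A1_def intro!: add_nonneg_nonneg mult_nonneg_nonneg)
  have loc: "loc_integrable ({0<..} \<times> \<Omega>) (\<lambda>(t, x). B_eps n \<epsilon> (u t x))"
    "loc_integrable ({0<..} \<times> \<Omega>) (\<lambda>(t, x). T_eps u ux uxxx t x)"
    "loc_integrable ({0<..} \<times> \<Omega>) (\<lambda>(t, x). R_eps n \<epsilon> u uxxx t x)"
    and ev: "\<And>\<psi>. test_fun ({0<..} \<times> \<Omega>) \<psi> \<Longrightarrow>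
        - (LINT (t, x):{0<..} \<times> \<Omega>|lborel. B_eps n \<epsilon> (u t x) * dt \<psi> (t, x))
        = (LINT (t, x):{0<..} \<times> \<Omega>|lborel. T_eps u ux uxxx t x * \<psi> (t, x))
          - (LINT (t, x):{0<..} \<times> \<Omega>|lborel. R_eps n \<epsilon> u uxxx t x * dx \<psi> (t, x))"
    using evolution by (auto simp: distr_eq_def)
  let ?D = "\<lambda>z. indicator ({0<..<T} \<times> UNIV) z * dissipation z"
  have D0: "0 \<le> ?D z" for z using dissipation_nonneg[of z] by simp
  have Dpair: "integrable (lborel \<Otimes>\<^sub>M lborel) ?D" using dissipation_bound(1)[OF T] by (simp add: lborel_prod)
  define D where "D r = (\<integral>x. ?D (r, x) \<partial>lborel)" for r
  have Di: "integrable lborel D" unfolding D_def by (rule lborel_pair.integrable_fst'[OF Dpair])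
  have D': "(\<integral>r. D r \<partial>lborel) \<le> C0 / \<bar>ln \<epsilon>\<bar>"
    unfolding D_def lborel_pair.integral_fst'[OF Dpair] lborel_prod by (rule dissipation_bound(2)[OF T])
  have Dnn: "0 \<le> D r" for r unfolding D_def using D0 by (intro Bochner_Integration.integral_nonneg) auto
  have "- (A1 * (t + 1 - s) + c0 / (8 * \<delta>\<^sup>2) * (C0 / \<bar>ln \<epsilon>\<bar>)
        + (c3 * \<delta> / 2 * ((t + 1 - s) * (b - a)) + c3 * CR / (2 * \<delta>) * (C0 / \<bar>ln \<epsilon>\<bar>))) \<le> m t - m s"
  proof (rule increment_ge_if_distributional[OF _ st])
    show "continuous_on {0<..} m" unfolding m_def by (rule rho_mass_continuous[OF \<phi>])
    fix \<eta> :: "real \<Rightarrow> real"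
    assume \<eta>: "test_fun {0<..} \<eta>" and \<eta>1: "\<And>r. 0 \<le> \<eta> r \<and> \<eta> r \<le> 1" and \<eta>0: "\<And>r. r \<notin> {s..t + 1} \<Longrightarrow> \<eta> r = 0"
    define \<psi> where "\<psi> = (\<lambda>(t, x). \<eta> t * \<phi> x)"
    have \<psi>: "test_fun ({0<..} \<times> \<Omega>) \<psi>" unfolding \<psi>_def by (rule test_fun_tensor[OF \<eta> \<phi>])
    note d = smooth_tensor(2,3)[OF test_fun_smooth[OF \<eta>] test_fun_smooth[OF \<phi>], folded \<psi>_def]
    define \<tau> where "\<tau> r = (LINT x:\<Omega>|lborel. T_eps u ux uxxx r x * \<phi> x)" for r
    have 1: "(LINT (t, x):{0<..} \<times> \<Omega>|lborel. B_eps n \<epsilon> (u t x) * dt \<psi> (t, x)) = (LINT r:{0<..}|lborel. m r * deriv \<eta> r)"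
    proof -
      have "(LINT (t, x):{0<..} \<times> \<Omega>|lborel. B_eps n \<epsilon> (u t x) * dt \<psi> (t, x)) = (\<integral>r. deriv \<eta> r * m r \<partial>lborel)"
        unfolding d m_def by (rule tensor_Fubini(2)[OF loc(1) test_fun_deriv[OF \<eta>] \<phi>])
      also have "\<dots> = (LINT r:{0<..}|lborel. m r * deriv \<eta> r)"
        unfolding set_lebesgue_integral_def using test_fun_supp(3)[OF test_fun_deriv[OF \<eta>]]
        by (intro Bochner_Integration.integral_cong) (auto simp: indicator_def)
      finally show ?thesis .
    qed
    have 2: "(LINT (t, x):{0<..} \<times> \<Omega>|lborel. T_eps u ux uxxx t x * \<psi> (t, x)) = (\<integral>r. \<eta> r * \<tau> r \<partial>lborel)"
      using tensor_Fubini(2)[OF loc(2) \<eta> \<phi>] by (simp add: \<psi>_def \<tau>_def)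
    have \<tau>i: "integrable lborel (\<lambda>r. \<eta> r * \<tau> r)"
      unfolding \<tau>_def by (rule tensor_Fubini(1)[OF loc(2) \<eta> \<phi>])
    have ii: "integrable lborel (\<lambda>r. indicator {s..t + 1} r :: real)"
      using borel_integrable_compact[of "{s..t+1}" "\<lambda>_. 1::real"] by simp
    have Ti: "- (A1 * (t + 1 - s) + c0 / (8 * \<delta>\<^sup>2) * (C0 / \<bar>ln \<epsilon>\<bar>)) \<le> (\<integral>r. \<eta> r * \<tau> r \<partial>lborel)"
    proof -
      have "- (\<integral>r. A1 * indicator {s..t + 1} r + c0 / (8 * \<delta>\<^sup>2) * D r \<partial>lborel)
          = (\<integral>r. - (A1 * indicator {s..t + 1} r + c0 / (8 * \<delta>\<^sup>2) * D r) \<partial>lborel)"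
        by (rule Bochner_Integration.integral_minus[symmetric])
      also have "\<dots> \<le> (\<integral>r. \<eta> r * \<tau> r \<partial>lborel)"
      proof (rule integral_mono_AE)
        show "integrable lborel (\<lambda>r. - (A1 * indicator {s..t + 1} r + c0 / (8 * \<delta>\<^sup>2) * D r))"
          using ii Di by (intro Bochner_Integration.integrable_minus Bochner_Integration.integrable_add integrable_mult_right)
        show "AE r in lborel. - (A1 * indicator {s..t + 1} r + c0 / (8 * \<delta>\<^sup>2) * D r) \<le> \<eta> r * \<tau> r"
          using production_lower_bound_ae[OF h \<delta> c0 c1 c2 T \<eta>]
        proof eventually_elim
          case (elim r)
          have cD: "0 \<le> c0 / (8 * \<delta>\<^sup>2) * D r" using c00 Dnn[of r] by simp
          show ?case
          proof (cases "\<eta> r = 0")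
            case True
            then show ?thesis using cD A10 by (simp add: indicator_def)
          next
            case False
            then have r: "r \<in> {s..t + 1}" using \<eta>0 by blast
            then have "r \<in> {0<..<T}" using st by (auto simp: T_def)
            then have "- (A1 + c0 / (8 * \<delta>\<^sup>2) * D r) \<le> \<tau> r"
              using elim False by (simp add: A1_def D_def \<tau>_def \<phi>_def)
            then have "\<eta> r * (- (A1 + c0 / (8 * \<delta>\<^sup>2) * D r)) \<le> \<eta> r * \<tau> r"
              using \<eta>1[of r] by (intro mult_left_mono) auto
            moreover have "\<eta> r * (A1 + c0 / (8 * \<delta>\<^sup>2) * D r) \<le> A1 + c0 / (8 * \<delta>\<^sup>2) * D r"
              using \<eta>1[of r] cD A10 by (intro mult_left_le_one_le) auto
            moreover have "indicator {s..t + 1} r = (1 :: real)" using r by simp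
            ultimately show ?thesis by (simp only: mult_minus_right mult_1_right)
          qed
        qed
      qed (rule \<tau>i)
      finally have "- (\<integral>r. A1 * indicator {s..t + 1} r + c0 / (8 * \<delta>\<^sup>2) * D r \<partial>lborel) \<le> (\<integral>r. \<eta> r * \<tau> r \<partial>lborel)" .
      moreover have "(\<integral>r. A1 * indicator {s..t + 1} r + c0 / (8 * \<delta>\<^sup>2) * D r \<partial>lborel)
          = A1 * (t + 1 - s) + c0 / (8 * \<delta>\<^sup>2) * (\<integral>r. D r \<partial>lborel)"
        using ii Di st by simp
      moreover have "c0 / (8 * \<delta>\<^sup>2) * (\<integral>r. D r \<partial>lborel) \<le> c0 / (8 * \<delta>\<^sup>2) * (C0 / \<bar>ln \<epsilon>\<bar>)"
        using D' c00 by (intro mult_left_mono) auto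
      ultimately show ?thesis by linarith
    qed
    let ?R = "\<lambda>z. indicator ({0<..} \<times> \<Omega>) z *\<^sub>R (case z of (t, x) \<Rightarrow> R_eps n \<epsilon> u uxxx t x * dx \<psi> (t, x))"
    let ?S = "{s..t + 1} \<times> \<Omega>"
    have Sm: "emeasure lborel ?S = ennreal ((t + 1 - s) * (b - a))"
    proof -
      have "emeasure (lborel \<Otimes>\<^sub>M lborel) ?S = emeasure lborel {s..t + 1} * emeasure lborel \<Omega>"
        by (rule lborel.emeasure_pair_measure_Times) auto
      then show ?thesis using st ab by (simp add: lborel_prod \<Omega> ennreal_mult)
    qed
    have Sb: "?S \<in> sets borel"
    proof -
      have "?S \<in> sets (borel \<Otimes>\<^sub>M borel)" by (intro pair_measureI) auto
      then show ?thesis by (simp only: borel_prod)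
    qed
    have Si: "integrable lborel (\<lambda>z. indicator ?S z :: real)"
      using Sb Sm by (intro integrable_real_indicator) auto
    have SI: "(\<integral>z. indicator ?S z \<partial>lborel) = (t + 1 - s) * (b - a)"
      using Sm st ab Sb by (simp add: measure_def)
    have Ri: "integrable lborel ?R"
    proof -
      have "set_integrable lborel ({0<..} \<times> \<Omega>) (\<lambda>z. (case z of (t, x) \<Rightarrow> R_eps n \<epsilon> u uxxx t x) * (case z of (t, x) \<Rightarrow> \<eta> t * deriv \<phi> x))"
        by (rule loc_integrable_mult_test[OF loc(3) test_fun_tensor[OF \<eta> test_fun_deriv[OF \<phi>]]])
      then show ?thesis by (simp add: set_integrable_def d split_beta)
    qed
    have "\<bar>\<integral>z. ?R z \<partial>lborel\<bar> \<le> (\<integral>z. \<bar>?R z\<bar> \<partial>lborel)" by (rule integral_abs_bound)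
    also have "\<dots> \<le> (\<integral>z. c3 * \<delta> / 2 * indicator ?S z + c3 * CR / (2 * \<delta>) * ?D z \<partial>lborel)"
    proof (rule integral_mono)
      show "integrable lborel (\<lambda>z. \<bar>?R z\<bar>)" using Ri by (rule integrable_abs)
      show "integrable lborel (\<lambda>z. c3 * \<delta> / 2 * indicator ?S z + c3 * CR / (2 * \<delta>) * ?D z)"
        by (intro Bochner_Integration.integrable_add integrable_mult_right Si dissipation_bound(1)[OF T])
      fix z :: "real \<times> real"
      obtain r x where z: "z = (r, x)" by (cases z)
      have rhs: "0 \<le> c3 * \<delta> / 2 * indicator ?S z + c3 * CR / (2 * \<delta>) * ?D z"
        using c30 CR0 \<delta> by (intro add_nonneg_nonneg mult_nonneg_nonneg[OF _ D0] divide_nonneg_nonneg) auto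
      show "\<bar>?R z\<bar> \<le> c3 * \<delta> / 2 * indicator ?S z + c3 * CR / (2 * \<delta>) * ?D z"
      proof (cases "0 < r \<and> x \<in> \<Omega> \<and> \<eta> r \<noteq> 0")
        case False
        then have "?R z = 0" by (auto simp: z d)
        then show ?thesis using rhs by (simp only: abs_zero)
      next
        case True
        then have r: "r \<in> {s..t + 1}" using \<eta>0 by blast
        then have rT: "r \<in> {0<..<T}" using st by (auto simp: T_def)
        have "\<bar>?R z\<bar> = \<bar>R_eps n \<epsilon> u uxxx r x\<bar> * \<bar>\<eta> r * deriv \<phi> x\<bar>"
          using True by (simp add: z d abs_mult)
        also have "\<dots> \<le> (\<delta> / 2 + CR / (2 * \<delta>) * dissipation (r, x)) * (1 * c3)"
        proof (rule mult_mono)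
          show "\<bar>R_eps n \<epsilon> u uxxx r x\<bar> \<le> \<delta> / 2 + CR / (2 * \<delta>) * dissipation (r, x)"
            unfolding CR_def using R_eps_le[OF \<delta>(1)] True by blast
          show "\<bar>\<eta> r * deriv \<phi> x\<bar> \<le> 1 * c3"
            unfolding abs_mult using \<eta>1[of r] c3[of x] by (intro mult_mono) (auto simp: \<phi>_def)
          show "0 \<le> \<delta> / 2 + CR / (2 * \<delta>) * dissipation (r, x)"
            using \<delta> CR0 dissipation_nonneg by (intro add_nonneg_nonneg mult_nonneg_nonneg divide_nonneg_nonneg) auto
        qed auto
        also have "\<dots> = c3 * \<delta> / 2 * indicator ?S z + c3 * CR / (2 * \<delta>) * ?D z"
          using r rT True by (simp add: z algebra_simps)
        finally show ?thesis .
      qed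
    qed
    also have "\<dots> = c3 * \<delta> / 2 * ((t + 1 - s) * (b - a)) + c3 * CR / (2 * \<delta>) * (\<integral>z. ?D z \<partial>lborel)"
      using Si dissipation_bound(1)[OF T] SI by (simp add: Bochner_Integration.integral_add)
    also have "\<dots> \<le> c3 * \<delta> / 2 * ((t + 1 - s) * (b - a)) + c3 * CR / (2 * \<delta>) * (C0 / \<bar>ln \<epsilon>\<bar>)"
      using dissipation_bound(2)[OF T] c30 CR0 \<delta> by (intro add_left_mono mult_left_mono) auto
    finally have 3: "\<bar>LINT (t, x):{0<..} \<times> \<Omega>|lborel. R_eps n \<epsilon> u uxxx t x * dx \<psi> (t, x)\<bar>
        \<le> c3 * \<delta> / 2 * ((t + 1 - s) * (b - a)) + c3 * CR / (2 * \<delta>) * (C0 / \<bar>ln \<epsilon>\<bar>)"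
      by (simp add: set_lebesgue_integral_def)
    show "- (A1 * (t + 1 - s) + c0 / (8 * \<delta>\<^sup>2) * (C0 / \<bar>ln \<epsilon>\<bar>)
        + (c3 * \<delta> / 2 * ((t + 1 - s) * (b - a)) + c3 * CR / (2 * \<delta>) * (C0 / \<bar>ln \<epsilon>\<bar>)))
        \<le> - (LINT r:{0<..}|lborel. m r * deriv \<eta> r)"
      using ev[OF \<psi>] 1 2 3 Ti by linarith
  qed
  then show ?thesis by (simp add: A1_def CR_def m_def \<phi>_def)
qed

end

text \<open>Each solution comes with its own weak derivative of the initial datum. By uniqueness
  these agree almost everywhere, so the initial energy is one number C0, independent of
  \<epsilon>.\<close>

lemma thin_film_solution_film:
  assumes ab: "a < b" and \<Omega>: "\<Omega> = {a<..<b}" and n: "0 < n" "n < 3" and uin: "in_H1 \<Omega> u_in"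
    and mass: "(LINT x:\<Omega>|lborel. u_in x) = 1"
  obtains C0 where "0 \<le> C0"
    "\<And>\<epsilon> u. 0 < \<epsilon> \<Longrightarrow> \<epsilon> \<le> 1/2 \<Longrightarrow> thin_film_solution \<Omega> n u_in \<epsilon> u \<Longrightarrow> \<exists>ux uxx uxxx. film a b n \<epsilon> C0 \<Omega> u ux uxx uxxx"
proof -
  have op: "open \<Omega>" by (simp add: \<Omega>)
  from uin obtain f where f: "weak_deriv \<Omega> u_in f" "Lp 2 \<Omega> f" by (auto simp: in_H1_def)
  have "(\<lambda>x. indicator \<Omega> x *\<^sub>R \<bar>f x\<bar> powr 2) = (\<lambda>x. indicator \<Omega> x * (f x)\<^sup>2)"
    by (auto simp: fun_eq_iff powr_numeral)
  then have i: "integrable lborel (\<lambda>x. indicator \<Omega> x * (f x)\<^sup>2)"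
    using f(2) by (simp add: Lp_def set_integrable_def)
  define C0 where "C0 = (\<integral>x. indicator \<Omega> x * (f x)\<^sup>2 / 2 \<partial>lborel)"
  have C0: "0 \<le> C0" unfolding C0_def by (rule Bochner_Integration.integral_nonneg) auto
  have e: "(\<integral>\<^sup>+x\<in>\<Omega>. ennreal ((g x)\<^sup>2 / 2) \<partial>lborel) = ennreal C0" if "weak_deriv \<Omega> u_in g" for g
  proof -
    have "AE x in lborel. x \<in> \<Omega> \<longrightarrow> g x = f x" by (rule weak_deriv_unique[OF op that f(1)])
    then have "AE x in lborel. ennreal ((g x)\<^sup>2 / 2) * indicator \<Omega> x = ennreal (indicator \<Omega> x * (f x)\<^sup>2 / 2)"
      by eventually_elim (auto simp: indicator_def)
    then have "(\<integral>\<^sup>+x\<in>\<Omega>. ennreal ((g x)\<^sup>2 / 2) \<partial>lborel) = (\<integral>\<^sup>+x. ennreal (indicator \<Omega> x * (f x)\<^sup>2 / 2) \<partial>lborel)"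
      by (rule nn_integral_cong_AE)
    also have "\<dots> = ennreal C0"
      unfolding C0_def using i by (intro nn_integral_eq_integral) auto
    finally show ?thesis .
  qed
  show thesis
  proof (rule that[OF C0])
    fix \<epsilon> u assume \<epsilon>: "0 < \<epsilon>" "\<epsilon> \<le> 1/2" and sol: "thin_film_solution \<Omega> n u_in \<epsilon> u"
    from sol obtain g ux uxx uxxx where
      "weak_deriv \<Omega> u_in g" and *: "derivatives \<Omega> u ux uxx uxxx"
      "\<forall>t>0. (LINT x:\<Omega>|lborel. u t x) = (LINT x:\<Omega>|lborel. u_in x)"
      "\<forall>t>0.
           (\<integral>\<^sup>+x\<in>\<Omega>. ennreal ((ux t x)\<^sup>2 / 2) \<partial>lborel)
           + (\<integral>\<^sup>+z\<in>{(s, x). 0 < s \<and> s < t \<and> x \<in> \<Omega> \<and> u s x > 0}.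
                (case z of (s, x) \<Rightarrow>
                   ennreal (\<bar>ln \<epsilon>\<bar> * mobility n \<epsilon> (u s x) * (uxxx s x)\<^sup>2)) \<partial>lborel)
           \<le> (\<integral>\<^sup>+x\<in>\<Omega>. ennreal ((g x)\<^sup>2 / 2) \<partial>lborel)"
      "\<forall>t>0.
           (\<integral>\<^sup>+z\<in>{0<..<t} \<times> \<Omega>. (case z of (s, x) \<Rightarrow> ennreal (u s x * (uxx s x)\<^sup>2)) \<partial>lborel)
           + (\<integral>\<^sup>+x\<in>\<Omega>. ennreal (B_eps n \<epsilon> (u 0 x)) \<partial>lborel)
           \<le> (\<integral>\<^sup>+x\<in>\<Omega>. ennreal (B_eps n \<epsilon> (u t x)) \<partial>lborel)"
      "AE t\<in>{0<..} in lborel. \<exists>v. continuous_on (closure \<Omega>) v \<and>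
           (\<forall>x\<in>closure \<Omega>. (u t has_real_derivative v x) (at x within closure \<Omega>)) \<and>
           (\<forall>x\<in>frontier \<Omega>. v x = 0)"
      "distr_eq \<Omega> (\<lambda>t x. B_eps n \<epsilon> (u t x)) (T_eps u ux uxxx) (R_eps n \<epsilon> u uxxx)"
      "AE t\<in>{0<..} in lborel. \<forall>\<phi>. smooth \<phi> \<longrightarrow>
           (LINT x:\<Omega>|lborel. T_eps u ux uxxx t x * \<phi> x)
           = (LINT x:\<Omega>|lborel. u t x * (uxx t x)\<^sup>2 * \<phi> x)
             - 5 / 6 * (LINT x:\<Omega>|lborel. (ux t x) ^ 3 * deriv \<phi> x)
             - 1 / 2 * (LINT x:\<Omega>|lborel. u t x * (ux t x)\<^sup>2 * deriv (deriv \<phi>) x)"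
      unfolding thin_film_solution_def by blast
    moreover have "continuous_on ({0..} \<times> closure \<Omega>) (\<lambda>(t, x). u t x)" "\<forall>t\<ge>0. \<forall>x\<in>closure \<Omega>. 0 \<le> u t x"
      using sol by (auto simp: thin_film_solution_def)
    ultimately have "film a b n \<epsilon> C0 \<Omega> u ux uxx uxxx"
      unfolding film_def using ab \<Omega> n \<epsilon> C0 mass e by simp
    then show "\<exists>ux uxx uxxx. film a b n \<epsilon> C0 \<Omega> u ux uxx uxxx" by blast
  qed
qed

section \<open>The norm of \<open>W\<^sup>-\<^sup>1\<^sup>,\<^sup>1\<close>\<close>

lemma set_integrable_mult_bounded:
  fixes f \<psi> :: "real \<Rightarrow> real"
  assumes f: "set_integrable lborel U f" and \<psi>: "\<psi> \<in> borel_measurable borel" "\<And>x. \<bar>\<psi> x\<bar> \<le> C"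
  shows "set_integrable lborel U (\<lambda>x. f x * \<psi> x)"
  using integrable_mult_bounded[OF f[unfolded set_integrable_def], of \<psi> C] \<psi>
  by (simp add: set_integrable_def mult.assoc)

abbreviation rep_norm :: "real set \<Rightarrow> (real \<Rightarrow> real) \<Rightarrow> (real \<Rightarrow> real) \<Rightarrow> real" where
  "rep_norm U f0 f1 \<equiv> (LINT x:U|lborel. \<bar>f0 x\<bar>) + (LINT x:U|lborel. \<bar>f1 x\<bar>)"

lemma rep_norm_nonneg: "0 \<le> rep_norm U f0 f1"
  unfolding set_lebesgue_integral_def
  by (intro add_nonneg_nonneg Bochner_Integration.integral_nonneg) (auto simp: indicator_def)

lemma Lp_1_iff: "U \<in> sets borel \<Longrightarrow> Lp 1 U f \<longleftrightarrow> set_integrable lborel U f" for U :: "real set"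
proof -
  assume U: "U \<in> sets borel"
  have "Lp 1 U f \<longleftrightarrow> set_borel_measurable lborel U f \<and> set_integrable lborel U (\<lambda>x. \<bar>f x\<bar>)"
    by (simp add: Lp_def)
  also have "\<dots> \<longleftrightarrow> set_integrable lborel U f"
    unfolding set_integrable_def set_borel_measurable_def
    using integrable_abs_iff[of "\<lambda>x. indicator U x *\<^sub>R f x" lborel]
    by (auto simp: abs_mult)
  finally show ?thesis .
qed

lemma W_norm_le: "W_rep U F f0 f1 \<Longrightarrow> W_norm U F \<le> rep_norm U f0 f1"
  unfolding W_norm_def
  by (rule cInf_lower) (auto intro!: bdd_belowI[of _ 0] rep_norm_nonneg)

lemma W_norm_geI:
  assumes "in_W U F" "\<And>f0 f1. W_rep U F f0 f1 \<Longrightarrow> c \<le> rep_norm U f0 f1"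
  shows "c \<le> W_norm U F"
  unfolding W_norm_def by (rule cInf_greatest) (use assms in \<open>auto simp: in_W_def\<close>)

lemma W_norm_nonneg: "in_W U F \<Longrightarrow> 0 \<le> W_norm U F"
  by (rule W_norm_geI) (auto intro: rep_norm_nonneg)

text \<open>The number c dominates \<phi> and \<phi>' together, so each representation bounds the
  pairing by c times its two L^1 norms; then the infimum is taken. Hence convergence in norm implies
  convergence against every test function.\<close>

lemma W_pairing_le:
  assumes U: "U \<in> sets borel" and F: "in_W U F" and \<phi>: "test_fun U \<phi>"
    and c: "0 < c" "\<And>x. \<bar>\<phi> x\<bar> \<le> c" "\<And>x. \<bar>deriv \<phi> x\<bar> \<le> c"
  shows "\<bar>F \<phi>\<bar> \<le> c * W_norm U F"
proof -
  have "\<bar>F \<phi>\<bar> / c \<le> W_norm U F"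
  proof (rule W_norm_geI[OF F])
    fix f0 f1 assume r: "W_rep U F f0 f1"
    have i: "set_integrable lborel U f0" "set_integrable lborel U f1"
      using r by (auto simp: W_rep_def Lp_1_iff[OF U])
    have bound: "\<bar>LINT x:U|lborel. f x * \<psi> x\<bar> \<le> c * (LINT x:U|lborel. \<bar>f x\<bar>)"
      if f: "set_integrable lborel U f" and \<psi>: "\<And>x. \<bar>\<psi> x\<bar> \<le> c" "test_fun U \<psi>" for f \<psi>
    proof -
      have fp: "integrable lborel (\<lambda>x. (indicator U x * f x) * \<psi> x)"
        using set_integrable_mult_bounded[OF f test_fun_borel[OF \<psi>(2)] \<psi>(1)]
        by (simp add: set_integrable_def mult.assoc)
      have "\<bar>LINT x:U|lborel. f x * \<psi> x\<bar> \<le> (\<integral>x. \<bar>(indicator U x * f x) * \<psi> x\<bar> \<partial>lborel)"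
        unfolding set_lebesgue_integral_def using integral_abs_bound[of lborel "\<lambda>x. (indicator U x * f x) * \<psi> x"]
        by (simp add: mult.assoc)
      also have "\<dots> \<le> (\<integral>x. c * (indicator U x * \<bar>f x\<bar>) \<partial>lborel)"
      proof (rule integral_mono[OF integrable_abs[OF fp]])
        show "integrable lborel (\<lambda>x. c * (indicator U x * \<bar>f x\<bar>))"
          using set_integrable_abs[OF f] by (simp add: set_integrable_def)
        fix x
        have "\<bar>f x\<bar> * \<bar>\<psi> x\<bar> \<le> \<bar>f x\<bar> * c" using \<psi>(1)[of x] by (intro mult_left_mono) auto
        then show "\<bar>(indicator U x * f x) * \<psi> x\<bar> \<le> c * (indicator U x * \<bar>f x\<bar>)"
          by (auto simp: indicator_def abs_mult mult.commute)
      qed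
      also have "\<dots> = c * (LINT x:U|lborel. \<bar>f x\<bar>)"
        by (simp add: set_lebesgue_integral_def)
      finally show ?thesis .
    qed
    have "F \<phi> = (LINT x:U|lborel. f0 x * \<phi> x) - (LINT x:U|lborel. f1 x * deriv \<phi> x)"
      using r \<phi> by (auto simp: W_rep_def)
    then have "\<bar>F \<phi>\<bar> \<le> \<bar>LINT x:U|lborel. f0 x * \<phi> x\<bar> + \<bar>LINT x:U|lborel. f1 x * deriv \<phi> x\<bar>" by linarith
    also have "\<dots> \<le> c * (LINT x:U|lborel. \<bar>f0 x\<bar>) + c * (LINT x:U|lborel. \<bar>f1 x\<bar>)"
      by (intro add_mono bound i c \<phi> test_fun_deriv)
    finally show "\<bar>F \<phi>\<bar> / c \<le> rep_norm U f0 f1"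
      using c by (simp add: field_simps)
  qed
  then show ?thesis using c by (simp add: field_simps)
qed

text \<open>The sign \<sigma> treats sums and differences at once. H is prescribed on test functions
  only, because the values of a functional elsewhere are arbitrary.\<close>

lemma W_combination:
  fixes \<sigma> :: real
  assumes U: "U \<in> sets borel" and F: "in_W U F" and G: "in_W U G" and \<sigma>: "\<bar>\<sigma>\<bar> = 1"
    and H: "\<And>\<phi>. test_fun U \<phi> \<Longrightarrow> H \<phi> = F \<phi> + \<sigma> * G \<phi>"
  shows "in_W U H" "W_norm U H \<le> W_norm U F + W_norm U G"
proof -
  have rep: "W_rep U H (\<lambda>x. f0 x + \<sigma> * g0 x) (\<lambda>x. f1 x + \<sigma> * g1 x) \<and>
      rep_norm U (\<lambda>x. f0 x + \<sigma> * g0 x) (\<lambda>x. f1 x + \<sigma> * g1 x) \<le> rep_norm U f0 f1 + rep_norm U g0 g1"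
    if r: "W_rep U F f0 f1" "W_rep U G g0 g1" for f0 f1 g0 g1
  proof -
    have i: "set_integrable lborel U f0" "set_integrable lborel U f1" "set_integrable lborel U g0" "set_integrable lborel U g1"
      using r by (auto simp: W_rep_def Lp_1_iff[OF U])
    have sum: "set_integrable lborel U (\<lambda>x. f x + \<sigma> * g x)"
      if "set_integrable lborel U f" "set_integrable lborel U g" for f g
      using that by (intro set_integral_add set_integrable_mult_right) auto
    have "H \<phi> = (LINT x:U|lborel. (f0 x + \<sigma> * g0 x) * \<phi> x) - (LINT x:U|lborel. (f1 x + \<sigma> * g1 x) * deriv \<phi> x)"
      if \<phi>: "test_fun U \<phi>" for \<phi>
    proof -
      have lin: "(LINT x:U|lborel. (f x + \<sigma> * g x) * \<psi> x) = (LINT x:U|lborel. f x * \<psi> x) + \<sigma> * (LINT x:U|lborel. g x * \<psi> x)"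
        if f: "set_integrable lborel U f" "set_integrable lborel U g" and \<psi>: "test_fun U \<psi>" for f g \<psi>
      proof -
        have p: "set_integrable lborel U (\<lambda>x. f x * \<psi> x)" if "set_integrable lborel U f" for f
        proof -
          obtain C where "\<And>x. \<bar>\<psi> x\<bar> \<le> C" using test_fun_bounded[OF \<psi>] by blast
          then show ?thesis by (rule set_integrable_mult_bounded[OF that test_fun_borel[OF \<psi>]])
        qed
        have "(LINT x:U|lborel. (f x + \<sigma> * g x) * \<psi> x) = (LINT x:U|lborel. f x * \<psi> x + \<sigma> * (g x * \<psi> x))"
          by (simp add: distrib_right mult.assoc)
        also have "\<dots> = (LINT x:U|lborel. f x * \<psi> x) + (LINT x:U|lborel. \<sigma> * (g x * \<psi> x))"
          by (intro set_integral_add set_integrable_mult_right p f)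
        finally show ?thesis by simp
      qed
      have "F \<phi> = (LINT x:U|lborel. f0 x * \<phi> x) - (LINT x:U|lborel. f1 x * deriv \<phi> x)"
        "G \<phi> = (LINT x:U|lborel. g0 x * \<phi> x) - (LINT x:U|lborel. g1 x * deriv \<phi> x)"
        using r \<phi> by (auto simp: W_rep_def)
      then show ?thesis
        unfolding H[OF \<phi>] lin[OF i(1,3) \<phi>] lin[OF i(2,4) test_fun_deriv[OF \<phi>]]
        by (simp add: right_diff_distrib)
    qed
    then have 1: "W_rep U H (\<lambda>x. f0 x + \<sigma> * g0 x) (\<lambda>x. f1 x + \<sigma> * g1 x)"
      using sum[OF i(1,3)] sum[OF i(2,4)] by (simp add: W_rep_def Lp_1_iff[OF U])
    have "(LINT x:U|lborel. \<bar>f x + \<sigma> * g x\<bar>) \<le> (LINT x:U|lborel. \<bar>f x\<bar>) + (LINT x:U|lborel. \<bar>g x\<bar>)"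
      if f: "set_integrable lborel U f" "set_integrable lborel U g" for f g
    proof -
      have "(LINT x:U|lborel. \<bar>f x + \<sigma> * g x\<bar>) \<le> (LINT x:U|lborel. \<bar>f x\<bar> + \<bar>g x\<bar>)"
      proof (rule set_integral_mono)
        show "set_integrable lborel U (\<lambda>x. \<bar>f x + \<sigma> * g x\<bar>)" by (intro set_integrable_abs sum f)
        show "set_integrable lborel U (\<lambda>x. \<bar>f x\<bar> + \<bar>g x\<bar>)" by (intro set_integral_add set_integrable_abs f)
        show "\<bar>f x + \<sigma> * g x\<bar> \<le> \<bar>f x\<bar> + \<bar>g x\<bar>" for x
          using abs_triangle_ineq[of "f x" "\<sigma> * g x"] \<sigma> by (simp add: abs_mult)
      qed
      also have "\<dots> = (LINT x:U|lborel. \<bar>f x\<bar>) + (LINT x:U|lborel. \<bar>g x\<bar>)"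
        by (intro set_integral_add set_integrable_abs f)
      finally show ?thesis .
    qed
    from this[OF i(1,3)] this[OF i(2,4)] 1 show ?thesis by simp
  qed
  obtain f0 f1 g0 g1 where "W_rep U F f0 f1" "W_rep U G g0 g1" using F G by (auto simp: in_W_def)
  with rep show "in_W U H" unfolding in_W_def by blast
  have "W_norm U H - W_norm U G \<le> W_norm U F"
  proof (rule W_norm_geI[OF F])
    fix f0 f1 assume r: "W_rep U F f0 f1"
    have "W_norm U H - rep_norm U f0 f1 \<le> W_norm U G"
    proof (rule W_norm_geI[OF G])
      fix g0 g1 assume "W_rep U G g0 g1"
      from rep[OF r this] show "W_norm U H - rep_norm U f0 f1 \<le> rep_norm U g0 g1"
        using W_norm_le[of U H] by fastforce
    qed
    then show "W_norm U H - W_norm U G \<le> rep_norm U f0 f1" by simp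
  qed
  then show "W_norm U H \<le> W_norm U F + W_norm U G" by simp
qed

lemma W_diff:
  assumes "U \<in> sets borel" "in_W U F" "in_W U G"
  shows "in_W U (\<lambda>\<phi>. F \<phi> - G \<phi>)" "W_norm U (\<lambda>\<phi>. F \<phi> - G \<phi>) \<le> W_norm U F + W_norm U G"
  using W_combination[OF assms, of "-1" "\<lambda>\<phi>. F \<phi> - G \<phi>"] by auto

text \<open>The triangle inequality in both directions; it transfers the convergence of simple
  approximations to the norm of a difference.\<close>

lemma W_norm_diff_approx:
  assumes U: "U \<in> sets borel" and F: "in_W U F" and G: "in_W U G" and S: "in_W U S" and R: "in_W U R"
  shows "\<bar>W_norm U (\<lambda>\<phi>. S \<phi> - R \<phi>) - W_norm U (\<lambda>\<phi>. F \<phi> - G \<phi>)\<bar>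
    \<le> W_norm U (\<lambda>\<phi>. S \<phi> - F \<phi>) + W_norm U (\<lambda>\<phi>. R \<phi> - G \<phi>)"
proof -
  let ?E = "\<lambda>\<phi>. (S \<phi> - F \<phi>) - (R \<phi> - G \<phi>)"
  have E: "in_W U ?E" "W_norm U ?E \<le> W_norm U (\<lambda>\<phi>. S \<phi> - F \<phi>) + W_norm U (\<lambda>\<phi>. R \<phi> - G \<phi>)"
    using W_diff[OF U W_diff(1)[OF U S F] W_diff(1)[OF U R G]] by auto
  have "W_norm U (\<lambda>\<phi>. S \<phi> - R \<phi>) \<le> W_norm U (\<lambda>\<phi>. F \<phi> - G \<phi>) + W_norm U ?E"
    by (rule W_combination(2)[OF U W_diff(1)[OF U F G] E(1), of 1]) auto
  moreover have "W_norm U (\<lambda>\<phi>. F \<phi> - G \<phi>) \<le> W_norm U (\<lambda>\<phi>. S \<phi> - R \<phi>) + W_norm U ?E"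
    by (rule W_combination(2)[OF U W_diff(1)[OF U S R] E(1), of "-1"]) auto
  ultimately show ?thesis using E(2) by linarith
qed

lemma finite_range_measurable:
  assumes "finite (f ` space M)" "\<And>y. {t\<in>space M. f t = y} \<in> sets M"
  shows "f \<in> measurable M (count_space UNIV)"
proof (rule measurableI)
  fix A
  have "f -` A \<inter> space M = (\<Union>y\<in>f ` space M \<inter> A. {t\<in>space M. f t = y})" by auto
  also have "\<dots> \<in> sets M" using assms by (intro sets.finite_UN) auto
  finally show "f -` A \<inter> space M \<in> sets M" .
qed auto

text \<open>The norm of a difference of two simple functions takes finitely many values on
  measurable sets. Strong measurability makes the sought function the almost everywhere limit of
  such norms, and a pointwise \<open>lim\<close> of measurable functions is measurable.\<close>

lemma W_norm_measurable_representative: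
  assumes U: "U \<in> sets borel" and F: "in_Lp_W p T U F" and G: "in_Lp_W p T U G"
  obtains g where "g \<in> borel_measurable lborel"
    "AE t in lborel. t \<in> {0<..<T} \<longrightarrow> g t = W_norm U (\<lambda>\<phi>. F t \<phi> - G t \<phi>)"
proof -
  obtain S where S: "\<And>j. W_simple T U (S j)"
    "AE t\<in>{0<..<T} in lborel. (\<lambda>j::nat. W_norm U (\<lambda>\<phi>. S j t \<phi> - F t \<phi>)) \<longlonglongrightarrow> 0"
    using F by (auto simp: in_Lp_W_def)
  obtain R where R: "\<And>j. W_simple T U (R j)"
    "AE t\<in>{0<..<T} in lborel. (\<lambda>j::nat. W_norm U (\<lambda>\<phi>. R j t \<phi> - G t \<phi>)) \<longlonglongrightarrow> 0"
    using G by (auto simp: in_Lp_W_def)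
  \<comment> \<open>Simple functions are restricted only inside (0, T). The Boolean flag sends all
    other times to one dummy value, which keeps the range finite on the whole line.\<close>
  define q where "q j t = (if t \<in> {0<..<T} then (True, S j t, R j t) else (False, undefined, undefined))" for j t
  define w where "w = (\<lambda>(b, A, B). if b then W_norm U (\<lambda>\<phi>. A \<phi> - B \<phi>) else (0::real))"
  have q: "q j \<in> measurable lborel (count_space UNIV)" for j
  proof (rule finite_range_measurable)
    have "q j ` space lborel \<subseteq> insert (False, undefined, undefined) ({True} \<times> (S j ` {0<..<T}) \<times> (R j ` {0<..<T}))"
      by (auto simp: q_def)
    moreover have "finite (S j ` {0<..<T})" "finite (R j ` {0<..<T})"
      using S(1)[of j] R(1)[of j] by (auto simp: W_simple_def)
    ultimately show "finite (q j ` space lborel)" by (meson finite_SigmaI finite.intros finite_insert finite_subset)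
    fix y :: "bool \<times> distr \<times> distr"
    obtain b A B where y: "y = (b, A, B)" by (cases y)
    show "{t\<in>space lborel. q j t = y} \<in> sets lborel"
    proof (cases b)
      case True
      have "{t\<in>space lborel. q j t = y} = {t\<in>{0<..<T}. S j t = A} \<inter> {t\<in>{0<..<T}. R j t = B}"
        using True by (auto simp: q_def y)
      also have "\<dots> \<in> sets lborel" using S(1)[of j] R(1)[of j] unfolding W_simple_def by (intro sets.Int) auto
      finally show ?thesis .
    next
      case False
      then have "{t\<in>space lborel. q j t = y} = (if A = undefined \<and> B = undefined then - {0<..<T} else {})"
        by (auto simp: q_def y)
      then show ?thesis by simp
    qed
  qed
  have m: "(\<lambda>t. w (q j t)) \<in> borel_measurable lborel" for j
    using measurable_compose[OF q, of w borel] by simp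
  define g where "g t = lim (\<lambda>j. w (q j t))" for t
  have "g \<in> borel_measurable lborel" unfolding g_def by (rule borel_measurable_lim_metric[OF m])
  moreover have "AE t in lborel. t \<in> {0<..<T} \<longrightarrow> g t = W_norm U (\<lambda>\<phi>. F t \<phi> - G t \<phi>)"
  proof -
    have "AE t\<in>{0<..<T} in lborel. in_W U (F t)" "AE t\<in>{0<..<T} in lborel. in_W U (G t)"
      using F G by (auto simp: in_Lp_W_def)
    with S(2) R(2) show ?thesis
    proof eventually_elim
      case (elim t)
      show ?case
      proof
        assume t: "t \<in> {0<..<T}"
        have wq: "w (q j t) = W_norm U (\<lambda>\<phi>. S j t \<phi> - R j t \<phi>)" for j
          using t by (simp add: w_def q_def)
        have in_W: "in_W U (S j t)" "in_W U (R j t)" for j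
          using S(1)[of j] R(1)[of j] t by (auto simp: W_simple_def)
        have "(\<lambda>j. W_norm U (\<lambda>\<phi>. S j t \<phi> - R j t \<phi>) - W_norm U (\<lambda>\<phi>. F t \<phi> - G t \<phi>)) \<longlonglongrightarrow> 0"
        proof (rule Lim_null_comparison)
          show "\<forall>\<^sub>F j in sequentially. norm (W_norm U (\<lambda>\<phi>. S j t \<phi> - R j t \<phi>) - W_norm U (\<lambda>\<phi>. F t \<phi> - G t \<phi>))
              \<le> W_norm U (\<lambda>\<phi>. S j t \<phi> - F t \<phi>) + W_norm U (\<lambda>\<phi>. R j t \<phi> - G t \<phi>)"
            using W_norm_diff_approx[OF U _ _ in_W] elim t by simp
          show "(\<lambda>j. W_norm U (\<lambda>\<phi>. S j t \<phi> - F t \<phi>) + W_norm U (\<lambda>\<phi>. R j t \<phi> - G t \<phi>)) \<longlonglongrightarrow> 0"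
            using elim t by (intro tendsto_add_zero) auto
        qed
        then have "(\<lambda>j. w (q j t)) \<longlonglongrightarrow> W_norm U (\<lambda>\<phi>. F t \<phi> - G t \<phi>)"
          unfolding wq by (rule LIM_zero_cancel)
        then show "g t = W_norm U (\<lambda>\<phi>. F t \<phi> - G t \<phi>)" unfolding g_def by (rule limI)
      qed
    qed
  qed
  ultimately show thesis by (rule that)
qed

text \<open>The p-th powers of the norms of the differences tend to 0 in L^1, hence almost
  everywhere along a subsequence. At such a time one exceptional set serves all test functions,
  because the pairing is bounded by the norm.\<close>

lemma converges_Lp_W_AE_subsequence:
  assumes U: "U \<in> sets borel" and conv: "converges_Lp_W p T U Fs F" and p: "1 \<le> p"
  obtains r :: "nat \<Rightarrow> nat" where "strict_mono r"
    "AE t in lborel. t \<in> {0<..<T} \<longrightarrow> (\<forall>\<phi>. test_fun U \<phi> \<longrightarrow> (\<lambda>k. Fs (r k) t \<phi>) \<longlonglongrightarrow> F t \<phi>)"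
proof -
  have Fs: "in_Lp_W p T U (Fs k)" and F: "in_Lp_W p T U F" for k
    using conv by (auto simp: converges_Lp_W_def)
  define W where "W k t = W_norm U (\<lambda>\<phi>. Fs k t \<phi> - F t \<phi>)" for k t
  have "\<exists>g. g \<in> borel_measurable lborel \<and> (AE t in lborel. t \<in> {0<..<T} \<longrightarrow> g t = W k t)" for k
  proof -
    obtain g where "g \<in> borel_measurable lborel"
      "AE t in lborel. t \<in> {0<..<T} \<longrightarrow> g t = W_norm U (\<lambda>\<phi>. Fs k t \<phi> - F t \<phi>)"
      by (rule W_norm_measurable_representative[OF U Fs F])
    then show ?thesis unfolding W_def by blast
  qed
  then have "\<exists>g. \<forall>k. g k \<in> borel_measurable lborel \<and> (AE t in lborel. t \<in> {0<..<T} \<longrightarrow> g k t = W k t)"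
    by (intro choice allI)
  then obtain g where g[measurable]: "\<And>k. g k \<in> borel_measurable lborel"
    and gW: "\<And>k. AE t in lborel. t \<in> {0<..<T} \<longrightarrow> g k t = W k t"
    by blast
  define h where "h k t = indicator {0<..<T} t * (g k t powr p)" for k t
  have hm[measurable]: "h k \<in> borel_measurable lborel" for k unfolding h_def by measurable
  have hn: "0 \<le> h k t" for k t by (simp add: h_def)
  have hN: "(\<integral>\<^sup>+t. ennreal (h k t) \<partial>lborel) = (\<integral>\<^sup>+t\<in>{0<..<T}. ennreal (W k t powr p) \<partial>lborel)" for k
    by (rule nn_integral_cong_AE) (use gW[of k] in \<open>eventually_elim, auto simp: h_def indicator_def\<close>)
  have lim: "(\<lambda>k. \<integral>\<^sup>+t. ennreal (h k t) \<partial>lborel) \<longlonglongrightarrow> 0"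
    unfolding hN using conv by (simp add: converges_Lp_W_def W_def)
  \<comment> \<open>From K on the integrals are below 1 and in particular finite, so the shifted
    functions belong to L^1.\<close>
  then have "eventually (\<lambda>k. (\<integral>\<^sup>+t. ennreal (h k t) \<partial>lborel) < 1) sequentially"
    by (rule order_tendstoD) simp
  then obtain K where K: "\<And>k. K \<le> k \<Longrightarrow> (\<integral>\<^sup>+t. ennreal (h k t) \<partial>lborel) < 1"
    by (auto simp: eventually_sequentially)
  have hi: "integrable lborel (h (k + K))" for k
    using K[of "k + K"] hn by (intro integrableI_nonneg) (auto intro: order.strict_trans)
  have "(\<lambda>k. ennreal (\<integral>t. norm (h (k + K) t) \<partial>lborel)) \<longlonglongrightarrow> 0"
  proof -
    have "ennreal (\<integral>t. norm (h (k + K) t) \<partial>lborel) = (\<integral>\<^sup>+t. ennreal (h (k + K) t) \<partial>lborel)" for k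
      using hi[of k] hn by (subst nn_integral_eq_integral) auto
    then show ?thesis using LIMSEQ_ignore_initial_segment[OF lim, of K] by simp
  qed
  then have "(\<lambda>k. \<integral>t. norm (h (k + K) t) \<partial>lborel) \<longlonglongrightarrow> 0"
    by (subst (asm) ennreal_0[symmetric], subst (asm) tendsto_ennreal_iff)
      (auto intro!: Bochner_Integration.integral_nonneg always_eventually)
  then obtain r0 :: "nat \<Rightarrow> nat" where r0: "strict_mono r0" "AE t in lborel. (\<lambda>k. h (r0 k + K) t) \<longlonglongrightarrow> 0"
    using tendsto_L1_AE_subseq[of lborel "\<lambda>k. h (k + K)"] hi by metis
  define r where "r k = r0 k + K" for k
  have "strict_mono r" using r0(1) by (auto simp: r_def strict_mono_def)
  moreover have "AE t in lborel. t \<in> {0<..<T} \<longrightarrow> (\<forall>\<phi>. test_fun U \<phi> \<longrightarrow> (\<lambda>k. Fs (r k) t \<phi>) \<longlonglongrightarrow> F t \<phi>)"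
  proof -
    have "AE t in lborel. \<forall>k. t \<in> {0<..<T} \<longrightarrow> g k t = W k t"
      unfolding AE_all_countable using gW by blast
    moreover have "AE t in lborel. \<forall>k. t \<in> {0<..<T} \<longrightarrow> in_W U (Fs k t)"
      unfolding AE_all_countable using Fs unfolding in_Lp_W_def by blast
    moreover have "AE t in lborel. t \<in> {0<..<T} \<longrightarrow> in_W U (F t)" using F by (simp add: in_Lp_W_def)
    ultimately show ?thesis using r0(2)
    proof eventually_elim
      case (elim t)
      show ?case
      proof (intro impI allI)
        fix \<phi> assume t: "t \<in> {0<..<T}" and \<phi>: "test_fun U \<phi>"
        have in_W: "in_W U (\<lambda>\<phi>. Fs k t \<phi> - F t \<phi>)" for k using W_diff(1)[OF U] elim t by blast
        then have Wn: "0 \<le> W k t" for k unfolding W_def by (rule W_norm_nonneg)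
        have "(\<lambda>k. W (r k) t powr p) \<longlonglongrightarrow> 0"
          using elim t by (simp add: h_def r_def)
        then have "(\<lambda>k. (W (r k) t powr p) powr (1 / p)) \<longlonglongrightarrow> 0 powr (1 / p)"
          using p by (intro tendsto_powr' tendsto_const) (auto intro!: always_eventually)
        then have W0: "(\<lambda>k. W (r k) t) \<longlonglongrightarrow> 0" using p Wn by (simp add: powr_powr)
        obtain C1 where C1: "C1 > 0" "\<And>x. \<bar>\<phi> x\<bar> \<le> C1" using test_fun_bounded[OF \<phi>] by blast
        obtain C2 where C2: "C2 > 0" "\<And>x. \<bar>deriv \<phi> x\<bar> \<le> C2" using test_fun_bounded[OF test_fun_deriv[OF \<phi>]] by blast
        define c where "c = max C1 C2"
        have c: "0 < c" "\<And>x. \<bar>\<phi> x\<bar> \<le> c" "\<And>x. \<bar>deriv \<phi> x\<bar> \<le> c"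
          using C1 C2 by (auto simp: c_def le_max_iff_disj)
        have "(\<lambda>k. Fs (r k) t \<phi> - F t \<phi>) \<longlonglongrightarrow> 0"
        proof (rule Lim_null_comparison)
          show "\<forall>\<^sub>F k in sequentially. norm (Fs (r k) t \<phi> - F t \<phi>) \<le> c * W (r k) t"
            using W_pairing_le[OF U in_W \<phi> c] by (simp add: W_def)
          show "(\<lambda>k. c * W (r k) t) \<longlonglongrightarrow> 0" using tendsto_mult_left[OF W0, of c] by simp
        qed
        then show "(\<lambda>k. Fs (r k) t \<phi>) \<longlonglongrightarrow> F t \<phi>" by (rule LIM_zero_cancel)
      qed
    qed
  qed
  ultimately show thesis by (rule that)
qed

section \<open>Bounded weak limits\<close>

lemma integrable_indicator_Ioo: "integrable lborel (\<lambda>y. indicator {p<..<q} y :: real)" for p q :: real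
proof (rule integrable_real_indicator)
  have "bounded {p<..<q}" by (rule bounded_subset[OF compact_imp_bounded[OF compact_Icc[of p q]]]) auto
  then show "emeasure lborel {p<..<q} < \<infinity>" by (rule emeasure_bounded_finite)
qed simp

text \<open>The end points a and x may be those of the domain, so the interval is first shrunk to
  one whose closure is inside; plateaus approximate its indicator in L^1.\<close>

lemma test_fun_approximates_interval:
  fixes a b x e :: real
  assumes x: "a \<le> x" "x \<le> b" and e: "0 < e"
  obtains \<phi> where "test_fun {a<..<b} \<phi>" "\<And>y. 0 \<le> \<phi> y \<and> \<phi> y \<le> 1" "(\<integral>y. \<bar>indicator {a<..<x} y - \<phi> y\<bar> \<partial>lborel) < e"
proof (cases "a = x")
  case True
  have "test_fun {a<..<b} (\<lambda>_. 0)" by (rule test_funI[of _ "{}"]) (auto intro: smooth_const)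
  then show thesis using that[of "\<lambda>_. 0"] e True by simp
next
  case False
  then have ax: "a < x" using x by simp
  \<comment> \<open>The shrinking costs 2 \<theta> \<le> e / 4 in L^1 and the plateau less than e /
    2. The bound (x - a) / 4 keeps the shrunk interval non-empty.\<close>
  define \<theta> where "\<theta> = min ((x - a) / 4) (e / 8)"
  have \<theta>: "0 < \<theta>" "\<theta> \<le> (x - a) / 4" "\<theta> \<le> e / 8"
    using ax e unfolding \<theta>_def by (simp, intro min.cobounded1, intro min.cobounded2)
  define c d where "c = a + \<theta>" and "d = x - \<theta>"
  have cd: "a < c" "c < d" "d < x" using \<theta> ax by (auto simp: c_def d_def)
  have sub: "{c..d} \<subseteq> {a<..<b}" using cd x by auto
  have meas: "plateau c d j \<in> borel_measurable borel" for j
    by (rule test_fun_borel[OF test_fun_plateau[OF sub]])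
  have "(\<lambda>j. \<integral>y. \<bar>indicator {c<..<d} y - plateau c d j y\<bar> \<partial>lborel) \<longlonglongrightarrow> integral\<^sup>L lborel (\<lambda>y::real. 0)"
  proof (rule integral_dominated_convergence)
    show "integrable lborel (\<lambda>y. indicator {c..d} y :: real)"
      using borel_integrable_compact[of "{c..d}" "\<lambda>_. 1::real"] by simp
    show "(\<lambda>y. \<bar>indicator {c<..<d} y - plateau c d j y\<bar>) \<in> borel_measurable lborel" for j
      using meas[of j] by measurable
    show "AE y in lborel. (\<lambda>j. \<bar>indicator {c<..<d} y - plateau c d j y\<bar>) \<longlonglongrightarrow> 0"
    proof (rule AE_I2)
      fix y
      have "(\<lambda>j. \<bar>indicator {c<..<d} y - plateau c d j y\<bar>) \<longlonglongrightarrow> \<bar>indicator {c<..<d} y - indicator {c<..<d} y\<bar>"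
        by (intro tendsto_intros plateau_tendsto)
      then show "(\<lambda>j. \<bar>indicator {c<..<d} y - plateau c d j y\<bar>) \<longlonglongrightarrow> 0" by simp
    qed
    show "AE y in lborel. norm \<bar>indicator {c<..<d} y - plateau c d j y\<bar> \<le> indicator {c..d} y" for j
    proof (rule AE_I2)
      fix y show "norm \<bar>indicator {c<..<d} y - plateau c d j y\<bar> \<le> indicator {c..d} y"
        using plateau_bounds[of c d j y] plateau_eq_0[of y c d j]
        by (cases "y \<in> {c<..<d}") (auto simp: indicator_def)
    qed
  qed auto
  then have "(\<lambda>j. \<integral>y. \<bar>indicator {c<..<d} y - plateau c d j y\<bar> \<partial>lborel) \<longlonglongrightarrow> 0" by simp
  from order_tendstoD(2)[OF this, of "e / 2"] e
  obtain j where j: "(\<integral>y. \<bar>indicator {c<..<d} y - plateau c d j y\<bar> \<partial>lborel) < e / 2"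
    by (auto simp: eventually_sequentially)
  have ii: "integrable lborel (\<lambda>y. indicator {p..q} y :: real)" for p q :: real
    using borel_integrable_compact[of "{p..q}" "\<lambda>_. 1::real"] by simp
  have ip: "integrable lborel (plateau c d j)"
    by (rule test_fun_integrable[OF test_fun_plateau]) simp
  note io = integrable_indicator_Ioo
  have "(\<integral>y. \<bar>indicator {a<..<x} y - plateau c d j y\<bar> \<partial>lborel)
      \<le> (\<integral>y. \<bar>indicator {c<..<d} y - plateau c d j y\<bar> + (indicator {a..c} y + indicator {d..x} y) \<partial>lborel)"
  proof (rule integral_mono)
    show "integrable lborel (\<lambda>y. \<bar>indicator {a<..<x} y - plateau c d j y\<bar>)"
      using io ip by auto
    show "integrable lborel (\<lambda>y. \<bar>indicator {c<..<d} y - plateau c d j y\<bar> + (indicator {a..c} y + indicator {d..x} y))"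
      using io ip ii by (intro Bochner_Integration.integrable_add integrable_abs Bochner_Integration.integrable_diff)
    fix y show "\<bar>indicator {a<..<x} y - plateau c d j y\<bar>
        \<le> \<bar>indicator {c<..<d} y - plateau c d j y\<bar> + (indicator {a..c} y + indicator {d..x} y)"
      using cd by (auto simp: indicator_def)
  qed
  also have "\<dots> = (\<integral>y. \<bar>indicator {c<..<d} y - plateau c d j y\<bar> \<partial>lborel) + (\<theta> + \<theta>)"
  proof -
    have "(\<integral>y. indicator {a..c} y \<partial>lborel) = \<theta>" "(\<integral>y. indicator {d..x} y \<partial>lborel) = \<theta>"
      using \<theta> by (auto simp: c_def d_def)
    moreover have "(\<integral>y. (indicator {a..c} y :: real) + indicator {d..x} y \<partial>lborel)
        = (\<integral>y. indicator {a..c} y \<partial>lborel) + (\<integral>y. indicator {d..x} y \<partial>lborel)"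
      by (rule Bochner_Integration.integral_add[OF ii ii])
    moreover have "(\<integral>y. \<bar>indicator {c<..<d} y - plateau c d j y\<bar> + (indicator {a..c} y + indicator {d..x} y) \<partial>lborel)
        = (\<integral>y. \<bar>indicator {c<..<d} y - plateau c d j y\<bar> \<partial>lborel) + (\<integral>y. indicator {a..c} y + indicator {d..x} y \<partial>lborel)"
      using io ip ii by (intro Bochner_Integration.integral_add integrable_abs Bochner_Integration.integrable_diff
          Bochner_Integration.integrable_add)
    ultimately show ?thesis by simp
  qed
  also have "\<dots> < e" using j \<theta> e by auto
  finally show thesis
    using that[of "plateau c d j"] test_fun_plateau[OF sub] plateau_bounds by blast
qed

text \<open>The measure with distribution function \<open>x - P x\<close> complements the one of \<open>P\<close> to Lebesgue measure.\<close>

lemma interval_measure_le_lborel: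
  fixes P :: "real \<Rightarrow> real"
  assumes P: "\<And>x y. x \<le> y \<Longrightarrow> 0 \<le> P y - P x \<and> P y - P x \<le> y - x" and A: "A \<in> sets borel"
  shows "emeasure (interval_measure P) A \<le> emeasure lborel A"
proof -
  define Q where "Q x = x - P x" for x
  have contP: "continuous_on UNIV P"
  proof (rule continuous_on_iff[THEN iffD2], intro ballI allI impI)
    fix x e :: real assume "0 < e"
    have "\<bar>P y - P x\<bar> \<le> \<bar>y - x\<bar>" for y using P[of x y] P[of y x] by (cases "x \<le> y") auto
    then show "\<exists>d>0. \<forall>y\<in>UNIV. dist y x < d \<longrightarrow> dist (P y) (P x) < e"
      using \<open>0 < e\<close> by (intro exI[of _ e]) (auto simp: dist_real_def intro: le_less_trans)
  qed
  then have contQ: "continuous_on UNIV Q" unfolding Q_def by (intro continuous_intros)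
  have right: "continuous (at_right x) P" "continuous (at_right x) Q" for x
    using contP contQ by (auto simp: continuous_on_eq_continuous_at intro: continuous_at_imp_continuous_within)
  have mono: "x \<le> y \<Longrightarrow> P x \<le> P y" "x \<le> y \<Longrightarrow> Q x \<le> Q y" for x y using P[of x y] by (auto simp: Q_def)
  let ?p = "interval_measure P" and ?q = "interval_measure Q"
  \<comment> \<open>The sum of the two Stieltjes measures. On a half-open interval with a \<le> b it
    has the mass (P b - P a) + (Q b - Q a) = b - a.\<close>
  define M where "M = measure_of UNIV (sets borel) (\<lambda>A. emeasure ?p A + emeasure ?q A)"
  have M: "emeasure M A = emeasure ?p A + emeasure ?q A" if "A \<in> sets borel" for A
    unfolding M_def
  proof (rule emeasure_measure_of_sigma)
    show "sigma_algebra UNIV (sets borel)" using sets.sigma_algebra_axioms[of borel] by simp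
    show "positive (sets borel) (\<lambda>A. emeasure ?p A + emeasure ?q A)" by (simp add: positive_def)
    show "countably_additive (sets borel) (\<lambda>A. emeasure ?p A + emeasure ?q A)"
    proof (rule countably_additiveI)
      fix A :: "nat \<Rightarrow> real set" assume "range A \<subseteq> sets borel" "disjoint_family A"
      then show "(\<Sum>i. emeasure ?p (A i) + emeasure ?q (A i)) = emeasure ?p (\<Union>i. A i) + emeasure ?q (\<Union>i. A i)"
        by (subst suminf_add[symmetric]) (auto simp: suminf_emeasure summableI)
    qed
  qed (rule that)
  have "lborel = M"
  proof (rule measure_eqI_generator_eq[where E = "range (\<lambda>(a, b). {a<..b::real})" and \<Omega> = UNIV and A = "\<lambda>i. {- real i<..real i}"])
    show "Int_stable (range (\<lambda>(a, b). {a<..b::real}))" by (auto simp: Int_stable_def)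
    show sb: "sets lborel = sigma_sets UNIV (range (\<lambda>(a, b). {a<..b::real}))"
      by (simp add: borel_sigma_sets_Ioc)
    show "sets M = sigma_sets UNIV (range (\<lambda>(a, b). {a<..b::real}))"
      using sb sets.sigma_sets_eq[of "borel :: real measure"] by (simp add: M_def)
    show "(\<Union>i. {- real i<..real i}) = UNIV"
    proof -
      have "\<exists>i. - real i < x \<and> x \<le> real i" for x :: real
      proof -
        obtain i where "\<bar>x\<bar> < real i" using reals_Archimedean2 by blast
        then show ?thesis by (intro exI[of _ i]) auto
      qed
      then show ?thesis by auto
    qed
    fix X assume "X \<in> range (\<lambda>(a, b). {a<..b::real})"
    then obtain a b where X: "X = {a<..b}" by auto
    show "emeasure lborel X = emeasure M X"
    proof (cases "a \<le> b")
      case True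
      have "emeasure M X = ennreal (P b - P a) + ennreal (Q b - Q a)"
        using True mono right by (simp add: X M emeasure_interval_measure_Ioc)
      also have "\<dots> = ennreal (b - a)"
        using mono[OF True] by (subst ennreal_plus[symmetric]) (auto simp: Q_def)
      finally show ?thesis using True by (simp add: X)
    qed (simp add: X M)
  qed auto
  then have "emeasure lborel A = emeasure ?p A + emeasure ?q A" using M[OF A] by simp
  then show ?thesis by simp
qed

text \<open>The Stieltjes measure of P is dominated by Lebesgue measure, so the Radon-Nikodym
  theorem provides a density. It is at most 1 almost everywhere, as otherwise the domination would
  fail on the set where it exceeds 1.\<close>

lemma density_of_Lipschitz:
  fixes P :: "real \<Rightarrow> real"
  assumes P: "\<And>x y. x \<le> y \<Longrightarrow> 0 \<le> P y - P x \<and> P y - P x \<le> y - x"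
  obtains g where "g \<in> borel_measurable borel" "\<And>x. 0 \<le> g x \<and> g x \<le> 1" "ac_on UNIV P g"
proof -
  let ?p = "interval_measure P"
  have le: "emeasure ?p A \<le> emeasure lborel A" if "A \<in> sets borel" for A
    by (rule interval_measure_le_lborel[OF P that])
  have "absolutely_continuous lborel ?p"
    unfolding absolutely_continuous_def null_sets_def using le by auto (metis le_zero_eq)
  then obtain f where f[measurable]: "f \<in> borel_measurable lborel" and fp: "density lborel f = ?p"
    using sigma_finite_measure.Radon_Nikodym[OF sigma_finite_lborel, of ?p] by auto
  have fA: "emeasure ?p A = (\<integral>\<^sup>+x. f x * indicator A x \<partial>lborel)" if "A \<in> sets borel" for A
    using emeasure_density[OF f, of A] that by (simp add: fp)
  have f1: "AE x in lborel. f x \<le> 1"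
  proof -
    \<comment> \<open>Bounded pieces have finite Lebesgue measure, which makes the subtraction of
      extended integrals legitimate.\<close>
    have "AE x in lborel. x \<in> {- real m..real m} \<longrightarrow> f x \<le> 1" for m :: nat
    proof -
      let ?A = "{x. 1 < f x} \<inter> {- real m..real m}"
      have "{x\<in>space lborel. 1 < f x} \<in> sets lborel" by measurable
      then have A[measurable]: "?A \<in> sets borel" by simp
      have "emeasure lborel ?A \<le> emeasure lborel {- real m..real m}" by (rule emeasure_mono) auto
      then have fin: "emeasure lborel ?A \<noteq> \<infinity>" by (auto simp: top_unique)
      have "(\<integral>\<^sup>+x. f x * indicator ?A x - indicator ?A x \<partial>lborel)
          = (\<integral>\<^sup>+x. f x * indicator ?A x \<partial>lborel) - (\<integral>\<^sup>+x. indicator ?A x \<partial>lborel)"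
      proof (rule nn_integral_diff)
        show "(\<integral>\<^sup>+x. indicator ?A x \<partial>lborel) \<noteq> \<infinity>" using fin by simp
        show "AE x in lborel. indicator ?A x \<le> f x * indicator ?A x"
          by (intro AE_I2) (auto simp: indicator_def)
      qed measurable
      also have "\<dots> = emeasure ?p ?A - emeasure lborel ?A" by (simp add: fA)
      also have "\<dots> = 0" using le[OF A] fin by (simp add: diff_eq_0_iff_ennreal top.not_eq_extremum)
      finally have "AE x in lborel. f x * indicator ?A x - indicator ?A x = 0"
        by (subst (asm) nn_integral_0_iff_AE) auto
      then show ?thesis
      proof eventually_elim
        case (elim x)
        show ?case
        proof (rule impI, rule ccontr)
          assume x: "x \<in> {- real m..real m}" "\<not> f x \<le> 1"
          then have "f x - 1 = 0" using elim by (auto simp: indicator_def not_le)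
          then show False using x by (simp add: diff_eq_0_iff_ennreal)
        qed
      qed
    qed
    then have "AE x in lborel. \<forall>m::nat. x \<in> {- real m..real m} \<longrightarrow> f x \<le> 1"
      unfolding AE_all_countable by blast
    then show ?thesis
    proof eventually_elim
      case (elim x)
      obtain m where "\<bar>x\<bar> < real m" using reals_Archimedean2 by blast
      then have "x \<in> {- real m..real m}" by auto
      then show ?case using elim by blast
    qed
  qed
  \<comment> \<open>The minimum changes f on a null set only and makes the bounds hold at every
    point.\<close>
  define g where "g x = enn2real (min (f x) 1)" for x
  have gm: "g \<in> borel_measurable borel" unfolding g_def using f by measurable
  have g01: "0 \<le> g x \<and> g x \<le> 1" for x
    unfolding g_def by (auto intro!: enn2real_leI)
  have gf: "AE x in lborel. ennreal (g x) = f x"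
    using f1
  proof eventually_elim
    case (elim x)
    then have "f x < top" by (auto intro: le_less_trans)
    then show ?case using elim by (simp add: g_def min_absorb1)
  qed
  have "ac_on UNIV P g"
    unfolding ac_on_def
  proof (intro allI impI)
    fix c d :: real assume cd: "c \<le> d \<and> {c..d} \<subseteq> UNIV"
    have i: "integrable lborel (\<lambda>x. indicator {c..d} x * g x)"
    proof (rule Bochner_Integration.integrable_bound)
      show "integrable lborel (\<lambda>y. indicator {c..d} y :: real)"
        using borel_integrable_compact[of "{c..d}" "\<lambda>_. 1::real"] by simp
      show "AE x in lborel. norm (indicator {c..d} x * g x) \<le> norm (indicator {c..d} x :: real)"
        using g01 by (auto simp: indicator_def)
    qed (use gm in measurable)
    have mono: "x \<le> y \<Longrightarrow> P x \<le> P y" for x y using P[of x y] by auto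
    have contP: "isCont P x" for x
    proof (rule continuous_at_eps_delta[THEN iffD2], intro allI impI)
      fix e :: real assume "0 < e"
      have "\<bar>P y - P x\<bar> \<le> \<bar>y - x\<bar>" for y using P[of x y] P[of y x] by (cases "x \<le> y") auto
      then show "\<exists>d>0. \<forall>y. dist y x < d \<longrightarrow> dist (P y) (P x) < e"
        using \<open>0 < e\<close> by (intro exI[of _ e]) (auto simp: dist_real_def intro: le_less_trans)
    qed
    have "ennreal (\<integral>x. indicator {c..d} x * g x \<partial>lborel) = (\<integral>\<^sup>+x. ennreal (indicator {c..d} x * g x) \<partial>lborel)"
      using i g01 by (intro nn_integral_eq_integral[symmetric]) (auto simp: indicator_def)
    also have "\<dots> = (\<integral>\<^sup>+x. f x * indicator {c<..d} x \<partial>lborel)"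
    proof (rule nn_integral_cong_AE)
      show "AE x in lborel. ennreal (indicator {c..d} x * g x) = f x * indicator {c<..d} x"
        using gf AE_lborel_singleton[of c] by eventually_elim (auto simp: indicator_def)
    qed
    also have "\<dots> = emeasure ?p {c<..d}" by (simp add: fA)
    also have "\<dots> = ennreal (P d - P c)"
      using cd mono contP by (intro emeasure_interval_measure_Ioc) (auto intro: continuous_at_imp_continuous_within)
    finally have "(\<integral>x. indicator {c..d} x * g x \<partial>lborel) = P d - P c"
      using cd mono g01 by (subst (asm) ennreal_inj) (auto intro!: Bochner_Integration.integral_nonneg simp: indicator_def)
    then show "set_integrable lborel {c..d} g \<and> (LINT x:{c..d}|lborel. g x) = P d - P c"
      using i by (simp add: set_integrable_def set_lebesgue_integral_def)
  qed
  then show thesis using that gm g01 by blast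
qed

text \<open>Pairings with test functions converge by hypothesis, and the indicator of (a, x) is an
  L^1 limit of test functions. As the f k are uniformly bounded, their primitives form Cauchy
  sequences at each x. The limit P is non-decreasing and, because C tends to 1, has Lipschitz
  constant 1; its density is g. An integration by parts against \<phi>' identifies g with F.\<close>

lemma bounded_weak_limit:
  fixes f :: "nat \<Rightarrow> real \<Rightarrow> real" and F :: distr
  assumes ab: "a < b" and fi: "\<And>k. set_integrable lborel {a<..<b} (f k)"
    and f0: "\<And>k x. x \<in> {a<..<b} \<Longrightarrow> 0 \<le> f k x \<and> f k x \<le> C k" and C: "C \<longlonglongrightarrow> 1"
    and lim: "\<And>\<phi>. test_fun {a<..<b} \<phi> \<Longrightarrow> (\<lambda>k. LINT x:{a<..<b}|lborel. f k x * \<phi> x) \<longlonglongrightarrow> F \<phi>"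
  obtains g where "Linf_rep {a<..<b} F g" "\<And>x. 0 \<le> g x \<and> g x \<le> 1"
proof -
  let ?U = "{a<..<b}"
  have "Bseq C" using C by (intro convergent_imp_Bseq convergentI)
  then obtain K where K: "\<And>k. \<bar>C k\<bar> \<le> K" unfolding Bseq_def by auto
  have K0: "0 \<le> K" using K[of 0] by linarith
  have fK: "0 \<le> f k x \<and> f k x \<le> K" if "x \<in> ?U" for k x using f0[OF that, of k] K[of k] by auto
  define h where "h k x = indicator ?U x * f k x" for k x
  have h: "integrable lborel (h k)" for k using fi by (simp add: set_integrable_def h_def[abs_def])
  have hK: "0 \<le> h k x" "\<bar>h k x\<bar> \<le> K" for k x using fK[of x k] K0 by (auto simp: h_def indicator_def)
  define Pk where "Pk k x = (\<integral>y. h k y * indicator {a<..<x} y \<partial>lborel)" for k x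
  have hi: "integrable lborel (\<lambda>y. h k y * indicator A y)" if "A \<in> sets borel" for k A
    using h that by (intro integrable_real_mult_indicator) auto
  have Pk_diff: "set_integrable lborel {x..y} (f k)" "(LINT q:{x..y}|lborel. f k q) = Pk k y - Pk k x"
    if xy: "x \<le> y" "{x..y} \<subseteq> ?U" for k x y
  proof -
    show "set_integrable lborel {x..y} (f k)" by (rule set_integrable_subset[OF fi]) (use xy in auto)
    have "Pk k y - Pk k x = (\<integral>q. h k q * indicator {a<..<y} q - h k q * indicator {a<..<x} q \<partial>lborel)"
      unfolding Pk_def by (rule Bochner_Integration.integral_diff[symmetric]) (auto intro: hi)
    also have "\<dots> = (\<integral>q. indicator {x..y} q * f k q \<partial>lborel)"
    proof (rule integral_cong_AE)
      show "AE q in lborel. h k q * indicator {a<..<y} q - h k q * indicator {a<..<x} q = indicator {x..y} q * f k q"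
        using AE_lborel_singleton[of x] AE_lborel_singleton[of y]
      proof eventually_elim
        case (elim q)
        have "a < x" "y < b" using xy by auto
        then show ?case using elim xy(1) by (auto simp: h_def indicator_def)
      qed
    qed (use hi \<open>set_integrable lborel {x..y} (f k)\<close> in \<open>auto simp: set_integrable_def\<close>)
    finally show "(LINT q:{x..y}|lborel. f k q) = Pk k y - Pk k x" by (simp add: set_lebesgue_integral_def)
  qed
  have Pk_mono: "0 \<le> Pk k y - Pk k x \<and> Pk k y - Pk k x \<le> C k * (y - x)" if xy: "a \<le> x" "x \<le> y" "y \<le> b" for k x y
  proof -
    have e: "Pk k y - Pk k x = (\<integral>q. h k q * indicator {a<..<y} q - h k q * indicator {a<..<x} q \<partial>lborel)"
      unfolding Pk_def by (rule Bochner_Integration.integral_diff[symmetric]) (auto intro: hi)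
    have d: "integrable lborel (\<lambda>q. h k q * indicator {a<..<y} q - h k q * indicator {a<..<x} q)"
      by (intro Bochner_Integration.integrable_diff hi) auto
    have "0 \<le> (\<integral>q. h k q * indicator {a<..<y} q - h k q * indicator {a<..<x} q \<partial>lborel)"
      using hK(1) xy by (intro Bochner_Integration.integral_nonneg) (auto simp: indicator_def)
    moreover have "(\<integral>q. h k q * indicator {a<..<y} q - h k q * indicator {a<..<x} q \<partial>lborel) \<le> (\<integral>q. C k * indicator {x..y} q \<partial>lborel)"
    proof (rule integral_mono[OF d])
      show "integrable lborel (\<lambda>q. C k * indicator {x..y} q)"
        using borel_integrable_compact[of "{x..y}" "\<lambda>_. 1::real"] by simp
      have C0: "0 \<le> C k" using f0[of "(a + b)/2" k] ab by auto
      fix q show "h k q * indicator {a<..<y} q - h k q * indicator {a<..<x} q \<le> C k * indicator {x..y} q"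
        using f0[of q k] xy C0 by (auto simp: h_def indicator_def)
    qed
    moreover have "(\<integral>q. C k * indicator {x..y} q \<partial>lborel) = C k * (y - x)" using xy by simp
    ultimately show ?thesis using e by linarith
  qed
  have conv: "convergent (\<lambda>k. Pk k x)" if x: "a \<le> x" "x \<le> b" for x
    unfolding Cauchy_convergent_iff[symmetric]
  proof (rule metric_CauchyI)
    fix e :: real assume e: "0 < e"
    obtain \<phi> where \<phi>: "test_fun ?U \<phi>" "\<And>y. 0 \<le> \<phi> y \<and> \<phi> y \<le> 1"
      "(\<integral>y. \<bar>indicator {a<..<x} y - \<phi> y\<bar> \<partial>lborel) < e / (3 * (K + 1))"
      by (rule test_fun_approximates_interval[OF x, of "e / (3 * (K + 1))"]) (use e K0 in auto)
    define L where "L k = (LINT y:?U|lborel. f k y * \<phi> y)" for k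
    have Lh: "L k = (\<integral>y. h k y * \<phi> y \<partial>lborel)" for k
      by (simp add: L_def set_lebesgue_integral_def h_def mult.assoc)
    have close: "\<bar>Pk k x - L k\<bar> < e / 3" for k
    proof -
      have hp: "integrable lborel (\<lambda>y. h k y * \<phi> y)"
        by (rule integrable_mult_bounded[OF h, of \<phi> 1]) (use test_fun_borel[OF \<phi>(1)] \<phi>(2) in \<open>auto simp: abs_le_iff intro: order_trans[of _ 0]\<close>)
      have pi: "integrable lborel \<phi>" by (rule test_fun_integrable[OF test_fun_mono[OF \<phi>(1)]]) simp
      note io = integrable_indicator_Ioo[of a x]
      have "Pk k x - L k = (\<integral>y. h k y * indicator {a<..<x} y - h k y * \<phi> y \<partial>lborel)"
        unfolding Pk_def Lh by (rule Bochner_Integration.integral_diff[symmetric]) (auto intro: hi hp)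
      also have "\<bar>\<dots>\<bar> \<le> (\<integral>y. \<bar>h k y * indicator {a<..<x} y - h k y * \<phi> y\<bar> \<partial>lborel)"
        by (rule integral_abs_bound)
      also have "\<dots> \<le> (\<integral>y. K * \<bar>indicator {a<..<x} y - \<phi> y\<bar> \<partial>lborel)"
      proof (rule integral_mono)
        show "integrable lborel (\<lambda>y. \<bar>h k y * indicator {a<..<x} y - h k y * \<phi> y\<bar>)"
          by (intro integrable_abs Bochner_Integration.integrable_diff hi hp) auto
        show "integrable lborel (\<lambda>y. K * \<bar>indicator {a<..<x} y - \<phi> y\<bar>)"
          by (intro integrable_mult_right integrable_abs Bochner_Integration.integrable_diff io pi)
        fix y
        have "\<bar>h k y\<bar> * \<bar>indicator {a<..<x} y - \<phi> y\<bar> \<le> K * \<bar>indicator {a<..<x} y - \<phi> y\<bar>"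
          using hK(2)[of k y] by (intro mult_right_mono) auto
        then show "\<bar>h k y * indicator {a<..<x} y - h k y * \<phi> y\<bar> \<le> K * \<bar>indicator {a<..<x} y - \<phi> y\<bar>"
          by (simp add: right_diff_distrib[symmetric] abs_mult)
      qed
      also have "\<dots> = K * (\<integral>y. \<bar>indicator {a<..<x} y - \<phi> y\<bar> \<partial>lborel)" by simp
      also have "\<dots> \<le> K * (e / (3 * (K + 1)))" using \<phi>(3) K0 by (intro mult_left_mono) auto
      also have "\<dots> < e / 3" using e K0 by (simp add: field_simps)
      finally show ?thesis .
    qed
    have "Cauchy L" using LIMSEQ_imp_Cauchy[OF lim[OF \<phi>(1)]] by (simp add: L_def[abs_def])
    then obtain N where N: "\<And>k l. N \<le> k \<Longrightarrow> N \<le> l \<Longrightarrow> dist (L k) (L l) < e / 3"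
      using e unfolding Cauchy_def by (metis zero_less_divide_iff zero_less_numeral)
    have "dist (Pk k x) (Pk l x) < e" if "N \<le> k" "N \<le> l" for k l
      using close[of k] close[of l] N[OF that] unfolding dist_real_def by linarith
    then show "\<exists>N. \<forall>k\<ge>N. \<forall>l\<ge>N. dist (Pk k x) (Pk l x) < e" by blast
  qed
  \<comment> \<open>Clamping x to [a, b] extends the limit to the whole line without spoiling
    monotonicity or the Lipschitz constant.\<close>
  define P where "P x = lim (\<lambda>k. Pk k (max a (min b x)))" for x
  have Plim: "(\<lambda>k. Pk k (max a (min b x))) \<longlonglongrightarrow> P x" for x
    unfolding P_def using conv[of "max a (min b x)"] ab by (simp add: convergent_LIMSEQ_iff)
  have P: "0 \<le> P y - P x \<and> P y - P x \<le> y - x" if "x \<le> y" for x y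
  proof -
    let ?x = "max a (min b x)" and ?y = "max a (min b y)"
    have xy: "a \<le> ?x" "?x \<le> ?y" "?y \<le> b" using that ab by auto
    have l: "(\<lambda>k. Pk k ?y - Pk k ?x) \<longlonglongrightarrow> P y - P x" by (intro tendsto_diff Plim)
    have "0 \<le> P y - P x" using Pk_mono[OF xy] by (intro LIMSEQ_le_const[OF l]) auto
    moreover have "P y - P x \<le> 1 * (?y - ?x)"
      by (rule LIMSEQ_le[OF l tendsto_mult[OF C tendsto_const]]) (use Pk_mono[OF xy] in auto)
    moreover have "?y - ?x \<le> y - x" using that by (auto simp: max_def min_def)
    ultimately show ?thesis by simp
  qed
  obtain g where g: "g \<in> borel_measurable borel" "\<And>x. 0 \<le> g x \<and> g x \<le> 1" "ac_on UNIV P g"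
    using density_of_Lipschitz[OF P] by (metis (no_types, lifting))
  have gl: "loc_integrable ?U g"
    unfolding loc_integrable_def
  proof (intro allI impI, elim conjE)
    fix S assume S: "compact S" "S \<subseteq> ?U"
    have "set_integrable lborel {a..b} g" using g(3) ab by (auto simp: ac_on_def)
    then show "set_integrable lborel S g"
      by (rule set_integrable_subset) (use S compact_imp_closed[OF S(1)] in auto)
  qed
  have PU: "max a (min b x) = x" if "x \<in> ?U" for x using that by auto
  have rep: "F \<phi> = distr_of ?U g \<phi>" if \<phi>: "test_fun ?U \<phi>" for \<phi>
  proof -
    have acP: "ac_on ?U P g" by (rule ac_on_subset[OF g(3)]) simp
    have acPk: "ac_on ?U (Pk k) (f k)" for k unfolding ac_on_def using Pk_diff by auto
    have fl: "loc_integrable ?U (f k)" for k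
      unfolding loc_integrable_def using set_integrable_subset[OF fi[of k]]
      by (auto intro: borel_closed[OF compact_imp_closed])
    have 1: "(LINT x:?U|lborel. f k x * \<phi> x) = - (LINT x:?U|lborel. Pk k x * deriv \<phi> x)" for k
      using ac_on_imp_weak[OF _ acPk fl \<phi>, of k] by simp
    have 2: "(LINT x:?U|lborel. g x * \<phi> x) = - (LINT x:?U|lborel. P x * deriv \<phi> x)"
      using ac_on_imp_weak[OF _ acP gl \<phi>] by simp
    note \<phi>' = test_fun_deriv[OF \<phi>]
    obtain D where D: "\<And>x. \<bar>deriv \<phi> x\<bar> \<le> D" using test_fun_bounded[OF \<phi>'] by blast
    have Pk0: "Pk k a = 0" for k by (simp add: Pk_def)
    have PkK: "\<bar>Pk k x\<bar> \<le> K * (b - a)" if "x \<in> ?U" for k x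
    proof -
      have "0 \<le> Pk k x" "Pk k x \<le> C k * (x - a)" using Pk_mono[of a x k] that Pk0 by auto
      moreover have "C k * (x - a) \<le> K * (b - a)" using K[of k] that K0 by (intro mult_mono) auto
      ultimately show ?thesis by auto
    qed
    have "(\<lambda>k. LINT x:?U|lborel. Pk k x * deriv \<phi> x) \<longlonglongrightarrow> (LINT x:?U|lborel. P x * deriv \<phi> x)"
      unfolding set_lebesgue_integral_def
    proof (rule integral_dominated_convergence)
      show "integrable lborel (\<lambda>x. indicator ?U x * (K * (b - a) * D))"
        by (intro integrable_mult_left integrable_indicator_Ioo)
      have m: "(\<lambda>x. indicator ?U x *\<^sub>R (p x * deriv \<phi> x)) \<in> borel_measurable lborel" if "continuous_on ?U p" for p
        using borel_measurable_continuous_on_indicator[OF _ continuous_on_mult[OF that smooth_continuous_on[OF test_fun_smooth[OF \<phi>'], of ?U]]]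
        by simp
      show "(\<lambda>x. indicator ?U x *\<^sub>R (P x * deriv \<phi> x)) \<in> borel_measurable lborel"
        by (rule m[OF ac_on_continuous_on[OF _ acP]]) simp
      show "(\<lambda>x. indicator ?U x *\<^sub>R (Pk k x * deriv \<phi> x)) \<in> borel_measurable lborel" for k
        by (rule m[OF ac_on_continuous_on[OF _ acPk]]) simp
      show "AE x in lborel. (\<lambda>k. indicator ?U x *\<^sub>R (Pk k x * deriv \<phi> x)) \<longlonglongrightarrow> indicator ?U x *\<^sub>R (P x * deriv \<phi> x)"
      proof (rule AE_I2)
        fix x show "(\<lambda>k. indicator ?U x *\<^sub>R (Pk k x * deriv \<phi> x)) \<longlonglongrightarrow> indicator ?U x *\<^sub>R (P x * deriv \<phi> x)"
        proof (cases "x \<in> ?U")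
          case True
          then have "(\<lambda>k. Pk k x) \<longlonglongrightarrow> P x" using Plim[of x] PU by simp
          then show ?thesis by (intro tendsto_intros)
        qed simp
      qed
      show "AE x in lborel. norm (indicator ?U x *\<^sub>R (Pk k x * deriv \<phi> x)) \<le> indicator ?U x * (K * (b - a) * D)" for k
      proof (rule AE_I2)
        fix x
        have "\<bar>Pk k x\<bar> * \<bar>deriv \<phi> x\<bar> \<le> K * (b - a) * D" if "x \<in> ?U"
          using PkK[OF that] D K0 ab by (intro mult_mono) auto
        then show "norm (indicator ?U x *\<^sub>R (Pk k x * deriv \<phi> x)) \<le> indicator ?U x * (K * (b - a) * D)"
          by (auto simp: indicator_def abs_mult)
      qed
    qed
    then have "(\<lambda>k. LINT x:?U|lborel. f k x * \<phi> x) \<longlonglongrightarrow> (LINT x:?U|lborel. g x * \<phi> x)"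
      unfolding 1 2 by (rule tendsto_minus)
    then show ?thesis using LIMSEQ_unique[OF lim[OF \<phi>]] by (simp add: distr_of_def)
  qed
  have "Linf ?U g"
    unfolding Linf_def set_borel_measurable_def
    using g(1,2) by (auto intro!: exI[of _ 1] AE_I2)
  then have "Linf_rep ?U F g" using rep by (simp add: Linf_rep_def)
  then show thesis using that g(2) by blast
qed

section \<open>Bounded representatives and the comparison of the sets
  \<open>Sigma_set\<close>\<close>

lemma Linf_integrable:
  fixes g :: "real \<Rightarrow> real"
  assumes "Linf {a<..<b} g" shows "set_integrable lborel {a<..<b} g"
proof -
  obtain C where C: "AE x\<in>{a<..<b} in lborel. \<bar>g x\<bar> \<le> C" using assms by (auto simp: Linf_def)
  show ?thesis
    unfolding set_integrable_def
  proof (rule Bochner_Integration.integrable_bound)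
    show "integrable lborel (\<lambda>x. \<bar>C\<bar> * indicator {a<..<b} x)"
      by (intro integrable_mult_right integrable_indicator_Ioo)
    show "(\<lambda>x. indicator {a<..<b} x *\<^sub>R g x) \<in> borel_measurable lborel"
      using assms by (simp add: Linf_def set_borel_measurable_def)
    show "AE x in lborel. norm (indicator {a<..<b} x *\<^sub>R g x) \<le> norm (\<bar>C\<bar> * indicator {a<..<b} x)"
      using C by eventually_elim (auto simp: indicator_def)
  qed
qed

lemma Linf_loc_integrable:
  "Linf {a<..<b} g \<Longrightarrow> loc_integrable {a<..<b} g" for g :: "real \<Rightarrow> real"
  unfolding loc_integrable_def
proof (intro allI impI, elim conjE)
  fix K assume "Linf {a<..<b} g" "compact K" "K \<subseteq> {a<..<b}"
  then show "set_integrable lborel K g"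
    by (intro set_integrable_subset[OF Linf_integrable]) (simp_all add: borel_closed compact_imp_closed)
qed

text \<open>This carries the bound by 1 from the representative that was constructed to an arbitrary
  one.\<close>

lemma Linf_rep_unique:
  fixes F :: distr
  assumes "Linf_rep {a<..<b} F g" "Linf_rep {a<..<b} F g'"
  shows "AE x in lborel. x \<in> {a<..<b} \<longrightarrow> g x = g' x"
proof -
  have l: "loc_integrable {a<..<b} g" "loc_integrable {a<..<b} g'"
    using assms by (auto simp: Linf_rep_def intro: Linf_loc_integrable)
  have "AE x in lborel. x \<in> {a<..<b} \<longrightarrow> g x - g' x = 0"
  proof (rule fundamental_lemma[OF _ loc_integrable_diff[OF l]])
    fix \<phi> assume \<phi>: "test_fun {a<..<b} \<phi>"
    have "(LINT x:{a<..<b}|lborel. g x * \<phi> x) = (LINT x:{a<..<b}|lborel. g' x * \<phi> x)"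
      using assms \<phi> unfolding Linf_rep_def distr_of_def by metis
    then show "(LINT x:{a<..<b}|lborel. (g x - g' x) * \<phi> x) = 0"
      using loc_integrable_mult_test[OF l(1) \<phi>] loc_integrable_mult_test[OF l(2) \<phi>]
      by (simp add: left_diff_distrib set_integral_diff)
  qed simp
  then show ?thesis by eventually_elim auto
qed

text \<open>Only fourth powers are available as test functions for the comparison; those of bump functions suffice.\<close>

lemma Sigma_set_mono:
  fixes F G :: distr
  assumes F: "Linf_rep {a<..<b} F f" "AE x in lborel. x \<in> {a<..<b} \<longrightarrow> f x \<le> 1"
    and G: "Linf_rep {a<..<b} G g" "AE x in lborel. x \<in> {a<..<b} \<longrightarrow> g x \<le> 1"
    and le: "\<And>h. test_fun {a<..<b} h \<Longrightarrow> (\<And>x. 0 \<le> h x) \<Longrightarrow> F (\<lambda>x. (h x)^4) \<le> G (\<lambda>x. (h x)^4)"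
  shows "Sigma_set {a<..<b} f \<subseteq> Sigma_set {a<..<b} g"
proof
  let ?U = "{a<..<b}"
  fix x assume "x \<in> Sigma_set ?U f"
  then obtain r where x: "x \<in> ?U" and r: "0 < r" and 0: "(LINT y:ball x r \<inter> ?U|lborel. 1 - f y) = 0"
    by (auto simp: Sigma_set_def)
  have fi: "set_integrable lborel ?U f" and gi: "set_integrable lborel ?U g"
    using F(1) G(1) by (auto simp: Linf_rep_def intro: Linf_integrable)
  have one: "set_integrable lborel ?U (\<lambda>_. 1::real)"
    using integrable_indicator_Ioo by (simp add: set_integrable_def)
  have i1: "set_integrable lborel V (\<lambda>y. 1 - q y)"
    if "V \<subseteq> ?U" "V \<in> sets borel" "set_integrable lborel ?U q" for V and q :: "real \<Rightarrow> real"
    using set_integrable_subset[OF set_integral_diff(1)[OF one that(3)]] that by simp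
  have f1: "AE y in lborel. y \<in> ball x r \<inter> ?U \<longrightarrow> f y = 1"
  proof -
    have "AE y in lborel. indicator (ball x r \<inter> ?U) y *\<^sub>R (1 - f y) = 0"
    proof (rule integral_nonneg_eq_0_iff_AE[THEN iffD1])
      show "integrable lborel (\<lambda>y. indicator (ball x r \<inter> ?U) y *\<^sub>R (1 - f y))"
        using i1[OF _ _ fi, of "ball x r \<inter> ?U"] by (simp add: set_integrable_def)
      show "AE y in lborel. 0 \<le> indicator (ball x r \<inter> ?U) y *\<^sub>R (1 - f y)"
        using F(2) by eventually_elim (auto simp: indicator_def)
      show "(\<integral>y. indicator (ball x r \<inter> ?U) y *\<^sub>R (1 - f y) \<partial>lborel) = 0"
        using 0 by (simp add: set_lebesgue_integral_def)
    qed
    then show ?thesis by eventually_elim (auto simp: indicator_def)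
  qed
  have "open (ball x r \<inter> ?U)" "x \<in> ball x r \<inter> ?U" using x r by auto
  then obtain q where q: "0 < q" "cball x q \<subseteq> ball x r \<inter> ?U" using open_contains_cball by blast
  define c d where "c = x - q" and "d = x + q"
  have cd: "{c..d} \<subseteq> ball x r \<inter> ?U" using q by (simp add: c_def d_def cball_eq_atLeastAtMost)
  define h where "h = bump c d"
  have h: "test_fun ?U h" unfolding h_def by (rule test_fun_bump) (use cd in auto)
  have h0: "0 \<le> h y" for y by (simp add: h_def bump_nonneg)
  define \<phi> where "\<phi> = (\<lambda>x. (h x)^4)"
  have \<phi>: "test_fun ?U \<phi>"
    unfolding \<phi>_def using test_fun_power[OF h(1), of 4] by (simp)
  have \<phi>0: "0 \<le> \<phi> y" "y \<notin> {c<..<d} \<Longrightarrow> \<phi> y = 0" "y \<in> {c<..<d} \<Longrightarrow> \<phi> y \<noteq> 0" for y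
    using h0[of y] bump_eq_0_iff[of c d y] by (auto simp: \<phi>_def h_def)
  have pi: "set_integrable lborel ?U (\<lambda>y. q y * \<phi> y)" if "set_integrable lborel ?U q" for q :: "real \<Rightarrow> real"
    using test_fun_bounded[OF \<phi>] set_integrable_mult_bounded[OF that test_fun_borel[OF \<phi>]] by metis
  have "(LINT y:?U|lborel. f y * \<phi> y) = (LINT y:?U|lborel. 1 * \<phi> y)"
    unfolding set_lebesgue_integral_def
  proof (rule integral_cong_AE)
    show "AE y in lborel. indicator ?U y *\<^sub>R (f y * \<phi> y) = indicator ?U y *\<^sub>R (1 * \<phi> y)"
      using f1
    proof eventually_elim
      case (elim y)
      show ?case
      proof (cases "y \<in> {c<..<d}")
        case True
        then have "y \<in> {c..d}" by auto
        then have "y \<in> ball x r \<inter> ?U" using cd by blast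
        then show ?thesis using elim by simp
      qed (simp add: \<phi>0)
    qed
  qed (use pi[OF fi] pi[OF one] in \<open>auto simp: set_integrable_def\<close>)
  moreover have "F \<phi> = (LINT y:?U|lborel. f y * \<phi> y)" "G \<phi> = (LINT y:?U|lborel. g y * \<phi> y)"
    using F(1) G(1) \<phi> by (auto simp: Linf_rep_def distr_of_def)
  moreover have "F \<phi> \<le> G \<phi>" unfolding \<phi>_def by (rule le[OF h h0])
  ultimately have "(LINT y:?U|lborel. 1 * \<phi> y) \<le> (LINT y:?U|lborel. g y * \<phi> y)" by simp
  moreover have "(LINT y:?U|lborel. 1 * \<phi> y - g y * \<phi> y) = (LINT y:?U|lborel. 1 * \<phi> y) - (LINT y:?U|lborel. g y * \<phi> y)"
    by (intro set_integral_diff pi gi one)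
  \<comment> \<open>As f = 1 on the support of \<phi>, the value F \<phi> is the integral of \<phi>,
    the largest value possible for G \<phi> when g \<le> 1. So G \<phi> \<ge> F \<phi> leaves no
    room, and g = 1 almost everywhere where \<phi> is positive.\<close>
  ultimately have neg: "(LINT y:?U|lborel. 1 * \<phi> y - g y * \<phi> y) \<le> 0" by simp
  have di: "set_integrable lborel ?U (\<lambda>y. 1 * \<phi> y - g y * \<phi> y)" by (intro set_integral_diff pi gi one)
  have nn: "AE y in lborel. 0 \<le> indicator ?U y *\<^sub>R (1 * \<phi> y - g y * \<phi> y)"
    using G(2)
  proof eventually_elim
    case (elim y)
    have "g y * \<phi> y \<le> 1 * \<phi> y" if "y \<in> ?U" using elim that \<phi>0(1)[of y] by (intro mult_right_mono) auto
    then show ?case by (auto simp: indicator_def)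
  qed
  have "AE y in lborel. indicator ?U y *\<^sub>R (1 * \<phi> y - g y * \<phi> y) = 0"
  proof (rule integral_nonneg_eq_0_iff_AE[THEN iffD1, OF _ nn])
    show "integrable lborel (\<lambda>y. indicator ?U y *\<^sub>R (1 * \<phi> y - g y * \<phi> y))"
      using di by (simp add: set_integrable_def)
    show "(\<integral>y. indicator ?U y *\<^sub>R (1 * \<phi> y - g y * \<phi> y) \<partial>lborel) = 0"
      using neg integral_nonneg_AE[OF nn] by (simp add: set_lebesgue_integral_def)
  qed
  then have "AE y in lborel. indicator (ball x q \<inter> ?U) y *\<^sub>R (1 - g y) = 0"
  proof eventually_elim
    case (elim y)
    show ?case
    proof (cases "y \<in> ball x q \<inter> ?U")
      case True
      then have "\<phi> y \<noteq> 0" by (intro \<phi>0(3)) (auto simp: c_def d_def dist_real_def)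
      moreover have "(1 - g y) * \<phi> y = 0" using elim True by (simp add: left_diff_distrib)
      ultimately show ?thesis by simp
    qed simp
  qed
  then have "(LINT y:ball x q \<inter> ?U|lborel. 1 - g y) = 0"
    unfolding set_lebesgue_integral_def by (rule integral_eq_zero_AE)
  then show "x \<in> Sigma_set ?U g" using x q by (auto simp: Sigma_set_def)
qed

section \<open>Passage to the limit\<close>

lemma film_bounded_weak_limit:
  assumes film: "\<And>i. film a b n (\<epsilon> i) C0 \<Omega> (u i) (ux i) (uxx i) (uxxx i)"
    and \<epsilon>: "(\<lambda>i. 1 / \<bar>ln (\<epsilon> i)\<bar>) \<longlonglongrightarrow> 0" and t: "0 < t"
    and lim: "\<And>\<phi>. test_fun \<Omega> \<phi> \<Longrightarrow> (\<lambda>i. LINT x:\<Omega>|lborel. B_eps n (\<epsilon> i) (u i t x) * \<phi> x) \<longlonglongrightarrow> F \<phi>"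
  obtains g where "Linf_rep \<Omega> F g" "\<And>x. 0 \<le> g x \<and> g x \<le> 1"
proof -
  \<comment> \<open>M depends only on a, b and C0, so the instance for index 0 provides the bound
    for all indices.\<close>
  interpret f0: film a b n "\<epsilon> 0" C0 \<Omega> "u 0" "ux 0" "uxx 0" "uxxx 0" by (rule film)
  have \<Omega>: "\<Omega> = {a<..<b}" by (rule f0.\<Omega>)
  define C where "C i = 1 + (B n 1 + ln f0.M) / \<bar>ln (\<epsilon> i)\<bar>" for i
  have "(\<lambda>i. 1 + (B n 1 + ln f0.M) * (1 / \<bar>ln (\<epsilon> i)\<bar>)) \<longlonglongrightarrow> 1 + (B n 1 + ln f0.M) * 0"
    by (intro tendsto_intros \<epsilon>)
  then have C: "C \<longlonglongrightarrow> 1" by (simp add: C_def[abs_def])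
  have b: "0 \<le> B_eps n (\<epsilon> i) (u i t x) \<and> B_eps n (\<epsilon> i) (u i t x) \<le> C i" if "x \<in> {a<..<b}" for i x
    using film.B_eps_u_le[OF film t, of x i] that B_eps_nonneg by (simp add: C_def \<Omega>)
  have i: "set_integrable lborel {a<..<b} (\<lambda>x. B_eps n (\<epsilon> i) (u i t x))" for i
  proof -
    have c: "continuous_on {a<..<b} (\<lambda>x. B_eps n (\<epsilon> i) (u i t x))"
      using film.rho_cont_x[OF film, of t i] t by (simp add: \<Omega>)
    have "Linf {a<..<b} (\<lambda>x. B_eps n (\<epsilon> i) (u i t x))"
      unfolding Linf_def set_borel_measurable_def
      using borel_measurable_continuous_on_indicator[OF _ c] b[of _ i]
      by (auto intro!: exI[of _ "C i"] AE_I2)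
    then show ?thesis by (rule Linf_integrable)
  qed
  show thesis
    using bounded_weak_limit[OF f0.ab i b C lim[unfolded \<Omega>]] that unfolding \<Omega> by blast
qed

lemma film_limit_monotone:
  assumes film: "\<And>i. film a b n (\<epsilon> i) C0 \<Omega> (u i) (ux i) (uxx i) (uxxx i)"
    and \<epsilon>: "(\<lambda>i. 1 / \<bar>ln (\<epsilon> i)\<bar>) \<longlonglongrightarrow> 0" and st: "0 < s" "s < t"
    and h: "test_fun \<Omega> h" "\<And>x. 0 \<le> h x"
    and lims: "(\<lambda>i. LINT x:\<Omega>|lborel. B_eps n (\<epsilon> i) (u i s x) * (h x)^4) \<longlonglongrightarrow> ls"
    and limt: "(\<lambda>i. LINT x:\<Omega>|lborel. B_eps n (\<epsilon> i) (u i t x) * (h x)^4) \<longlonglongrightarrow> lt"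
  shows "ls \<le> lt"
proof -
  interpret f0: film a b n "\<epsilon> 0" C0 \<Omega> "u 0" "ux 0" "uxx 0" "uxxx 0" by (rule film)
  have \<phi>: "test_fun \<Omega> (\<lambda>x. (h x)^4)"
    using test_fun_power[OF h(1), of 4] by (simp)
  obtain c0 where c0: "\<And>x. \<bar>(h x)^4\<bar> \<le> c0" using test_fun_bounded[OF \<phi>] by blast
  obtain c1 where c1: "\<And>x. \<bar>deriv h x\<bar> \<le> c1" using test_fun_bounded[OF test_fun_deriv[OF h(1)]] by blast
  obtain c3 where c3: "\<And>x. \<bar>deriv (\<lambda>x. (h x)^4) x\<bar> \<le> c3" using test_fun_bounded[OF test_fun_deriv[OF \<phi>]] by blast
  obtain c2 where c2: "\<And>x. \<bar>deriv (deriv (\<lambda>x. (h x)^4)) x\<bar> \<le> c2"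
    using test_fun_bounded[OF test_fun_deriv[OF test_fun_deriv[OF \<phi>]]] by blast
  have c0': "(h x)^4 \<le> c0" for x using c0[of x] by (simp add: abs_le_iff)
  \<comment> \<open>E1 collects the errors that survive \<epsilon> -> 0 and vanish with \<delta>;
    E2, defined next, is the coefficient of 1 / |ln \<epsilon>|. Its negative powers of \<delta>
    dictate the order of the two limits.\<close>
  define E1 where "E1 \<delta> = (417 * c1^4 * \<delta>\<^sup>2 * (\<delta> + f0.M) * (b - a) + \<delta> * (c0 + c2) * (2 * C0)) * (t + 1 - s)
      + c3 * \<delta> / 2 * ((t + 1 - s) * (b - a))" for \<delta>
  define E2 where "E2 \<delta> = c0 / (8 * \<delta>\<^sup>2) * C0 + c3 * (2 * f0.M + 9 / n\<^sup>2) / (2 * \<delta>) * C0" for \<delta>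
  have step: "- E1 \<delta> \<le> lt - ls" if \<delta>: "0 < \<delta>" "\<delta> \<le> 1" for \<delta>
  proof -
    have "- (E1 \<delta> + E2 \<delta> * (1 / \<bar>ln (\<epsilon> i)\<bar>)) \<le> (LINT x:\<Omega>|lborel. B_eps n (\<epsilon> i) (u i t x) * (h x)^4)
        - (LINT x:\<Omega>|lborel. B_eps n (\<epsilon> i) (u i s x) * (h x)^4)" for i
      using film.increment_lower_bound[OF film h \<delta> c0' c1 c2 c3 st, of i]
      by (simp add: E1_def E2_def add_divide_distrib distrib_right)
    moreover have "(\<lambda>i. - (E1 \<delta> + E2 \<delta> * (1 / \<bar>ln (\<epsilon> i)\<bar>))) \<longlonglongrightarrow> - (E1 \<delta> + E2 \<delta> * 0)"
      by (intro tendsto_intros \<epsilon>)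
    ultimately have "- (E1 \<delta> + E2 \<delta> * 0) \<le> lt - ls"
      by (intro LIMSEQ_le[OF _ tendsto_diff[OF limt lims]]) auto
    then show ?thesis by simp
  qed
  have "(\<lambda>j. 1 / real (Suc j)) \<longlonglongrightarrow> 0" by (rule LIMSEQ_Suc[OF lim_1_over_n])
  then have "(\<lambda>j. - E1 (1 / real (Suc j))) \<longlonglongrightarrow> - E1 0"
    unfolding E1_def by (intro tendsto_intros) auto
  moreover have "E1 0 = 0" by (simp add: E1_def)
  ultimately have "(\<lambda>j. - E1 (1 / real (Suc j))) \<longlonglongrightarrow> 0" by simp
  then have "0 \<le> lt - ls"
    by (rule LIMSEQ_le_const2) (auto intro!: exI[of _ 0] step)
  then show ?thesis by simp
qed

theorem corollary1p6:
  fixes a b n p :: real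
    and \<Omega> :: "real set"
    and u_in :: "real \<Rightarrow> real"
    and u :: "real \<Rightarrow> real \<Rightarrow> real \<Rightarrow> real"
    and \<epsilon> :: "nat \<Rightarrow> real"
    and \<rho> :: "real \<Rightarrow> distr"
  assumes "a < b" and "\<Omega> = {a<..<b}"
    and "0 < n" and "n < 3"
    and "in_H1 \<Omega> u_in"
    and "AE x\<in>\<Omega> in lborel. 0 \<le> u_in x"
    and "(LINT x:\<Omega>|lborel. u_in x) = 1"
    and "\<And>e. 0 < e \<Longrightarrow> e \<le> 1/2 \<Longrightarrow> thin_film_solution \<Omega> n u_in e (u e)"
    and "\<And>k. 0 < \<epsilon> k \<and> \<epsilon> k \<le> 1/2" and "\<epsilon> \<longlonglongrightarrow> 0"
    and "1 \<le> p"
    and "\<And>T. 0 < T \<Longrightarrow>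
           converges_Lp_W p T \<Omega> (\<lambda>k t. distr_of \<Omega> (\<lambda>x. B_eps n (\<epsilon> k) (u (\<epsilon> k) t x))) \<rho>"
  shows "\<exists>N\<in>null_sets lborel.
           (\<forall>t. 0 < t \<and> t \<notin> N \<longrightarrow> (\<exists>g. Linf_rep \<Omega> (\<rho> t) g)) \<and>
           (\<forall>s t g_s g_t. 0 < s \<and> s < t \<and> s \<notin> N \<and> t \<notin> N \<and>
              Linf_rep \<Omega> (\<rho> s) g_s \<and> Linf_rep \<Omega> (\<rho> t) g_t \<longrightarrow>
              Sigma_set \<Omega> g_s \<subseteq> Sigma_set \<Omega> g_t)"
proof -
  note \<Omega> = assms(2)
  obtain C0 where C0: "\<And>\<epsilon> u. 0 < \<epsilon> \<Longrightarrow> \<epsilon> \<le> 1/2 \<Longrightarrow> thin_film_solution \<Omega> n u_in \<epsilon> u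
      \<Longrightarrow> \<exists>ux uxx uxxx. film a b n \<epsilon> C0 \<Omega> u ux uxx uxxx"
    using thin_film_solution_film[OF assms(1-5) assms(7)] by metis
  \<comment> \<open>The three derivatives are packed into a triple so that a single choice selects
    them for all k.\<close>
  have "\<forall>k. \<exists>v. film a b n (\<epsilon> k) C0 \<Omega> (u (\<epsilon> k)) (fst v) (fst (snd v)) (snd (snd v))"
  proof
    fix k
    obtain ux uxx uxxx where "film a b n (\<epsilon> k) C0 \<Omega> (u (\<epsilon> k)) ux uxx uxxx"
      using C0[OF _ _ assms(8)] assms(9)[of k] by blast
    then show "\<exists>v. film a b n (\<epsilon> k) C0 \<Omega> (u (\<epsilon> k)) (fst v) (fst (snd v)) (snd (snd v))"
      by (intro exI[of _ "(ux, uxx, uxxx)"]) simp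
  qed
  from choice[OF this] obtain v
    where film: "\<And>k. film a b n (\<epsilon> k) C0 \<Omega> (u (\<epsilon> k)) (fst (v k)) (fst (snd (v k))) (snd (snd (v k)))"
    by blast
  have ln0: "(\<lambda>k. 1 / \<bar>ln (\<epsilon> k)\<bar>) \<longlonglongrightarrow> 0"
  proof -
    have "\<epsilon> k \<in> {0<..} \<and> \<epsilon> k \<noteq> 0" for k using assms(9)[of k] by auto
    then have "filterlim \<epsilon> (at_right 0) sequentially"
      unfolding filterlim_at using assms(10) by simp
    then have "filterlim (\<lambda>k. ln (\<epsilon> k)) at_bot sequentially"
      by (rule filterlim_compose[OF ln_at_0])
    then have "filterlim (\<lambda>k. ln (\<epsilon> k)) at_infinity sequentially"
      by (rule filterlim_at_bot_imp_at_infinity)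
    from tendsto_norm_zero[OF filterlim_compose[OF tendsto_inverse_0 this]] show ?thesis
      by (simp add: divide_inverse)
  qed
  have Ub: "\<Omega> \<in> sets borel" by (simp add: \<Omega>)
  define m where "m k t \<phi> = (LINT x:\<Omega>|lborel. B_eps n (\<epsilon> k) (u (\<epsilon> k) t x) * \<phi> x)" for k t \<phi>
  \<comment> \<open>One subsequence for each time horizon j + 1. Two times s < t will be compared
    along the subsequence of a horizon beyond t, which serves both of them.\<close>
  have "\<exists>r :: nat \<Rightarrow> nat. strict_mono r \<and> (AE t in lborel. t \<in> {0<..<real (Suc j)} \<longrightarrow>
      (\<forall>\<phi>. test_fun \<Omega> \<phi> \<longrightarrow> (\<lambda>k. m (r k) t \<phi>) \<longlonglongrightarrow> \<rho> t \<phi>))" for j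
  proof -
    have "0 < real (Suc j)" by simp
    from converges_Lp_W_AE_subsequence[OF Ub assms(12)[OF this] assms(11)]
    obtain r :: "nat \<Rightarrow> nat" where "strict_mono r" "AE t in lborel. t \<in> {0<..<real (Suc j)} \<longrightarrow>
      (\<forall>\<phi>. test_fun \<Omega> \<phi> \<longrightarrow> (\<lambda>k. distr_of \<Omega> (\<lambda>x. B_eps n (\<epsilon> (r k)) (u (\<epsilon> (r k)) t x)) \<phi>) \<longlonglongrightarrow> \<rho> t \<phi>)"
      by blast
    then show ?thesis unfolding m_def distr_of_def by blast
  qed
  then have "\<exists>r. \<forall>j. strict_mono (r j :: nat \<Rightarrow> nat) \<and> (AE t in lborel. t \<in> {0<..<real (Suc j)} \<longrightarrow>
      (\<forall>\<phi>. test_fun \<Omega> \<phi> \<longrightarrow> (\<lambda>k. m (r j k) t \<phi>) \<longlonglongrightarrow> \<rho> t \<phi>))"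
    by (intro choice allI)
  then obtain r :: "nat \<Rightarrow> nat \<Rightarrow> nat" where r: "\<And>j. strict_mono (r j)"
    and ae: "\<And>j. AE t in lborel. t \<in> {0<..<real (Suc j)} \<longrightarrow>
      (\<forall>\<phi>. test_fun \<Omega> \<phi> \<longrightarrow> (\<lambda>k. m (r j k) t \<phi>) \<longlonglongrightarrow> \<rho> t \<phi>)"
    by blast
  \<comment> \<open>There are countably many horizons, so one null set N works for all pairs of
    times and all test functions.\<close>
  have "AE t in lborel. \<forall>j. t \<in> {0<..<real (Suc j)} \<longrightarrow>
      (\<forall>\<phi>. test_fun \<Omega> \<phi> \<longrightarrow> (\<lambda>k. m (r j k) t \<phi>) \<longlonglongrightarrow> \<rho> t \<phi>)"
    unfolding AE_all_countable using ae by blast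
  from AE_E3[OF this] obtain N where N: "N \<in> null_sets lborel"
    and lim': "\<And>t. t \<notin> N \<Longrightarrow> \<forall>j. t \<in> {0<..<real (Suc j)} \<longrightarrow>
      (\<forall>\<phi>. test_fun \<Omega> \<phi> \<longrightarrow> (\<lambda>k. m (r j k) t \<phi>) \<longlonglongrightarrow> \<rho> t \<phi>)"
    by auto
  have lim: "(\<lambda>k. m (r j k) t \<phi>) \<longlonglongrightarrow> \<rho> t \<phi>"
    if "0 < t" "t < real (Suc j)" "t \<notin> N" "test_fun \<Omega> \<phi>" for j t \<phi>
    using lim'[OF that(3)] that by auto
  have lnr: "(\<lambda>k. 1 / \<bar>ln (\<epsilon> (r j k))\<bar>) \<longlonglongrightarrow> 0" for j
    using LIMSEQ_subseq_LIMSEQ[OF ln0 r[of j]] by (simp add: comp_def)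
  have rep: "\<exists>g. Linf_rep \<Omega> (\<rho> t) g \<and> (\<forall>x. 0 \<le> g x \<and> g x \<le> 1)" if t: "0 < t" "t \<notin> N" for t
  proof -
    obtain j where j: "t < real j" using reals_Archimedean2 by blast
    then have j: "t < real (Suc j)" by simp
    obtain g where "Linf_rep \<Omega> (\<rho> t) g" "\<And>x. 0 \<le> g x \<and> g x \<le> 1"
      using film_bounded_weak_limit[OF film lnr[of j] t(1), of "\<rho> t"]
        lim[OF t(1) j t(2), unfolded m_def] by blast
    then show ?thesis by blast
  qed
  have rep1: "AE x in lborel. x \<in> {a<..<b} \<longrightarrow> g x \<le> 1" if t: "0 < t" "t \<notin> N" and g: "Linf_rep \<Omega> (\<rho> t) g" for t g
  proof -
    obtain g' where g': "Linf_rep \<Omega> (\<rho> t) g'" "\<forall>x. 0 \<le> g' x \<and> g' x \<le> 1" using rep[OF t] by blast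
    have "AE x in lborel. x \<in> {a<..<b} \<longrightarrow> g x = g' x"
      by (rule Linf_rep_unique) (use g g' \<Omega> in auto)
    then show ?thesis by eventually_elim (use g'(2) in auto)
  qed
  have mono: "Sigma_set \<Omega> g_s \<subseteq> Sigma_set \<Omega> g_t"
    if st: "0 < s" "s < t" "s \<notin> N" "t \<notin> N" and g: "Linf_rep \<Omega> (\<rho> s) g_s" "Linf_rep \<Omega> (\<rho> t) g_t" for s t g_s g_t
    unfolding \<Omega>
  proof (rule Sigma_set_mono[OF g(1)[unfolded \<Omega>] _ g(2)[unfolded \<Omega>]])
    show "AE x in lborel. x \<in> {a<..<b} \<longrightarrow> g_s x \<le> 1" "AE x in lborel. x \<in> {a<..<b} \<longrightarrow> g_t x \<le> 1"
      using rep1[OF _ st(3) g(1)] rep1[OF _ st(4) g(2)] st(1,2) by simp_all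
    fix h :: "real \<Rightarrow> real" assume h: "test_fun {a<..<b} h" "\<And>x. 0 \<le> h x"
    have \<phi>: "test_fun \<Omega> (\<lambda>x. (h x)^4)"
      using test_fun_power[OF h(1), of 4] by (simp add: \<Omega>)
    obtain j where "t < real j" using reals_Archimedean2 by blast
    then have j: "t < real (Suc j)" by simp
    show "\<rho> s (\<lambda>x. (h x)^4) \<le> \<rho> t (\<lambda>x. (h x)^4)"
    proof (rule film_limit_monotone[OF film lnr[of j] st(1,2) h(1)[folded \<Omega>] h(2)])
      show "(\<lambda>i. LINT x:\<Omega>|lborel. B_eps n (\<epsilon> (r j i)) (u (\<epsilon> (r j i)) s x) * (h x)^4) \<longlonglongrightarrow> \<rho> s (\<lambda>x. (h x)^4)"
        using lim[OF _ _ st(3) \<phi>, of j] st j by (simp add: m_def)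
      show "(\<lambda>i. LINT x:\<Omega>|lborel. B_eps n (\<epsilon> (r j i)) (u (\<epsilon> (r j i)) t x) * (h x)^4) \<longlonglongrightarrow> \<rho> t (\<lambda>x. (h x)^4)"
        using lim[OF _ _ st(4) \<phi>, of j] st j by (simp add: m_def)
    qed
  qed
  show ?thesis
  proof (rule bexI[OF _ N], intro conjI allI impI)
    fix t assume "0 < t \<and> t \<notin> N"
    then show "\<exists>g. Linf_rep \<Omega> (\<rho> t) g" using rep by blast
  next
    fix s t g_s g_t
    assume "0 < s \<and> s < t \<and> s \<notin> N \<and> t \<notin> N \<and> Linf_rep \<Omega> (\<rho> s) g_s \<and> Linf_rep \<Omega> (\<rho> t) g_t"
    then show "Sigma_set \<Omega> g_s \<subseteq> Sigma_set \<Omega> g_t" using mono by blast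
  qed
qed

end
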